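(* Let $\omega:\mathbb{R}^d\to\mathbb{R}$ (the dispersion relation) be continuous, and let $U(t)$ be the Fourier multiplier operator with symbol $e^{-it\omega(\xi)}$. Suppose there exist $\phi\in\mathcal{E}'(\mathbb{R}^d)\setminus\{0\}$ and $t\in\mathbb{R}\setminus\{0\}$ such that $\operatorname{supp}(U(t)\phi)$ is compact. (1) For $d\ge 2$ and for each $1\le j\le d$, there exist a non-open subset $Z_j\subseteq\mathbb{R}^{d-1}$ and a simply-connected open subset $\Omega_j\subseteq\mathbb{C}$ such that whenever $\xi_j'\in\mathbb{R}^{d-1}\setminus Z_j$, the map $\xi_j\mapsto\omega(\xi_j;\xi_j')$ has an analytic extension $z_j\mapsto\omega(z_j;\xi_j')$ for $z_j\in\Omega_j$. More precisely, for each $1\le j\le d$ and $\xi_j'\in\mathbb{R}^{d-1}\setminus Z_j$, there exists a countable subset $E_j\subseteq\mathbb{C}\setminus\mathbb{R}$ with no accumulation points such that $\Omega_j=\mathbb{C}\setminus\bigcup_{z\in E_j}\gamma_z$. If $d=1$, then there exists a countable subset $E_1\subseteq\mathbb{C}\setminus\mathbb{R}$ with no accumulation points such that $\omega(\xi_1)$ has an analytic extension $\omega(z_1)$ for $z_1\in\Omega_1=\mathbb{C}\setminus\bigcup_{z\in E_1}\gamma_z$. (2) Furthermore, if $Z_j=\emptyset$ for all $1\le j\le d$ (which vacuously holds for $d=1$), and if $z_j\mapsto\omega(z_j;\xi_j')$ is holomorphic on some punctured disk centered at every point in $E_j$ for all $\xi_j'\in\mathbb{R}^{d-1}$, then $$\omega(\xi)=\sum_{|\boldsymbol\alpha|\le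 1}a_{\boldsymbol\alpha}\xi^{\boldsymbol\alpha}$$ for some $a_{\boldsymbol\alpha}\in\mathbb{R}$, where the sum is over multi-indices $\boldsymbol\alpha\in\mathbb{N}_0^d$.
   Context: $\mathcal{E}'(\mathbb{R}^d)$ is the space of compactly supported distributions on $\mathbb{R}^d$. The Fourier transform is $\widehat f(\xi)=\int f(x)e^{-ix\cdot\xi}\,dx$, with inverse $\mathcal{F}^{-1}[f](x)=(2\pi)^{-d}\int f(\xi)e^{ix\cdot\xi}\,d\xi$, extended to tempered distributions. $U(t)\phi=\mathcal{F}^{-1}[e^{-it\omega}\widehat\phi]$ is the solution at time $t$ of $i\partial_t u=Lu$, $u(\cdot,0)=\phi$, where $\widehat{Lf}=\omega\widehat f$. For a function $h(x_1,\dots,x_d)$ and $1\le j\le d$, $x_j'$ denotes the remaining variables $(x_1,\dots,x_{j-1},x_{j+1},\dots,x_d)$, regarded as an element of $\mathbb{R}^{d-1}$, and $x_j\mapsto h(x_j;x_j')$ is $h$ as a function of its $j$th variable with the others fixed. For $z\in\mathbb{C}$ with $\operatorname{Im}z\neq0$, $\gamma_z$ is the vertical ray $\{\xi+i\eta:\xi=\operatorname{Re}z,\ \eta\ge\operatorname{Im}z\}$ if $\operatorname{Im}z>0$, and $\{\xi+i\eta:\xi=\operatorname{Re}z,\ \eta\le\operatorname{Im}z\}$ if $\operatorname{Im}z<0$.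
   Formalization: E_j is also required to contain all singularities: at points of the rays outside E_j the extension continues analytically from each side (proved in (1), assumed in (2), which is false without it). "Non-open Z_j" is read as "empty or not open"; Ω_j depends on ξ_j'. *)

theory Defs
  imports "HOL-Complex_Analysis.Complex_Analysis"
begin

section \<open>Test functions and Schwartz functions\<close>

definition partial_deriv :: "'n \<Rightarrow> (real ^ 'n \<Rightarrow> complex) \<Rightarrow> real ^ 'n \<Rightarrow> complex" where
  "partial_deriv i f x = vector_derivative (\<lambda>s. f (x + s *\<^sub>R axis i 1)) (at 0)"

primrec iter_partial :: "'n list \<Rightarrow> (real ^ 'n \<Rightarrow> complex) \<Rightarrow> real ^ 'n \<Rightarrow> complex" where
  "iter_partial [] f = f"
| "iter_partial (i # is) f = partial_deriv i (iter_partial is f)"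

definition smooth :: "(real ^ 'n \<Rightarrow> complex) \<Rightarrow> bool" where
  "smooth f \<longleftrightarrow> (\<forall>is. iter_partial is f differentiable_on UNIV)"

abbreviation fun_support :: "(real ^ 'n \<Rightarrow> complex) \<Rightarrow> (real ^ 'n) set" where
  "fun_support f \<equiv> closure {x. f x \<noteq> 0}"

definition test_functions :: "(real ^ 'n \<Rightarrow> complex) set" where
  "test_functions = {f. smooth f \<and> compact (fun_support f)}"

definition schwartz_functions :: "(real ^ 'n \<Rightarrow> complex) set" where
  "schwartz_functions =
    {f. smooth f \<and> (\<forall>k is. bounded (range (\<lambda>x. (1 + norm x) ^ k * norm (iter_partial is f x))))}"

text \<open>
  The supremum below is finite on Schwartz functions, hence on test functions, since there are
  only finitely many lists of length at most \<open>N\<close> over the finite index type.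
\<close>

definition schwartz_seminorm :: "nat \<Rightarrow> nat \<Rightarrow> (real ^ 'n \<Rightarrow> complex) \<Rightarrow> real" where
  "schwartz_seminorm k N f =
    (SUP (is, x) \<in> {is. length is \<le> N} \<times> UNIV. (1 + norm x) ^ k * norm (iter_partial is f x))"

section \<open>Distributions\<close>

text \<open>
  Distributions and tempered distributions are represented by functionals on all functions
  \<open>real ^ 'n \<Rightarrow> complex\<close>, of which only the values on test functions, respectively on Schwartz
  functions, are meaningful.
\<close>

definition linear_functional_on ::
    "(real ^ 'n \<Rightarrow> complex) set \<Rightarrow> ((real ^ 'n \<Rightarrow> complex) \<Rightarrow> complex) \<Rightarrow> bool" where
  "linear_functional_on S u \<longleftrightarrow>
    (\<forall>f\<in>S. \<forall>g\<in>S. \<forall>a b. u (\<lambda>x. a * f x + b * g x) = a * u f + b * u g)"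

definition distribution :: "((real ^ 'n \<Rightarrow> complex) \<Rightarrow> complex) \<Rightarrow> bool" where
  "distribution u \<longleftrightarrow> linear_functional_on test_functions u \<and>
    (\<forall>K. compact K \<longrightarrow> (\<exists>C N. \<forall>f\<in>test_functions. fun_support f \<subseteq> K \<longrightarrow>
      norm (u f) \<le> C * schwartz_seminorm 0 N f))"

definition tempered_distribution :: "((real ^ 'n \<Rightarrow> complex) \<Rightarrow> complex) \<Rightarrow> bool" where
  "tempered_distribution u \<longleftrightarrow> linear_functional_on schwartz_functions u \<and>
    (\<exists>C N. \<forall>f\<in>schwartz_functions. norm (u f) \<le> C * schwartz_seminorm N N f)"

definition distr_support :: "((real ^ 'n \<Rightarrow> complex) \<Rightarrow> complex) \<Rightarrow> (real ^ 'n) set" where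
  "distr_support u =
    - \<Union>{V. open V \<and> (\<forall>f\<in>test_functions. fun_support f \<subseteq> V \<longrightarrow> u f = 0)}"

definition compactly_supported_distributions :: "((real ^ 'n \<Rightarrow> complex) \<Rightarrow> complex) set" where
  "compactly_supported_distributions = {u. distribution u \<and> compact (distr_support u)}"

definition nonzero_distribution :: "((real ^ 'n \<Rightarrow> complex) \<Rightarrow> complex) \<Rightarrow> bool" where
  "nonzero_distribution u \<longleftrightarrow> (\<exists>f\<in>test_functions. u f \<noteq> 0)"

text \<open>
  A compactly supported distribution has exactly one tempered extension, test functions being
  dense in the Schwartz space; this is the embedding of the former into the latter.
\<close>

definition tempered_extension ::
    "((real ^ 'n \<Rightarrow> complex) \<Rightarrow> complex) \<Rightarrow> (real ^ 'n \<Rightarrow> complex) \<Rightarrow> complex" where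
  "tempered_extension u =
    (SOME v. tempered_distribution v \<and> (\<forall>f\<in>test_functions. v f = u f))"

section \<open>Fourier transform and Fourier multipliers\<close>

definition fourier :: "(real ^ 'n \<Rightarrow> complex) \<Rightarrow> real ^ 'n \<Rightarrow> complex" where
  "fourier f \<xi> = (LINT x|lborel. f x * exp (- \<i> * of_real (x \<bullet> \<xi>)))"

definition inv_fourier :: "(real ^ 'n \<Rightarrow> complex) \<Rightarrow> real ^ 'n \<Rightarrow> complex" where
  "inv_fourier f x =
    (LINT \<xi>|lborel. f \<xi> * exp (\<i> * of_real (x \<bullet> \<xi>))) / of_real ((2 * pi) ^ CARD('n))"

definition fourier_distr ::
    "((real ^ 'n \<Rightarrow> complex) \<Rightarrow> complex) \<Rightarrow> (real ^ 'n \<Rightarrow> complex) \<Rightarrow> complex" where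
  "fourier_distr u f = u (fourier f)"

definition inv_fourier_distr ::
    "((real ^ 'n \<Rightarrow> complex) \<Rightarrow> complex) \<Rightarrow> (real ^ 'n \<Rightarrow> complex) \<Rightarrow> complex" where
  "inv_fourier_distr u f = u (inv_fourier f)"

definition function_distr ::
    "(real ^ 'n \<Rightarrow> complex) \<Rightarrow> (real ^ 'n \<Rightarrow> complex) \<Rightarrow> complex" where
  "function_distr g f = (LINT \<xi>|lborel. g \<xi> * f \<xi>)"

text \<open>
  The symbol of the propagator is merely continuous, so it cannot multiply an arbitrary tempered
  distribution. The Fourier transform of a compactly supported distribution is, however, a
  continuous function (of polynomial growth), namely the one chosen here; the symbol multiplies
  it pointwise.
\<close>

definition density_of ::
    "((real ^ 'n \<Rightarrow> complex) \<Rightarrow> complex) \<Rightarrow> real ^ 'n \<Rightarrow> complex" where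
  "density_of u = (SOME g. continuous_on UNIV g \<and>
    (\<forall>f\<in>schwartz_functions. integrable lborel (\<lambda>\<xi>. g \<xi> * f \<xi>) \<and> u f = function_distr g f))"

definition fourier_multiplier ::
    "(real ^ 'n \<Rightarrow> complex) \<Rightarrow> ((real ^ 'n \<Rightarrow> complex) \<Rightarrow> complex) \<Rightarrow>
      (real ^ 'n \<Rightarrow> complex) \<Rightarrow> complex" where
  "fourier_multiplier m u =
    inv_fourier_distr (function_distr
      (\<lambda>\<xi>. m \<xi> * density_of (fourier_distr (tempered_extension u)) \<xi>))"

definition propagator ::
    "(real ^ 'n \<Rightarrow> real) \<Rightarrow> real \<Rightarrow> ((real ^ 'n \<Rightarrow> complex) \<Rightarrow> complex) \<Rightarrow>
      (real ^ 'n \<Rightarrow> complex) \<Rightarrow> complex" where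
  "propagator \<omega> t = fourier_multiplier (\<lambda>\<xi>. exp (- \<i> * of_real (t * \<omega> \<xi>)))"

section \<open>Slices and analytic extensions\<close>

text \<open>
  The remaining variables \<open>x\<^sub>j'\<close> are the tuples indexed by \<open>- {j}\<close>, with the product topology;
  this is a copy of Euclidean space of dimension \<open>CARD('n) - 1\<close>.
\<close>

abbreviation remaining_top :: "'n \<Rightarrow> ('n \<Rightarrow> real) topology" where
  "remaining_top j \<equiv> product_topology (\<lambda>_. euclideanreal) (- {j})"

definition slice :: "(real ^ 'n \<Rightarrow> real) \<Rightarrow> 'n \<Rightarrow> ('n \<Rightarrow> real) \<Rightarrow> real \<Rightarrow> real" where
  "slice h j y s = h (\<chi> i. if i = j then s else y i)"

definition vertical_ray :: "complex \<Rightarrow> complex set" where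
  "vertical_ray z =
    {w. Re w = Re z \<and> (Im z > 0 \<and> Im w \<ge> Im z \<or> Im z < 0 \<and> Im w \<le> Im z)}"

definition slit_plane :: "complex set \<Rightarrow> complex set" where
  "slit_plane E = - (\<Union>z\<in>E. vertical_ray z)"

text \<open>
  \<open>F\<close> is an analytic extension of \<open>f\<close> to the plane slit along the rays from the points of \<open>E\<close>.
  The last clause says that \<open>E\<close> accounts for all singularities and that the slits are otherwise
  mere branch cuts: at a point of a slit that is not in \<open>E\<close>, \<open>F\<close> continues analytically from
  either side. Without it a singularity may hide inside a slit, and then demanding that \<open>F\<close> be
  holomorphic in punctured disks about the points of \<open>E\<close> says nothing about that singularity.
  For instance, in dimension one let \<open>exp (- \<i> * t * \<omega>(\<xi>)) = (\<xi> - 2 * \<i>) / (\<xi> + 2 * \<i>)\<close>: the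
  extension of \<open>\<omega>\<close> to the plane slit from \<open>\<plusminus> \<i>\<close> is holomorphic near \<open>\<plusminus> \<i>\<close>, and \<open>\<omega>\<close> is not affine.
\<close>

definition slit_extension ::
    "(real \<Rightarrow> real) \<Rightarrow> complex set \<Rightarrow> (complex \<Rightarrow> complex) \<Rightarrow> bool" where
  "slit_extension f E F \<longleftrightarrow>
    countable E \<and> E \<inter> \<real> = {} \<and> (\<forall>z. \<not> z islimpt E) \<and>
    F holomorphic_on slit_plane E \<and> (\<forall>s. F (of_real s) = of_real (f s)) \<and>
    (\<forall>q \<in> - slit_plane E - E. \<exists>r>0. \<exists>F\<^sub>l F\<^sub>r.
      F\<^sub>l holomorphic_on ball q r \<and> F\<^sub>r holomorphic_on ball q r \<and>
      (\<forall>z \<in> ball q r \<inter> slit_plane E.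
        (Re z < Re q \<longrightarrow> F\<^sub>l z = F z) \<and> (Re z > Re q \<longrightarrow> F\<^sub>r z = F z)))"

definition extends_off ::
    "(real ^ 'n \<Rightarrow> real) \<Rightarrow> 'n \<Rightarrow> ('n \<Rightarrow> real) set \<Rightarrow> (('n \<Rightarrow> real) \<Rightarrow> complex set) \<Rightarrow>
      (('n \<Rightarrow> real) \<Rightarrow> complex \<Rightarrow> complex) \<Rightarrow> bool" where
  "extends_off \<omega> j Z E F \<longleftrightarrow>
    (\<forall>y \<in> topspace (remaining_top j) - Z. slit_extension (slice \<omega> j y) (E y) (F y))"

definition holomorphic_on_punctured_disk_at ::
    "complex set \<Rightarrow> (complex \<Rightarrow> complex) \<Rightarrow> complex \<Rightarrow> bool" where
  "holomorphic_on_punctured_disk_at \<Omega> F p \<longleftrightarrow>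
    (\<exists>r>0. \<exists>G. G holomorphic_on (ball p r - {p}) \<and> (\<forall>z \<in> (ball p r - {p}) \<inter> \<Omega>. G z = F z))"

end

theory Submission
  imports Defs "HOL-Probability.Sinc_Integral" "HOL-Probability.Characteristic_Functions"
    "HOL-Real_Asymp.Real_Asymp"
begin

text \<open>Regularizing \<open>\<phi>\<close> and \<open>U(t)\<phi>\<close> by one and the same test function gives compactly supported
  continuous functions. Along every line their Fourier transforms extend to entire functions \<open>G\<close>
  and \<open>H\<close> of exponential type, and \<open>H = exp (- i t \<omega>) G\<close> on the real axis. By analyticity, the lines
  parallel to an axis on which \<open>G\<close> vanishes form a set without interior; on the others \<open>H / G\<close> is
  meromorphic with neither zeros nor poles on the real axis, as it has modulus one there. The plane
  slit along vertical rays from its zeros and poles is contractible, so \<open>H / G\<close> has a logarithm on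
  it, which extends \<open>- i t \<omega>\<close>.

  If such an extension of \<open>\<omega>\<close> is single-valued about each point of \<open>E\<close>, then \<open>H / G\<close> has a
  logarithm on a punctured disk about each of its zeros and poles, which is impossible unless there
  are none. Hence \<open>H = exp h G\<close> with \<open>h\<close> entire; as \<open>G\<close> and \<open>H\<close> have exponential type, \<open>h\<close> grows at
  most linearly and is affine. So \<open>\<omega>\<close> is affine in each variable separately. Multiplication by
  \<open>exp (- i t m z)\<close> preserves the type bound of the transforms only for bounded slopes \<open>m\<close>, and
  boundedness of the slopes makes \<open>\<omega>\<close> jointly affine.\<close>

section \<open>Quotients of entire functions\<close>

text \<open>The test function \<open>f\<close> used for regularizing satisfies
  \<open>\<phi> f \<noteq> 0\<close>, which keeps the transform \<open>P\<close> from vanishing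
  identically; \<open>inv_fourier f\<close> is a factor of both transforms and cancels in the
  quotient. Regularity also turns the polynomial factor of the Paley-Wiener bound into a constant,
  as the final argument by Liouville's theorem wants.

  The propagator is defined through choices, of a tempered extension and of a continuous density.
  Both must be shown to be forced: by density of the test functions, and by pairing with bumps. This
  is what the theory of Schwartz functions and Fourier inversion serves; after it,
  \<open>\<phi>\<close> and its evolution are given by densities that differ by the factor
  \<open>exp (- i t \<omega>)\<close>.

  In the last part extensions are given on every line, but where \<open>P\<close> vanishes on a
  whole line, \<open>G\<close> and \<open>H\<close> carry no information. Affinity is proved on
  lines that meet the set where \<open>P\<close> is nonzero, with slopes bounded by
  \<open>2 R / \<bar>t\<bar>\<close> since both regularizations are supported in a ball of radius
  \<open>R\<close>, and extends to all lines because that set is dense and \<open>\<omega>\<close>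
  continuous.\<close>

lemma entire_local_factor:
  fixes f :: "complex \<Rightarrow> complex"
  assumes f: "f holomorphic_on UNIV" and nz: "f z0 \<noteq> 0"
  obtains n g r where "r > 0" "g holomorphic_on ball p r"
    "\<And>w. w \<in> ball p r \<Longrightarrow> g w \<noteq> 0" "\<And>w. w \<in> ball p r \<Longrightarrow> f w = (w - p) ^ n * g w"
proof (cases "f p = 0")
  case False
  have "continuous_on UNIV f" using f by (rule holomorphic_on_imp_continuous_on)
  then have "isCont f p" by (simp add: continuous_on_eq_continuous_at)
  then obtain e where e: "e > 0" "\<And>y. dist p y < e \<Longrightarrow> f y \<noteq> 0"
    using continuous_at_avoid[of p f 0] False by (auto simp: dist_commute)
  show thesis
    by (rule that[of e f 0]) (use e f in \<open>auto intro: holomorphic_on_subset\<close>)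
next
  case True
  have nc: "\<not> f constant_on UNIV"
    using True nz by (metis UNIV_I constant_on_def)
  obtain g r n where "0 < n" "0 < r" "ball p r \<subseteq> UNIV" "g holomorphic_on ball p r"
    "\<And>w. w \<in> ball p r \<Longrightarrow> f w = (w - p) ^ n * g w" "\<And>w. w \<in> ball p r \<Longrightarrow> g w \<noteq> 0"
    by (rule holomorphic_factor_zero_nonconstant[OF f open_UNIV connected_UNIV UNIV_I True nc]) blast
  then show thesis by (intro that[of r g n]) auto
qed

text \<open>A positive exponent sends the power to 0 at \<open>p\<close>, a negative one sends its
  reciprocal to 0. This reads off the order of a quotient from its limit.\<close>

lemma tendsto_powi_nonzero:
  fixes c p :: complex
  assumes lim: "((\<lambda>w. (w - p) powi k) \<longlongrightarrow> c) (at p)" and c: "c \<noteq> 0"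
  shows "k = 0"
proof (rule ccontr)
  assume "k \<noteq> 0"
  then consider "k > 0" | "k < 0" by linarith
  then show False
  proof cases
    case 1
    then obtain n where n: "k = int n" "n > 0" by (metis zero_less_imp_eq_int)
    have "((\<lambda>w. (w - p) ^ n) \<longlongrightarrow> (p - p) ^ n) (at p)" by (intro tendsto_intros)
    then have "((\<lambda>w. (w - p) powi k) \<longlongrightarrow> 0) (at p)" using n by (simp add: power_0_left)
    with lim c show False using tendsto_unique[OF _ lim] by (simp add: tendsto_unique)
  next
    case 2
    then obtain n where n: "k = - int n" "n > 0"
      by (metis minus_minus neg_0_less_iff_less zero_less_imp_eq_int)
    have "((\<lambda>w. (w - p) ^ n) \<longlongrightarrow> (p - p) ^ n) (at p)" by (intro tendsto_intros)
    then have "((\<lambda>w. inverse ((w - p) powi k)) \<longlongrightarrow> 0) (at p)"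
      using n by (simp add: power_0_left power_int_minus)
    moreover have "((\<lambda>w. inverse ((w - p) powi k)) \<longlongrightarrow> inverse c) (at p)"
      using lim c by (rule tendsto_inverse)
    ultimately show False using c by (metis LIM_unique inverse_zero_imp_zero)
  qed
qed

text \<open>Dividing the two local factorizations leaves the exponent \<open>m - n\<close>, the
  order of the quotient at \<open>p\<close>: positive at a zero, negative at a pole. Common zeros of
  \<open>G\<close> and \<open>H\<close> cancel, so \<open>k\<close> alone decides whether
  \<open>p\<close> is singular.\<close>

lemma entire_quotient_local:
  fixes G H :: "complex \<Rightarrow> complex"
  assumes G: "G holomorphic_on UNIV" "G a \<noteq> 0" and H: "H holomorphic_on UNIV" "H b \<noteq> 0"
  obtains k U r where "r > 0" "U holomorphic_on ball p r" "\<And>w. w \<in> ball p r \<Longrightarrow> U w \<noteq> 0"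
    "\<And>w. w \<in> ball p r - {p} \<Longrightarrow> G w \<noteq> 0" "\<And>w. w \<in> ball p r - {p} \<Longrightarrow> H w \<noteq> 0"
    "\<And>w. w \<in> ball p r - {p} \<Longrightarrow> H w / G w = U w * (w - p) powi k"
proof -
  obtain n g r where g: "r > 0" "g holomorphic_on ball p r"
    "\<And>w. w \<in> ball p r \<Longrightarrow> g w \<noteq> 0" "\<And>w. w \<in> ball p r \<Longrightarrow> G w = (w - p) ^ n * g w"
    by (rule entire_local_factor[OF G]) blast
  obtain m h s where h: "s > 0" "h holomorphic_on ball p s"
    "\<And>w. w \<in> ball p s \<Longrightarrow> h w \<noteq> 0" "\<And>w. w \<in> ball p s \<Longrightarrow> H w = (w - p) ^ m * h w"
    by (rule entire_local_factor[OF H]) blast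
  show thesis
  proof (rule that[of "min r s" "\<lambda>w. h w / g w" "int m - int n"])
    show "(\<lambda>w. h w / g w) holomorphic_on ball p (min r s)"
      using g h by (intro holomorphic_intros) (auto intro: holomorphic_on_subset)
    show "H w / G w = h w / g w * (w - p) powi (int m - int n)" if "w \<in> ball p (min r s) - {p}" for w
      using that g(4)[of w] h(4)[of w] by (simp add: power_int_diff field_simps)
  qed (use g h in auto)
qed

text \<open>The zeros and poles of the quotient: at every other point it extends to a nonzero holomorphic value.\<close>

definition quotient_sing :: "(complex \<Rightarrow> complex) \<Rightarrow> (complex \<Rightarrow> complex) \<Rightarrow> complex set" where
  "quotient_sing H G = {p. \<not> (\<exists>c. c \<noteq> 0 \<and> ((\<lambda>z. H z / G z) \<longlongrightarrow> c) (at p))}"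

lemma quotient_regular_local:
  fixes G H :: "complex \<Rightarrow> complex"
  assumes G: "G holomorphic_on UNIV" "G a \<noteq> 0" and H: "H holomorphic_on UNIV" "H b \<noteq> 0"
    and p: "p \<notin> quotient_sing H G"
  obtains U r where "r > 0" "U holomorphic_on ball p r" "\<And>w. w \<in> ball p r \<Longrightarrow> U w \<noteq> 0"
    "ball p r \<inter> quotient_sing H G = {}"
    "\<And>w. w \<in> ball p r \<Longrightarrow> remove_sings (\<lambda>z. H z / G z) w = U w"
    "\<And>w. w \<in> ball p r \<Longrightarrow> H w = G w * U w"
proof -
  obtain k U r where U: "r > 0" "U holomorphic_on ball p r" "\<And>w. w \<in> ball p r \<Longrightarrow> U w \<noteq> 0"
    "\<And>w. w \<in> ball p r - {p} \<Longrightarrow> G w \<noteq> 0" "\<And>w. w \<in> ball p r - {p} \<Longrightarrow> H w \<noteq> 0"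
    "\<And>w. w \<in> ball p r - {p} \<Longrightarrow> H w / G w = U w * (w - p) powi k"
    by (rule entire_quotient_local[OF G H]) blast
  obtain c where c: "c \<noteq> 0" "((\<lambda>z. H z / G z) \<longlongrightarrow> c) (at p)"
    using p by (auto simp: quotient_sing_def)
  have contU: "isCont U w" if "w \<in> ball p r" for w
    using U(2) that by (meson continuous_on_eq_continuous_at holomorphic_on_imp_continuous_on open_ball)
  have ev: "eventually (\<lambda>w. w \<in> ball p r - {p}) (at p)"
    using U(1) by (intro eventually_at_in_open) auto
  have "((\<lambda>w. (H w / G w) / U w) \<longlongrightarrow> c / U p) (at p)"
    using c(2) contU[of p] U(1,3) by (intro tendsto_divide) (auto simp: isCont_def)
  moreover have "eventually (\<lambda>w. (H w / G w) / U w = (w - p) powi k) (at p)"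
    using ev by eventually_elim (use U in auto)
  ultimately have "((\<lambda>w. (w - p) powi k) \<longlongrightarrow> c / U p) (at p)"
    by (simp add: Lim_transform_eventually)
  then have k: "k = 0" by (rule tendsto_powi_nonzero) (use c U in auto)
  have eq: "H w / G w = U w" if "w \<in> ball p r - {p}" for w using U(6)[OF that] k by simp
  \<comment> \<open>Needed at every point of the ball and not at \<open>p\<close> only: it shows
    that the ball contains no singularity and that \<open>remove_sings\<close> agrees with
    \<open>U\<close> throughout.\<close>
  have lim: "((\<lambda>z. H z / G z) \<longlongrightarrow> U w) (at w)" if w: "w \<in> ball p r" for w
  proof -
    have "(U \<longlongrightarrow> U w) (at w)" using contU[OF w] by (simp add: isCont_def)
    moreover have "eventually (\<lambda>z. z \<in> ball p r - {p}) (at w)"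
    proof (cases "w = p")
      case True then show ?thesis using ev by simp
    next
      case False
      then have "eventually (\<lambda>z. z \<in> ball p r - {p} - {w}) (at w)" using w
        by (intro eventually_at_in_open) auto
      then show ?thesis by eventually_elim auto
    qed
    then have "eventually (\<lambda>z. U z = H z / G z) (at w)"
      by eventually_elim (use eq in auto)
    ultimately show ?thesis by (rule Lim_transform_eventually)
  qed
  have prod: "H w = G w * U w" if w: "w \<in> ball p r" for w
  proof (cases "w = p")
    case False then show ?thesis using eq[of w] w U(4)[of w] by (auto simp: field_simps)
  next
    \<comment> \<open>At \<open>p\<close> both functions may vanish, and then the quotient says
      nothing; the product formula follows from the continuity of its two sides.\<close>
    case True
    have "isCont H p" "isCont G p"
      using G(1) H(1) by (meson UNIV_I continuous_on_eq_continuous_at holomorphic_on_imp_continuous_on open_UNIV)+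
    then have l1: "(H \<longlongrightarrow> H p) (at p)" and l2: "((\<lambda>w. G w * U w) \<longlongrightarrow> G p * U p) (at p)"
      using contU[of p] U(1) by (auto simp: isCont_def intro!: tendsto_intros)
    have ev2: "eventually (\<lambda>w. H w = G w * U w) (at p)"
      using ev by eventually_elim (use eq U(4) in \<open>auto simp: field_simps\<close>)
    show ?thesis using LIM_unique[OF l2 Lim_transform_eventually[OF l1 ev2]] True by simp
  qed
  show thesis
  proof (rule that[of r U])
    show "ball p r \<inter> quotient_sing H G = {}"
      using lim U(3) unfolding quotient_sing_def by blast
  qed (use U lim prod in \<open>auto intro: remove_sings_eqI\<close>)
qed

text \<open>The singularities lie among the zeros of \<open>G\<close> and \<open>H\<close>, and the
  zeros of an entire function that is not identically zero are isolated and countably many.\<close>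

lemma quotient_sing_isolated:
  fixes G H :: "complex \<Rightarrow> complex"
  assumes G: "G holomorphic_on UNIV" "G a \<noteq> 0" and H: "H holomorphic_on UNIV" "H b \<noteq> 0"
  shows "\<not> p islimpt quotient_sing H G" and "countable (quotient_sing H G)"
proof -
  have sub: "G w = 0 \<or> H w = 0" if "w \<in> quotient_sing H G" for w
  proof (rule ccontr)
    assume *: "\<not> ?thesis"
    have "isCont H w" "isCont G w"
      using G(1) H(1) by (meson UNIV_I continuous_on_eq_continuous_at holomorphic_on_imp_continuous_on open_UNIV)+
    then have "((\<lambda>z. H z / G z) \<longlongrightarrow> H w / G w) (at w)"
      using * by (auto simp: isCont_def intro!: tendsto_intros)
    moreover have "H w / G w \<noteq> 0" using * by auto
    ultimately show False using that unfolding quotient_sing_def by blast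
  qed
  obtain k U r where U: "r > 0"
    "\<And>w. w \<in> ball p r - {p} \<Longrightarrow> G w \<noteq> 0" "\<And>w. w \<in> ball p r - {p} \<Longrightarrow> H w \<noteq> 0"
    by (rule entire_quotient_local[OF G H]) blast
  show "\<not> p islimpt quotient_sing H G"
  proof
    assume "p islimpt quotient_sing H G"
    then obtain w where "w \<in> quotient_sing H G" "w \<in> ball p r" "w \<noteq> p"
      using \<open>r > 0\<close> by (meson centre_in_ball islimptE open_ball)
    then show False using sub U by blast
  qed
  have cz: "countable {z. f z = 0}" if "f holomorphic_on UNIV" "f a \<noteq> 0" for f :: "complex \<Rightarrow> complex" and a
  proof (cases "f constant_on UNIV")
    case True
    then show ?thesis using that(2) by (auto simp: constant_on_def)
  next
    case False
    then show ?thesis using holomorphic_countable_zeros[OF that(1)] by auto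
  qed
  have "quotient_sing H G \<subseteq> {z. G z = 0} \<union> {z. H z = 0}" using sub by auto
  then show "countable (quotient_sing H G)"
    using cz[OF G] cz[OF H] countable_Un countable_subset by blast
qed

lemma quotient_regular:
  fixes G H :: "complex \<Rightarrow> complex"
  assumes G: "G holomorphic_on UNIV" "G a \<noteq> 0" and H: "H holomorphic_on UNIV" "H b \<noteq> 0"
  defines "M \<equiv> remove_sings (\<lambda>z. H z / G z)"
  shows "M holomorphic_on - quotient_sing H G"
    and "\<And>z. z \<notin> quotient_sing H G \<Longrightarrow> M z \<noteq> 0"
    and "\<And>z. z \<notin> quotient_sing H G \<Longrightarrow> H z = G z * M z"
proof -
  have loc: "M field_differentiable at z \<and> M z \<noteq> 0 \<and> H z = G z * M z" if z: "z \<notin> quotient_sing H G" for z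
  proof -
    obtain U r where U: "r > 0" "U holomorphic_on ball z r" "\<And>w. w \<in> ball z r \<Longrightarrow> U w \<noteq> 0"
      "\<And>w. w \<in> ball z r \<Longrightarrow> M w = U w" "\<And>w. w \<in> ball z r \<Longrightarrow> H w = G w * U w"
      unfolding M_def by (rule quotient_regular_local[OF G H z]) blast
    have "M holomorphic_on ball z r" using U(2,4) by (metis holomorphic_transform)
    then show ?thesis using U by (auto intro: holomorphic_on_imp_differentiable_at)
  qed
  then show "M holomorphic_on - quotient_sing H G"
    by (auto simp: holomorphic_on_def intro: field_differentiable_at_within)
  show "\<And>z. z \<notin> quotient_sing H G \<Longrightarrow> M z \<noteq> 0" "\<And>z. z \<notin> quotient_sing H G \<Longrightarrow> H z = G z * M z"
    using loc by auto
qed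

text \<open>Along the real axis, off the zeros of \<open>G\<close>, the quotient equals
  \<open>u\<close>, which has modulus one; a zero would force the limit 0 and a pole would make it
  unbounded. So the order is 0, the limit exists in the complex plane, and continuity of
  \<open>u\<close> identifies it.\<close>

lemma quotient_real_limit:
  fixes G H :: "complex \<Rightarrow> complex" and u :: "real \<Rightarrow> complex"
  assumes G: "G holomorphic_on UNIV" "G a \<noteq> 0" and H: "H holomorphic_on UNIV" "H b \<noteq> 0"
    and u: "continuous_on UNIV u" "\<And>s. norm (u s) = 1"
    and eq: "\<And>s. H (of_real s) = u s * G (of_real s)"
  shows "((\<lambda>z. H z / G z) \<longlongrightarrow> u s) (at (of_real s))"
proof -
  define p where "p = complex_of_real s"
  obtain k U r where U: "r > 0" "U holomorphic_on ball p r" "\<And>w. w \<in> ball p r \<Longrightarrow> U w \<noteq> 0"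
    "\<And>w. w \<in> ball p r - {p} \<Longrightarrow> G w \<noteq> 0" "\<And>w. w \<in> ball p r - {p} \<Longrightarrow> H w \<noteq> 0"
    "\<And>w. w \<in> ball p r - {p} \<Longrightarrow> H w / G w = U w * (w - p) powi k"
    by (rule entire_quotient_local[OF G H]) blast
  have "isCont U p"
    using U(1,2) by (meson centre_in_ball continuous_on_eq_continuous_at holomorphic_on_imp_continuous_on open_ball)
  then have Up: "(U \<longlongrightarrow> U p) (at p)" by (simp add: isCont_def)
  have fl: "filterlim complex_of_real (at p) (at s)"
    unfolding p_def filterlim_at by (auto intro!: tendsto_intros simp: eventually_at_filter)
  have Us: "((\<lambda>x. U (of_real x)) \<longlongrightarrow> U p) (at s)"
    using filterlim_compose[OF Up fl] .
  have ev: "eventually (\<lambda>w. w \<in> ball p r - {p}) (at p)"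
    using U(1) by (intro eventually_at_in_open) auto
  have "eventually (\<lambda>x. complex_of_real x \<in> ball p r - {p}) (at s)"
    using ev fl unfolding filterlim_iff by blast
  then have uU: "eventually (\<lambda>x. u x = U (of_real x) * (of_real x - p) powi k) (at s)"
  proof eventually_elim
    case (elim x)
    then show ?case using U(4)[of "of_real x"] U(6)[of "of_real x"] eq[of x] by auto
  qed
  have ulim: "(u \<longlongrightarrow> u s) (at s)" using u(1) by (simp add: continuous_on_eq_continuous_at isCont_def)
  have U0: "U p \<noteq> 0" using U by simp
  have k: "k = 0"
  proof (rule ccontr)
    assume "k \<noteq> 0"
    then consider "k > 0" | "k < 0" by linarith
    then show False
    proof cases
      case 1
      then obtain n where n: "k = int n" "n > 0" by (metis zero_less_imp_eq_int)
      have "((\<lambda>x. U (of_real x) * (of_real x - p) ^ n) \<longlongrightarrow> U p * (of_real s - p) ^ n) (at s)"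
        by (intro tendsto_intros Us)
      then have "((\<lambda>x. U (of_real x) * (of_real x - p) powi k) \<longlongrightarrow> 0) (at s)"
        using n by (simp add: p_def power_0_left)
      then have "(u \<longlongrightarrow> 0) (at s)" using eventually_mono[OF uU] Lim_transform_eventually[of "\<lambda>x. U (of_real x) * (of_real x - p) powi k" 0 "at s" u]
        by (simp add: eq_commute)
      then have "u s = 0" using ulim LIM_unique by blast
      then show False using u(2)[of s] by simp
    next
      case 2
      then obtain n where n: "k = - int n" "n > 0"
        by (metis minus_minus neg_0_less_iff_less zero_less_imp_eq_int)
      \<comment> \<open>The power is moved to the side of \<open>u\<close>: that side tends to 0,
        the other to \<open>U p \<noteq> 0\<close>.\<close>
      have "((\<lambda>x. u x * (of_real x - p) ^ n) \<longlongrightarrow> u s * (of_real s - p) ^ n) (at s)"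
        by (intro tendsto_intros ulim)
      then have "((\<lambda>x. u x * (of_real x - p) ^ n) \<longlongrightarrow> 0) (at s)"
        using n by (simp add: p_def power_0_left)
      moreover have "eventually (\<lambda>x. u x * (of_real x - p) ^ n = U (of_real x)) (at s)"
        using uU eventually_neq_at_within[of s s UNIV]
      proof (eventually_elim)
        case (elim x)
        then have "complex_of_real x - p \<noteq> 0" by (auto simp: p_def)
        then show ?case using elim n by (simp add: power_int_minus)
      qed
      ultimately have "((\<lambda>x. U (of_real x)) \<longlongrightarrow> 0) (at s)"
        by (rule Lim_transform_eventually)
      then show False using Us U0 LIM_unique by blast
    qed
  qed
  have "((\<lambda>z. H z / G z) \<longlongrightarrow> U p) (at p)"
    by (rule Lim_transform_eventually[OF Up]) (use ev in \<open>eventually_elim; use U(6) k in auto\<close>)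
  moreover have "U p = u s"
  proof -
    have "eventually (\<lambda>x. U (of_real x) = u x) (at s)"
      using uU by eventually_elim (use k in auto)
    then have "(u \<longlongrightarrow> U p) (at s)" using Us by (rule Lim_transform_eventually[rotated])
    then show ?thesis using ulim LIM_unique by blast
  qed
  ultimately show ?thesis by (simp add: p_def)
qed

section \<open>Slit planes\<close>

lemma closed_vertical_ray: "closed (vertical_ray z)"
proof -
  have "vertical_ray z = {w. Re w = Re z} \<inter> (({w. Im w \<ge> Im z} \<inter> {w. Im z > 0}) \<union> ({w. Im w \<le> Im z} \<inter> {w. Im z < 0}))"
    by (auto simp: vertical_ray_def)
  also have "closed \<dots>"
    by (intro closed_Int closed_Un closed_Collect_eq closed_Collect_le closed_Collect_const continuous_intros)
  finally show ?thesis .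
qed

lemma vertical_ray_bounds: "w \<in> vertical_ray p \<Longrightarrow> Re p = Re w \<and> \<bar>Im p\<bar> \<le> \<bar>Im w\<bar>"
  by (auto simp: vertical_ray_def)

lemma of_real_in_slit_plane: "of_real s \<in> slit_plane E"
  by (auto simp: slit_plane_def vertical_ray_def)

lemma notin_slit_plane: "p \<in> E \<Longrightarrow> E \<inter> \<real> = {} \<Longrightarrow> p \<notin> slit_plane E"
  by (force simp: slit_plane_def vertical_ray_def complex_is_Real_iff)

text \<open>The slits are locally finite although \<open>E\<close> may be infinite. A ray that
  passes near \<open>q\<close> starts at a point with the same real part and no larger distance from
  the real axis, hence in the compact box \<open>B\<close>, which contains only finitely many points
  of \<open>E\<close>.\<close>

lemma slit_plane_local:
  assumes E: "\<And>z. \<not> z islimpt E"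
  obtains r where "r > 0" "ball q r \<inter> E \<subseteq> {q}"
    "\<And>z. z \<in> ball q r \<Longrightarrow> Re z \<noteq> Re q \<Longrightarrow> z \<in> slit_plane E"
    "q \<in> slit_plane E \<Longrightarrow> ball q r \<subseteq> slit_plane E"
proof -
  define B where "B = {p. \<bar>Re p - Re q\<bar> \<le> 1 \<and> \<bar>Im p\<bar> \<le> \<bar>Im q\<bar> + 1}"
  have "closed B" unfolding B_def
    by (intro closed_Collect_conj closed_Collect_le continuous_intros)
  moreover have "bounded B"
  proof (rule boundedI)
    fix p assume "p \<in> B"
    then have "\<bar>Re p\<bar> \<le> \<bar>Re q\<bar> + 1" "\<bar>Im p\<bar> \<le> \<bar>Im q\<bar> + 1" by (auto simp: B_def)
    then show "norm p \<le> \<bar>Re q\<bar> + 1 + (\<bar>Im q\<bar> + 1)" using cmod_le[of p] by linarith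
  qed
  ultimately have "compact B" by (simp add: compact_eq_bounded_closed)
  then have fin: "finite (B \<inter> E)"
    using E by (intro finite_not_islimpt_in_compact) auto
  \<comment> \<open>Removing the finitely many rays from the box that miss \<open>q\<close> leaves a
    neighbourhood in which every slit passes through \<open>q\<close>, and so lies on the vertical
    line through \<open>q\<close>.\<close>
  define A where "A = {p \<in> B \<inter> E. q \<notin> vertical_ray p}"
  define W where "W = ball q 1 - (\<Union>p\<in>A. vertical_ray p) - (E - {q})"
  have "closed E" using E by (simp add: closed_limpt)
  have "closed (E - {q})"
    using E by (auto simp: closed_limpt dest: islimpt_subset)
  moreover have "finite A" by (rule finite_subset[OF _ fin]) (auto simp: A_def)
  ultimately have "open W" unfolding W_def
    by (intro open_Diff open_ball closed_UN) (auto intro: closed_vertical_ray)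
  moreover have "q \<in> W" by (auto simp: W_def A_def)
  ultimately obtain r where r: "r > 0" "ball q r \<subseteq> W"
    using open_contains_ball by blast
  have key: "q \<in> vertical_ray p" if z: "z \<in> ball q r" and p: "p \<in> E" and zp: "z \<in> vertical_ray p" for z p
  proof (rule ccontr)
    assume n: "\<not> ?thesis"
    have z1: "z \<in> W" using z r by auto
    then have "norm (z - q) < 1" by (auto simp: W_def dist_norm norm_minus_commute)
    then have "\<bar>Re z - Re q\<bar> < 1" "\<bar>Im z - Im q\<bar> < 1"
      using abs_Re_le_cmod[of "z - q"] abs_Im_le_cmod[of "z - q"] by auto
    then have "p \<in> B" using vertical_ray_bounds[OF zp] by (auto simp: B_def)
    then have "p \<in> A" using n p by (auto simp: A_def)
    then show False using z1 zp by (auto simp: W_def)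
  qed
  show thesis
  proof (rule that[of r])
    show "ball q r \<inter> E \<subseteq> {q}" using r by (auto simp: W_def)
    show "z \<in> slit_plane E" if "z \<in> ball q r" "Re z \<noteq> Re q" for z
    proof (rule ccontr)
      assume "z \<notin> slit_plane E"
      then obtain p where p: "p \<in> E" "z \<in> vertical_ray p" by (auto simp: slit_plane_def)
      then show False using key[OF that(1) p] vertical_ray_bounds[of z p] vertical_ray_bounds[of q p] that(2) by simp
    qed
    show "ball q r \<subseteq> slit_plane E" if "q \<in> slit_plane E"
      using key that unfolding slit_plane_def by blast
  qed (use r in auto)
qed

lemma open_slit_plane: "(\<And>z. \<not> z islimpt E) \<Longrightarrow> open (slit_plane E)"
  unfolding open_contains_ball
proof
  fix q assume E: "\<And>z. \<not> z islimpt E" and "q \<in> slit_plane E"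
  then show "\<exists>r>0. ball q r \<subseteq> slit_plane E"
    by (rule_tac slit_plane_local[OF E, of q]) blast
qed

text \<open>The slit plane retracts vertically onto the real axis.\<close>

lemma contractible_slit_plane: "contractible (slit_plane E)"
proof -
  let ?S = "slit_plane E"
  have 1: "homotopic_with_canon (\<lambda>z. True) ?S ?S (\<lambda>z. z) (\<lambda>z. of_real (Re z))"
  proof (rule homotopic_with_linear)
    fix z assume z: "z \<in> ?S"
    show "closed_segment z (complex_of_real (Re z)) \<subseteq> ?S"
    proof
      fix w assume "w \<in> closed_segment z (complex_of_real (Re z))"
      then obtain u where u: "0 \<le> u" "u \<le> 1" "w = (1 - u) *\<^sub>R z + u *\<^sub>R of_real (Re z)"
        by (auto simp: in_segment)
      have re: "Re w = Re z" unfolding u(3) by (simp add: algebra_simps)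
      have im: "Im w = (1 - u) * Im z" using u by simp
      have "z \<in> vertical_ray p" if p: "w \<in> vertical_ray p" for p
      proof -
        have "Im z \<ge> Im p" if "Im p > 0" "Im w \<ge> Im p"
        proof -
          have "Im z \<ge> 0" using that im u by (smt (verit) mult_nonneg_nonpos)
          then have "(1 - u) * Im z \<le> 1 * Im z" using u by (intro mult_right_mono) auto
          then show ?thesis using im that by simp
        qed
        moreover have "Im z \<le> Im p" if "Im p < 0" "Im w \<le> Im p"
        proof -
          have "Im z \<le> 0" using that im u by (smt (verit) mult_nonneg_nonneg)
          then have "(1 - u) * Im z \<ge> 1 * Im z" using u by (intro mult_right_mono_neg) auto
          then show ?thesis using im that by simp
        qed
        ultimately show ?thesis using p re by (auto simp: vertical_ray_def)
      qed
      then show "w \<in> ?S" using z by (auto simp: slit_plane_def)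
    qed
  qed (auto intro!: continuous_intros)
  have 2: "homotopic_with_canon (\<lambda>z. True) ?S ?S (\<lambda>z. of_real (Re z)) (\<lambda>z. 0)"
  proof (rule homotopic_with_linear)
    fix z assume "z \<in> ?S"
    show "closed_segment (complex_of_real (Re z)) 0 \<subseteq> ?S"
    proof
      fix w assume "w \<in> closed_segment (complex_of_real (Re z)) 0"
      then obtain u where "w = (1 - u) *\<^sub>R of_real (Re z)" by (auto simp: in_segment)
      then have "w = of_real ((1 - u) * Re z)" by (simp add: scaleR_conv_of_real)
      then show "w \<in> ?S" using of_real_in_slit_plane by metis
    qed
  qed (auto intro!: continuous_intros)
  have "homotopic_with_canon (\<lambda>z. True) ?S ?S id (\<lambda>z. 0)"
    using homotopic_with_trans[OF 1 2] by (simp add: id_def)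
  then show ?thesis unfolding contractible_def by blast
qed

text \<open>The difference is continuous with values in the integer multiples of
  \<open>2 * pi * \<i>\<close>, any two of which are at least \<open>2 * pi\<close> apart.\<close>

lemma logarithms_differ_by_constant:
  fixes g h :: "'a::topological_space \<Rightarrow> complex"
  assumes A: "connected A" and g: "continuous_on A g" and h: "continuous_on A h"
    and eq: "\<And>z. z \<in> A \<Longrightarrow> exp (g z) = exp (h z)"
  obtains c where "exp c = 1" "\<And>z. z \<in> A \<Longrightarrow> g z = h z + c"
proof -
  have ex: "exp (g z - h z) = 1" if "z \<in> A" for z using eq[OF that] by (simp add: exp_diff)
  have "(\<lambda>z. g z - h z) constant_on A"
  proof (rule continuous_discrete_range_constant[OF A])
    show "continuous_on A (\<lambda>z. g z - h z)" by (intro continuous_intros g h)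
    fix x assume x: "x \<in> A"
    show "\<exists>e>0. \<forall>y. y \<in> A \<and> g y - h y \<noteq> g x - h x \<longrightarrow> e \<le> norm (g y - h y - (g x - h x))"
    proof (intro exI conjI allI impI)
      show "(0::real) < 2 * pi" by simp
      fix y assume y: "y \<in> A \<and> g y - h y \<noteq> g x - h x"
      then obtain n where n: "g y - h y = g x - h x + (of_int (2 * n) * pi) * \<i>"
        using ex[OF x] ex[of y] by (metis exp_eq)
      then have "n \<noteq> 0" using y by auto
      then have "1 \<le> real_of_int \<bar>n\<bar>" by linarith
      then have "2 * pi * 1 \<le> 2 * pi * real_of_int \<bar>n\<bar>" by (intro mult_left_mono) auto
      also have "\<dots> = norm (g y - h y - (g x - h x))"
        using n by (simp add: norm_mult abs_mult)
      finally show "2 * pi \<le> norm (g y - h y - (g x - h x))" by simp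
    qed
  qed
  then obtain c where c: "\<And>z. z \<in> A \<Longrightarrow> g z - h z = c" by (auto simp: constant_on_def)
  show thesis
  proof (cases "A = {}")
    case True then show ?thesis by (intro that[of 0]) auto
  next
    case False
    then obtain x where "x \<in> A" by auto
    then have "exp c = 1" using ex c by metis
    then show ?thesis using c by (intro that[of c]) (auto simp: algebra_simps)
  qed
qed

text \<open>The identity theorem, with 0 as the accumulation point of the real axis.\<close>

lemma zero_on_reals_imp_zero:
  assumes D: "D holomorphic_on S" "open S" "connected S" "range of_real \<subseteq> S"
    and z: "\<And>s. D (of_real s) = 0" and w: "w \<in> S"
  shows "D w = 0"
proof -
  have "(0::complex) islimpt range of_real"
    unfolding islimpt_approachable
  proof (intro allI impI)
    fix e :: real assume "e > 0"
    then show "\<exists>x'\<in>range complex_of_real. x' \<noteq> 0 \<and> dist x' 0 < e"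
      by (intro bexI[of _ "of_real (e/2)"]) (simp, rule rangeI)
  qed
  moreover have "0 \<in> S" using D(4) by (metis of_real_0 range_subsetD)
  ultimately show ?thesis
    using analytic_continuation[OF D(1-3) D(4), of 0 w] z w by blast
qed

text \<open>Serves to find a point where \<open>H\<close> is nonzero as well: the relation between
  \<open>G\<close> and \<open>H\<close> is given on the real axis only, and there the two have equal
  modulus.\<close>

lemma entire_nonzero_on_reals:
  assumes "G holomorphic_on UNIV" "G a \<noteq> 0"
  obtains s where "G (of_real s) \<noteq> 0"
  using zero_on_reals_imp_zero[OF assms(1) open_UNIV connected_UNIV subset_UNIV _ UNIV_I] assms(2) by blast

text \<open>With \<open>L\<close> a logarithm of the quotient on the contractible slit plane,
  \<open>\<i> / t * L\<close> is the extension, up to the additive constant that makes it agree with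
  \<open>f\<close> on the real axis.\<close>

lemma slit_extension_quotient:
  fixes f :: "real \<Rightarrow> real"
  assumes G: "G holomorphic_on UNIV" "G a \<noteq> 0" and H: "H holomorphic_on UNIV"
    and f: "continuous_on UNIV f" and t: "t \<noteq> 0"
    and eq: "\<And>s. H (of_real s) = exp (- \<i> * of_real (t * f s)) * G (of_real s)"
  shows "\<exists>F. slit_extension f (quotient_sing H G) F"
    and "open (slit_plane (quotient_sing H G))"
proof -
  define E where "E = quotient_sing H G"
  define M where "M = remove_sings (\<lambda>z. H z / G z)"
  obtain s0 where "G (of_real s0) \<noteq> 0" using entire_nonzero_on_reals[OF G] .
  then have Hb: "H (of_real s0) \<noteq> 0" by (simp add: eq)
  note GH = G H Hb
  define u where "u = (\<lambda>s. exp (- \<i> * of_real (t * f s)))"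
  have u: "continuous_on UNIV u" "\<And>s. norm (u s) = 1"
    unfolding u_def by (auto intro!: continuous_intros f)
  have lim: "((\<lambda>z. H z / G z) \<longlongrightarrow> u s) (at (of_real s))" for s
    using quotient_real_limit[OF GH u] eq by (simp add: u_def)
  have unz: "u s \<noteq> 0" for s by (simp add: u_def)
  have Ereal: "E \<inter> \<real> = {}"
    using lim unz by (auto simp: E_def quotient_sing_def Reals_def)
  have Eiso: "\<not> z islimpt E" for z
    unfolding E_def by (rule quotient_sing_isolated[OF GH])
  have Ecount: "countable E"
    unfolding E_def by (rule quotient_sing_isolated[OF GH])
  have M: "M holomorphic_on - E" "\<And>z. z \<notin> E \<Longrightarrow> M z \<noteq> 0"
    unfolding M_def E_def using quotient_regular[OF GH] by auto
  have Mreal: "M (of_real s) = u s" for s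
    unfolding M_def using lim by (rule remove_sings_eqI)
  have sub: "slit_plane E \<subseteq> - E" using notin_slit_plane[OF _ Ereal] by auto
  show op: "open (slit_plane (quotient_sing H G))"
    using Eiso open_slit_plane unfolding E_def by blast
  obtain L where L: "L holomorphic_on slit_plane E" "\<And>z. z \<in> slit_plane E \<Longrightarrow> M z = exp (L z)"
    by (rule contractible_imp_holomorphic_log[OF _ contractible_slit_plane])
       (use M sub in \<open>auto intro: holomorphic_on_subset\<close>)
  have contL: "continuous_on UNIV (\<lambda>s. L (of_real s))"
    using of_real_in_slit_plane
    by (intro continuous_on_compose2[OF holomorphic_on_imp_continuous_on[OF L(1)]] continuous_intros) auto
  have expL: "exp (L (of_real s)) = exp (- \<i> * of_real (t * f s))" for s
    using L(2)[OF of_real_in_slit_plane] Mreal[of s] by (simp add: u_def)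
  have contf: "continuous_on UNIV (\<lambda>s. - \<i> * complex_of_real (t * f s))"
    by (intro continuous_intros f)
  \<comment> \<open>A logarithm is determined only up to a multiple of \<open>2 * pi * \<i>\<close>;
    \<open>c\<close> is the one by which \<open>L\<close> misses \<open>- i t f\<close> on the real
    axis.\<close>
  obtain c where c: "exp c = 1" "\<And>s. L (of_real s) = - \<i> * of_real (t * f s) + c"
    by (rule logarithms_differ_by_constant[OF connected_UNIV contL contf expL]) (rule that; simp)
  define F where "F = (\<lambda>z. \<i> / of_real t * (L z - c))"
  have Freal: "F (of_real s) = of_real (f s)" for s
    using t by (simp add: F_def c(2))
  have Fhol: "F holomorphic_on slit_plane E"
    unfolding F_def by (intro holomorphic_intros L)
  \<comment> \<open>At a point of a slit outside \<open>E\<close> the quotient is holomorphic and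
    zero-free on a whole ball, so it has a logarithm \<open>l\<close> there that ignores the
    slit.\<close>
  have side: "\<exists>r>0. \<exists>Fl Fr. Fl holomorphic_on ball q r \<and> Fr holomorphic_on ball q r \<and>
      (\<forall>z \<in> ball q r \<inter> slit_plane E. (Re z < Re q \<longrightarrow> Fl z = F z) \<and> (Re z > Re q \<longrightarrow> Fr z = F z))"
    if q: "q \<notin> slit_plane E" "q \<notin> E" for q
  proof -
    obtain r where r: "r > 0" "ball q r \<inter> E \<subseteq> {q}"
      "\<And>z. z \<in> ball q r \<Longrightarrow> Re z \<noteq> Re q \<Longrightarrow> z \<in> slit_plane E"
      by (rule slit_plane_local[OF Eiso, of q]) blast
    have sb: "ball q r \<subseteq> - E" using r q by auto
    obtain l where l: "l holomorphic_on ball q r" "\<And>z. z \<in> ball q r \<Longrightarrow> M z = exp (l z)"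
      by (rule contractible_imp_holomorphic_log[OF _ convex_imp_contractible[OF convex_ball], of M q r])
         (use M sb in \<open>auto intro: holomorphic_on_subset\<close>)
    \<comment> \<open>Applied to the left and right halves of the ball separately. Each is connected
      and free of slits, so \<open>L - l\<close> is constant on it, but the two constants may differ
      by the monodromy across the slit.\<close>
    have half: "\<exists>F'. F' holomorphic_on ball q r \<and> (\<forall>z\<in>A. F' z = F z)"
      if A: "A \<subseteq> ball q r" "A \<subseteq> slit_plane E" "convex A" for A
    proof -
      have "continuous_on A L" "continuous_on A l"
        using A L(1) l(1) by (meson continuous_on_subset holomorphic_on_imp_continuous_on)+
      note cont = this
      have ex: "exp (L z) = exp (l z)" if "z \<in> A" for z
        using that A L(2)[of z] l(2)[of z] by (metis subsetD)
      obtain d where d: "\<And>z. z \<in> A \<Longrightarrow> L z = l z + d"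
        by (rule logarithms_differ_by_constant[OF convex_connected[OF A(3)] cont ex]) (simp, rule that, simp)
      show ?thesis
        by (intro exI[of _ "\<lambda>z. \<i> / of_real t * (l z + d - c)"] conjI holomorphic_intros l ballI)
           (simp add: F_def d)
    qed
    have "ball q r \<inter> {z. Re z < Re q} \<subseteq> slit_plane E" "ball q r \<inter> {z. Re z > Re q} \<subseteq> slit_plane E"
      using r(3) by auto
    then obtain Fl Fr where Fl: "Fl holomorphic_on ball q r" "\<forall>z\<in>ball q r \<inter> {z. Re z < Re q}. Fl z = F z"
      and Fr: "Fr holomorphic_on ball q r" "\<forall>z\<in>ball q r \<inter> {z. Re z > Re q}. Fr z = F z"
      using half[OF Int_lower1 _ convex_Int[OF convex_ball convex_halfspace_Re_lt]]
        half[OF Int_lower1 _ convex_Int[OF convex_ball convex_halfspace_Re_gt]] by metis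
    show ?thesis using r(1) Fl Fr by (intro exI[of _ r] conjI exI[of _ Fl] exI[of _ Fr]) auto
  qed
  have "slit_extension f E F"
    unfolding slit_extension_def using Ecount Ereal Eiso Fhol Freal side by auto
  then show "\<exists>F. slit_extension f (quotient_sing H G) F" unfolding E_def by blast
qed

section \<open>Quotients of functions of exponential type\<close>

text \<open>The map \<open>w / (2 M - w)\<close> sends the half plane of real part less than
  \<open>M\<close> into the unit disk and fixes 0. Schwarz's lemma gives modulus at most 1/2 at half
  the radius, and solving for \<open>w\<close> gives the bound \<open>2 M\<close>.\<close>

lemma Borel_Caratheodory_half:
  assumes f: "f holomorphic_on ball 0 r" and r: "r > 0"
    and A: "\<And>z. z \<in> ball 0 r \<Longrightarrow> Re (f z) \<le> A" and z: "norm z \<le> r / 2"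
  shows "norm (f z - f 0) \<le> 2 * (A - Re (f 0))"
proof (rule field_le_epsilon)
  fix e :: real assume e: "e > 0"
  \<comment> \<open>The margin \<open>e / 2\<close> makes the inequality for the real part strict
    and \<open>M\<close> positive, also for constant \<open>f\<close>; it is removed by letting
    \<open>e\<close> tend to 0.\<close>
  define M where "M = A - Re (f 0) + e / 2"
  have M: "M > 0" using A[of 0] r e by (simp add: M_def)
  define g where "g = (\<lambda>w. (f (of_real r * w) - f 0) / (of_real (2 * M) - (f (of_real r * w) - f 0)))"
  have in_ball: "of_real r * w \<in> ball 0 r" if "norm w < 1" for w :: complex
    using that r by (simp add: norm_mult)
  have Re: "Re (f (of_real r * w) - f 0) < M" if "norm w < 1" for w
    using A[OF in_ball[OF that]] e by (simp add: M_def)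
  have den: "norm x < norm (of_real (2 * M) - x)" if "Re x < M" for x
  proof -
    have "(norm x)\<^sup>2 < (norm (of_real (2 * M) - x))\<^sup>2"
    proof -
      have "M * Re x < M * M" using that M by simp
      then show ?thesis unfolding cmod_power2 by (simp add: power2_eq_square algebra_simps)
    qed
    then show ?thesis by (rule power2_less_imp_less) auto
  qed
  have dnz: "of_real (2 * M) - x \<noteq> 0" if "Re x < M" for x
    using that M by (auto simp: complex_eq_iff)
  have "g holomorphic_on ball 0 1"
  proof -
    have "(\<lambda>w. f (of_real r * w)) holomorphic_on ball 0 1"
    proof -
      have "(\<lambda>w. complex_of_real r * w) ` ball 0 1 \<subseteq> ball 0 r" using in_ball by auto
      then show ?thesis
        using holomorphic_on_compose_gen[OF _ f, of "\<lambda>w. of_real r * w" "ball 0 1"]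
        by (simp add: o_def holomorphic_on_mult holomorphic_on_ident holomorphic_on_const)
    qed
    then show ?thesis unfolding g_def
      using dnz Re by (intro holomorphic_intros) auto
  qed
  moreover have "g 0 = 0" by (simp add: g_def)
  moreover have "norm (g w) < 1" if "norm w < 1" for w
  proof -
    have "norm (f (of_real r * w) - f 0) < norm (of_real (2 * M) - (f (of_real r * w) - f 0))"
      by (rule den[OF Re[OF that]])
    then show ?thesis unfolding g_def norm_divide
      by (subst divide_less_eq_1_pos) (auto intro: le_less_trans[OF norm_ge_zero])
  qed
  moreover have "norm (z / of_real r) < 1" using z r by (simp add: norm_divide divide_less_eq)
  ultimately have "norm (g (z / of_real r)) \<le> norm (z / of_real r)"
    using Schwarz_Lemma(1)[of g] by blast
  also have "\<dots> \<le> 1 / 2" using z r by (simp add: norm_divide divide_le_eq)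
  finally have le: "norm (f z - f 0) / norm (of_real (2 * M) - (f z - f 0)) \<le> 1 / 2"
    using r by (simp add: g_def norm_divide)
  have "Re (f z - f 0) < M" using Re[OF \<open>norm (z / of_real r) < 1\<close>] r by simp
  then have "norm (of_real (2 * M) - (f z - f 0)) > 0" using dnz by simp
  then have "norm (f z - f 0) \<le> 1 / 2 * norm (of_real (2 * M) - (f z - f 0))"
    using le by (simp add: divide_le_eq)
  also have "\<dots> \<le> 1 / 2 * (norm (complex_of_real (2 * M)) + norm (f z - f 0))"
    by (intro mult_left_mono norm_triangle_ineq4) auto
  finally have "norm (f z - f 0) \<le> 2 * M" using M by simp
  then show "norm (f z - f 0) \<le> 2 * (A - Re (f 0)) + e" by (simp add: M_def)
qed

text \<open>Reflecting the zeros in the circle keeps the modulus on the circle and enlarges it at the centre.\<close>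

lemma reflect_zeros:
  assumes "f holomorphic_on UNIV" "f 0 \<noteq> 0" "r > 0" "\<And>z. norm z = r \<Longrightarrow> f z \<noteq> 0"
  obtains g where "g holomorphic_on UNIV" "\<And>z. norm z \<le> r \<Longrightarrow> g z \<noteq> 0"
    "\<And>z. norm z = r \<Longrightarrow> norm (g z) = norm (f z)" "norm (g 0) \<ge> norm (f 0)"
proof -
  have fin: "finite {z \<in> cball 0 r. f z = 0}" if "f holomorphic_on UNIV" "f 0 \<noteq> 0" for f
  proof (cases "f constant_on UNIV")
    case True
    then show ?thesis using that(2) by (auto simp: constant_on_def)
  next
    case False
    then show ?thesis using holomorphic_compact_finite_zeros[OF that(1), of "cball 0 r"] by auto
  qed
  have "\<exists>g. g holomorphic_on UNIV \<and> (\<forall>z. norm z \<le> r \<longrightarrow> g z \<noteq> 0) \<and>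
    (\<forall>z. norm z = r \<longrightarrow> norm (g z) = norm (f z)) \<and> norm (g 0) \<ge> norm (f 0)"
    using assms
  \<comment> \<open>One zero is reflected at a time, which lowers the number of distinct zeros in
    the disk.\<close>
  proof (induction "card {z \<in> cball 0 r. f z = 0}" arbitrary: f rule: less_induct)
    case less
    show ?case
    proof (cases "\<exists>a. norm a \<le> r \<and> f a = 0")
      case False
      then show ?thesis using less.prems by (intro exI[of _ f]) auto
    next
      case True
      then obtain a where a: "norm a \<le> r" "f a = 0" by auto
      then have ar: "norm a < r" using less.prems(4)[of a] by (cases "norm a = r") auto
      obtain n g \<rho> where g: "\<rho> > 0" "g holomorphic_on ball a \<rho>"
        "\<And>w. w \<in> ball a \<rho> \<Longrightarrow> g w \<noteq> 0" "\<And>w. w \<in> ball a \<rho> \<Longrightarrow> f w = (w - a) ^ n * g w"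
        by (rule entire_local_factor[OF less.prems(1,2)]) blast
      \<comment> \<open>Glues the local cofactor to the global quotient, giving an entire function
        that is nonzero at \<open>a\<close>: the zero is removed with its whole
        multiplicity.\<close>
      define q where "q = (\<lambda>z. if z \<in> ball a \<rho> then g z else f z / (z - a) ^ n)"
      have q: "f z = (z - a) ^ n * q z" for z
        using g(1,4) by (auto simp: q_def)
      have qhol: "q holomorphic_on UNIV"
      proof -
        have "q holomorphic_on ball a \<rho>" using g(2) by (rule holomorphic_transform) (auto simp: q_def)
        moreover have "q holomorphic_on - {a}"
        proof (rule holomorphic_transform[of "\<lambda>z. f z / (z - a) ^ n"])
          show "(\<lambda>z. f z / (z - a) ^ n) holomorphic_on - {a}"
            using less.prems(1) by (intro holomorphic_intros) (auto intro: holomorphic_on_subset)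
        qed (use q in auto)
        ultimately have "q holomorphic_on ball a \<rho> \<union> - {a}"
          by (intro holomorphic_on_Un) auto
        moreover have "ball a \<rho> \<union> - {a} = UNIV" using g(1) by auto
        ultimately show ?thesis by simp
      qed
      have qa: "q a \<noteq> 0" using g by (simp add: q_def)
      \<comment> \<open>The only zero of \<open>b\<close> is the reflection of \<open>a\<close> in
        the circle, which lies outside the disk. On the circle \<open>r * r = z * cnj z\<close>
        gives \<open>b\<close> the modulus of \<open>z - a\<close>, and at the centre
        \<open>b\<close> has modulus \<open>r\<close>, which exceeds that of
        \<open>a\<close>.\<close>
      define b where "b = (\<lambda>z. of_real r - cnj a * z / of_real r)"
      define h where "h = (\<lambda>z. b z ^ n * q z)"
      have bnz: "b z \<noteq> 0" if "norm z \<le> r" for z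
      proof
        assume "b z = 0"
        then have "cnj a * z = of_real (r * r)" using less.prems(3) by (simp add: b_def field_simps)
        then have "norm a * norm z = r * r"
          using less.prems(3) by (metis abs_of_nonneg complex_mod_cnj norm_mult norm_of_real zero_le_square)
        moreover have "norm a * norm z \<le> norm a * r" using that by (intro mult_left_mono) auto
        moreover have "norm a * r < r * r" using ar less.prems(3) by simp
        ultimately show False by simp
      qed
      have bnorm: "norm (b z) = norm (z - a)" if "norm z = r" for z
      proof -
        have "z * cnj z = of_real (r * r)" using that complex_norm_square[of z]
          by (simp add: power2_eq_square)
        have "b z * of_real r = z * cnj z - cnj a * z"
          using \<open>z * cnj z = of_real (r * r)\<close> less.prems(3) by (simp add: b_def field_simps)
        also have "\<dots> = z * cnj (z - a)" by (simp add: algebra_simps)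
        finally have "norm (b z * of_real r) = norm (z * cnj (z - a))" by simp
        then show ?thesis using that less.prems(3) by (simp add: norm_mult del: complex_cnj_diff)
      qed
      have hhol: "h holomorphic_on UNIV"
        unfolding h_def b_def by (intro holomorphic_intros qhol) (use less.prems(3) in auto)
      have h0: "norm (h 0) \<ge> norm (f 0)"
        using q[of 0] ar by (auto simp: h_def b_def norm_mult norm_power intro!: mult_right_mono power_mono)
      have hf: "norm (h z) = norm (f z)" if "norm z = r" for z
        using q[of z] bnorm[OF that] by (simp add: h_def norm_mult norm_power)
      have h00: "h 0 \<noteq> 0" using h0 less.prems(2) by auto
      have sub: "{z \<in> cball 0 r. h z = 0} \<subset> {z \<in> cball 0 r. f z = 0}"
      proof
        show "{z \<in> cball 0 r. h z = 0} \<subseteq> {z \<in> cball 0 r. f z = 0}"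
          using bnz q by (auto simp: h_def)
        have "h a \<noteq> 0" using qa bnz[of a] a by (simp add: h_def)
        then show "{z \<in> cball 0 r. h z = 0} \<noteq> {z \<in> cball 0 r. f z = 0}" using a by auto
      qed
      have "card {z \<in> cball 0 r. h z = 0} < card {z \<in> cball 0 r. f z = 0}"
        by (rule psubset_card_mono[OF fin[OF less.prems(1,2)] sub])
      moreover have "h z \<noteq> 0" if "norm z = r" for z
        using hf[OF that] less.prems(4)[OF that] by auto
      ultimately obtain k where "k holomorphic_on UNIV" "\<forall>z. norm z \<le> r \<longrightarrow> k z \<noteq> 0"
        "\<forall>z. norm z = r \<longrightarrow> norm (k z) = norm (h z)" "norm (k 0) \<ge> norm (h 0)"
        using less.hyps[OF _ hhol h00 less.prems(3)] by blast
      then show ?thesis using hf h0 by (intro exI[of _ k]) auto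
    qed
  qed
  then show thesis using that by blast
qed

lemma maximum_modulus_cball:
  assumes "f holomorphic_on cball 0 r" "r > 0" "\<And>z. norm z = r \<Longrightarrow> norm (f z) \<le> B" "norm z \<le> r"
  shows "norm (f z) \<le> B"
proof -
  have 1: "f holomorphic_on interior (cball 0 r)"
    using assms(1) by (rule holomorphic_on_subset) (simp add: interior_cball)
  have 2: "continuous_on (closure (cball 0 r)) f"
    using assms(1) by (simp add: holomorphic_on_imp_continuous_on)
  have 3: "norm (f w) \<le> B" if "w \<in> frontier (cball 0 r)" for w
    using that assms(2,3) by (auto simp: frontier_cball)
  show ?thesis
    by (rule maximum_modulus_frontier[OF 1 2 bounded_cball 3]) (use assms(4) in auto)
qed

text \<open>After reflecting the zeros of \<open>G\<close> and \<open>H\<close> in the circle, both have logarithms on the disk that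
  Borel--Caratheodory bounds. What \<open>h\<close> adds to the difference of these logarithms has vanishing
  real part on the circle, hence is constant.\<close>

lemma exponential_type_quotient_bound:
  assumes G: "G holomorphic_on UNIV" "G 0 \<noteq> 0" and H: "H holomorphic_on UNIV"
    and h: "h holomorphic_on UNIV" and eq: "\<And>z. H z = G z * exp (h z)"
    and r: "r > 0" "\<And>z. norm z = r \<Longrightarrow> G z \<noteq> 0"
    and bound: "\<And>z. norm z = r \<Longrightarrow> norm (G z) \<le> exp A" "\<And>z. norm z = r \<Longrightarrow> norm (H z) \<le> exp A"
    and z: "norm z \<le> r / 2"
  shows "norm (h z - h 0) \<le> 2 * (A - ln (norm (G 0))) + 2 * (A - ln (norm (H 0)))"
proof -
  have H0: "H 0 \<noteq> 0" and Hr: "norm z = r \<Longrightarrow> H z \<noteq> 0" for z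
    using eq G r by auto
  obtain G1 where G1: "G1 holomorphic_on UNIV" "\<And>z. norm z \<le> r \<Longrightarrow> G1 z \<noteq> 0"
    "\<And>z. norm z = r \<Longrightarrow> norm (G1 z) = norm (G z)" "norm (G1 0) \<ge> norm (G 0)"
    by (rule reflect_zeros[OF G r(1)], erule r(2), rule that) simp_all
  obtain H1 where H1: "H1 holomorphic_on UNIV" "\<And>z. norm z \<le> r \<Longrightarrow> H1 z \<noteq> 0"
    "\<And>z. norm z = r \<Longrightarrow> norm (H1 z) = norm (H z)" "norm (H1 0) \<ge> norm (H 0)"
    by (rule reflect_zeros[OF H H0 r(1)], erule Hr, rule that) simp_all
  \<comment> \<open>On the circle the reflected function has the modulus of the original, so the
    maximum principle bounds the real part of its logarithm by \<open>A\<close> inside. At the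
    centre reflection can only enlarge the modulus, so \<open>ln (norm (F 0))\<close> is still a
    lower bound there.\<close>
  have log: "\<exists>L. L holomorphic_on cball 0 r \<and> (\<forall>z\<in>cball 0 r. f z = exp (L z)) \<and>
     (norm z \<le> r / 2 \<longrightarrow> norm (L z - L 0) \<le> 2 * (A - ln (norm (F 0))))"
    if f: "f holomorphic_on UNIV" "\<And>z. norm z \<le> r \<Longrightarrow> f z \<noteq> 0"
      "\<And>z. norm z = r \<Longrightarrow> norm (f z) = norm (F z)" "norm (f 0) \<ge> norm (F 0)"
      "\<And>z. norm z = r \<Longrightarrow> norm (F z) \<le> exp A" "F 0 \<noteq> 0" for f F :: "complex \<Rightarrow> complex"
  proof -
    obtain L where L: "L holomorphic_on cball 0 r" "\<And>z. z \<in> cball 0 r \<Longrightarrow> f z = exp (L z)"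
      by (rule contractible_imp_holomorphic_log[OF _ convex_imp_contractible[OF convex_cball], of f 0 r])
         (use f in \<open>auto intro: holomorphic_on_subset\<close>)
    have re: "Re (L z) = ln (norm (f z))" if "z \<in> cball 0 r" for z using L(2)[OF that] by simp
    have "Re (L w) \<le> A" if w: "w \<in> ball 0 r" for w
    proof -
      have "norm (f w) \<le> exp A"
        by (rule maximum_modulus_cball[of f r]) (use f w r in \<open>auto intro: holomorphic_on_subset\<close>)
      moreover have "norm (f w) = exp (Re (L w))" using L(2)[of w] w by simp
      ultimately show ?thesis by simp
    qed
    then have "norm (L z - L 0) \<le> 2 * (A - Re (L 0))" if "norm z \<le> r / 2"
      using that r L(1) by (intro Borel_Caratheodory_half[of L r]) (auto intro: holomorphic_on_subset)
    moreover have "ln (norm (F 0)) \<le> ln (norm (f 0))" using f(4,6) by (intro ln_mono) auto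
    then have "ln (norm (F 0)) \<le> Re (L 0)" using re[of 0] r by simp
    ultimately show ?thesis using L by force
  qed
  obtain LG where LG: "LG holomorphic_on cball 0 r" "\<And>z. z \<in> cball 0 r \<Longrightarrow> G1 z = exp (LG z)"
     "norm (LG z - LG 0) \<le> 2 * (A - ln (norm (G 0)))"
    using log[OF G1 bound(1) G(2)] z by blast
  obtain LH where LH: "LH holomorphic_on cball 0 r" "\<And>z. z \<in> cball 0 r \<Longrightarrow> H1 z = exp (LH z)"
     "norm (LH z - LH 0) \<le> 2 * (A - ln (norm (H 0)))"
    using log[OF H1 bound(2) H0] z by blast
  define d where "d = (\<lambda>z. h z - LH z + LG z)"
  have dhol: "d holomorphic_on cball 0 r"
    unfolding d_def by (intro holomorphic_intros LG LH holomorphic_on_subset[OF h]) auto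
  have circ: "Re (d w) = 0" if w: "norm w = r" for w
  \<comment> \<open>The reflected functions may be replaced by \<open>G\<close> and \<open>H\<close>
    inside norms on the circle, and there \<open>H = G * exp h\<close>.\<close>
  proof -
    have "norm (exp (d w)) = norm (exp (h w)) * norm (G1 w) / norm (H1 w)"
      using LG(2)[of w] LH(2)[of w] w
      by (simp add: d_def exp_add exp_diff norm_mult norm_divide del: norm_exp_eq_Re)
    also have "\<dots> = norm (exp (h w)) * norm (G w) / norm (H w)"
      using w G1(3) H1(3) by simp
    also have "\<dots> = 1" using eq[of w] Hr[OF w] r(2)[OF w] by (simp add: norm_mult)
    finally show ?thesis by simp
  qed
  have "norm (exp (d w)) \<le> 1" "norm (exp (- d w)) \<le> 1" if "norm w \<le> r" for w
  proof -
    show "norm (exp (d w)) \<le> 1"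
      by (rule maximum_modulus_cball[of "\<lambda>w. exp (d w)" r])
         (use circ that r in \<open>auto intro!: holomorphic_intros dhol\<close>)
    show "norm (exp (- d w)) \<le> 1"
      by (rule maximum_modulus_cball[of "\<lambda>w. exp (- d w)" r])
         (use circ that r in \<open>auto intro!: holomorphic_intros dhol\<close>)
  qed
  \<comment> \<open>The maximum principle for both \<open>exp d\<close> and \<open>exp (- d)\<close>
    squeezes the real part of \<open>d\<close>. The Borel-Caratheodory bound with upper bound 0 then
    makes \<open>d\<close> constant.\<close>
  then have "Re (d w) = 0" if "norm w \<le> r" for w using that by (fastforce intro: antisym)
  then have "norm (d z - d 0) \<le> 2 * (0 - Re (d 0))"
    using z r by (intro Borel_Caratheodory_half[of d r]) (auto intro: holomorphic_on_subset[OF dhol])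
  then have "d z = d 0" using \<open>\<And>w. norm w \<le> r \<Longrightarrow> Re (d w) = 0\<close>[of 0] r by simp
  then have "h z - h 0 = (LH z - LH 0) - (LG z - LG 0)" by (simp add: d_def algebra_simps)
  then have "norm (h z - h 0) \<le> norm (LH z - LH 0) + norm (LG z - LG 0)"
    by (metis norm_triangle_ineq4)
  then show ?thesis using LG(3) LH(3) by linarith
qed

text \<open>The estimate on circles of radius about \<open>2 * norm z\<close> gives \<open>h\<close>
  linear growth, and an entire function of linear growth is a polynomial of degree at most
  one.\<close>

lemma exponential_type_quotient_affine_at_0:
  assumes G: "G holomorphic_on UNIV" "G 0 \<noteq> 0" and H: "H holomorphic_on UNIV"
    and h: "h holomorphic_on UNIV" and eq: "\<And>z. H z = G z * exp (h z)"
    and bound: "\<And>z. norm (G z) \<le> exp (B + R * norm z)" "\<And>z. norm (H z) \<le> exp (B + R * norm z)"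
    and R: "R \<ge> 0"
  obtains \<alpha> \<beta> where "\<And>z. h z = \<alpha> * z + \<beta>"
proof -
  define K where "K = norm (h 0) + 4 * \<bar>B\<bar> + 8 * R + 2 * \<bar>ln (norm (G 0))\<bar> + 2 * \<bar>ln (norm (H 0))\<bar>"
  have lin: "norm (h z) \<le> K + 8 * R * norm z" for z
  proof -
    have fin: "finite {w \<in> cball 0 (2 * norm z + 2). G w = 0}"
    proof (cases "G constant_on UNIV")
      case True
      then show ?thesis using G(2) by (auto simp: constant_on_def)
    next
      case False
      then show ?thesis using holomorphic_compact_finite_zeros[OF G(1), of "cball 0 (2 * norm z + 2)"] by auto
    qed
    \<comment> \<open>The circle has to avoid the zeros of \<open>G\<close>. Finitely many of them
      lie in the larger disk, so some radius in the interval is not the modulus of any.\<close>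
    have "infinite {2 * norm z + 1..2 * norm z + 2}" by (simp add: infinite_Icc)
    then obtain r where r: "r \<in> {2 * norm z + 1..2 * norm z + 2}" "r \<notin> norm ` {w \<in> cball 0 (2 * norm z + 2). G w = 0}"
      using fin by (meson finite_imageI finite_subset subsetI)
    have "norm (h z - h 0) \<le> 2 * ((B + R * r) - ln (norm (G 0))) + 2 * ((B + R * r) - ln (norm (H 0)))"
    proof (rule exponential_type_quotient_bound[OF G H h eq])
      show "r > 0" using r(1) by (smt (verit) atLeastAtMost_iff norm_ge_zero)
      show "norm z \<le> r / 2" using r(1) by simp
      show "G w \<noteq> 0" if "norm w = r" for w using r that by force
      show "norm (G w) \<le> exp (B + R * r)" "norm (H w) \<le> exp (B + R * r)" if "norm w = r" for w
        using bound[of w] that by auto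
    qed
    moreover have "R * r \<le> R * (2 * norm z + 2)" using r R by (intro mult_left_mono) auto
    moreover have "norm (h z) \<le> norm (h 0) + norm (h z - h 0)" by (metis norm_triangle_sub)
    ultimately show ?thesis unfolding K_def by (simp add: algebra_simps)
  qed
  have poly: "h \<xi> = (\<Sum>k\<le>1. (deriv ^^ k) h 0 / fact k * \<xi> ^ k)" for \<xi>
  proof (rule Liouville_polynomial[OF h])
    fix z :: complex assume z: "1 \<le> norm z"
    have "K \<ge> 0" using R by (simp add: K_def)
    then have "K * 1 \<le> K * norm z" using z by (intro mult_left_mono) auto
    then show "norm (h z) \<le> (K + 8 * R) * norm z ^ 1" using lin[of z] by (simp add: algebra_simps)
  qed
  show thesis
  proof (rule that)
    fix z show "h z = deriv h 0 * z + h 0"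
      using poly[of z] unfolding One_nat_def by simp
  qed
qed

text \<open>Translation by \<open>a\<close> reduces to a function that is nonzero at 0; the shift
  only enlarges the constant \<open>B\<close> by \<open>R * norm a\<close>.\<close>

lemma exponential_type_quotient_affine:
  assumes G: "G holomorphic_on UNIV" "G a \<noteq> 0" and H: "H holomorphic_on UNIV"
    and h: "h holomorphic_on UNIV" and eq: "\<And>z. H z = G z * exp (h z)"
    and bound: "\<And>z. norm (G z) \<le> exp (B + R * norm z)" "\<And>z. norm (H z) \<le> exp (B + R * norm z)"
    and R: "R \<ge> 0"
  obtains \<alpha> \<beta> where "\<And>z. h z = \<alpha> * z + \<beta>"
proof -
  have shift: "(\<lambda>z. f (z + a)) holomorphic_on UNIV" if "f holomorphic_on UNIV" for f
    using holomorphic_on_compose_gen[OF _ that, of "\<lambda>z. z + a" UNIV]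
    by (simp add: o_def holomorphic_on_add holomorphic_on_ident holomorphic_on_const)
  have b: "exp (B + R * norm (z + a)) \<le> exp ((B + R * norm a) + R * norm z)" for z
    using R norm_triangle_ineq[of z a] mult_left_mono[of "norm (z + a)" "norm z + norm a" R]
    by (simp add: algebra_simps)
  obtain \<alpha> \<beta> where "\<And>z. h (z + a) = \<alpha> * z + \<beta>"
    by (rule exponential_type_quotient_affine_at_0[OF shift[OF G(1)] _ shift[OF H] shift[OF h], of "B + R * norm a" R])
       (use G(2) eq R order_trans[OF bound(1) b] order_trans[OF bound(2) b] in auto)
  from this[of "z - a" for z] show thesis
    by (intro that[of \<alpha> "\<beta> - \<alpha> * a"]) (simp add: algebra_simps)
qed

text \<open>The bound on \<open>H\<close> makes \<open>G(z) exp (- i R z)\<close> decay in the upper half plane, and that on \<open>G\<close>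
  makes it bounded in the lower one; Liouville's theorem applies.\<close>

lemma Paley_Wiener_frequency_shift:
  assumes G: "G holomorphic_on UNIV"
    and eq: "\<And>z. H z = G z * exp (- \<i> * of_real \<tau> * z + \<beta>)"
    and bound: "\<And>z. norm (G z) \<le> C * exp (R * \<bar>Im z\<bar>)" "\<And>z. norm (H z) \<le> C * exp (R * \<bar>Im z\<bar>)"
    and R: "R \<ge> 0" and \<tau>: "\<tau> > 2 * R"
  shows "G z = 0"
proof -
  define P where "P = (\<lambda>z. G z * exp (- \<i> * of_real R * z))"
  have P: "P holomorphic_on UNIV" unfolding P_def by (intro holomorphic_intros G)
  have nP: "norm (P z) = norm (G z) * exp (R * Im z)" for z by (simp add: P_def norm_mult)
  have C: "C \<ge> 0" using order_trans[OF norm_ge_zero bound(1)[of 0]] by simp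
  define D where "D = C / exp (Re \<beta>)"
  have D: "D \<ge> 0" using C by (simp add: D_def)
  \<comment> \<open>The exponential factor of \<open>H\<close> has modulus
    \<open>exp (\<tau> * Im z + Re \<beta>)\<close>. Dividing by it leaves the exponent
    \<open>R - \<tau>\<close> for \<open>G\<close>, and the factor in \<open>P\<close> adds another
    \<open>R\<close>.\<close>
  have up: "norm (P z) \<le> D * exp ((2 * R - \<tau>) * Im z)" if "Im z \<ge> 0" for z
  proof -
    have "norm (G z) * exp (\<tau> * Im z) * exp (Re \<beta>) \<le> C * exp (R * Im z)"
      using bound(2)[of z] that by (simp add: eq norm_mult exp_add mult_ac)
    then have "norm (G z) * exp (R * Im z) \<le> C * exp (R * Im z) / exp (Re \<beta>) / exp (\<tau> * Im z) * exp (R * Im z)"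
      by (simp add: field_simps)
    also have "\<dots> = D * exp ((2 * R - \<tau>) * Im z)"
      by (simp add: D_def algebra_simps exp_diff exp_add exp_double power2_eq_square) (simp add: mult_exp_exp)
    finally show ?thesis by (simp add: nP)
  qed
  have "bounded (range P)"
  proof (rule boundedI[of _ "max C D"], clarify)
    fix z
    show "norm (P z) \<le> max C D"
    proof (cases "Im z \<ge> 0")
      case True
      have "exp ((2 * R - \<tau>) * Im z) \<le> 1" using True \<tau> by (simp add: mult_nonpos_nonneg)
      then have "D * exp ((2 * R - \<tau>) * Im z) \<le> D * 1" using D by (intro mult_left_mono)
      then show ?thesis using up[OF True] by simp
    next
      case False
      then have "norm (G z) * exp (R * Im z) \<le> C * exp (R * - Im z) * exp (R * Im z)"
        using bound(1)[of z] by (intro mult_right_mono) auto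
      also have "\<dots> = C" by (simp add: exp_minus)
      finally show ?thesis by (simp add: nP)
    qed
  qed
  then obtain c where c: "\<And>z. P z = c"
    using Liouville_theorem[OF P] by (auto simp: constant_on_def)
  \<comment> \<open>The constant value of \<open>P\<close> is bounded along the positive imaginary
    axis by a quantity that tends to 0, since \<open>\<tau> > 2 * R\<close>.\<close>
  have "((\<lambda>y. D * exp ((2 * R - \<tau>) * y)) \<longlongrightarrow> 0) at_top"
    using \<tau> by real_asymp
  moreover have "norm c \<le> D * exp ((2 * R - \<tau>) * y)" if "y \<ge> 0" for y
    using up[of "\<i> * of_real y"] c that by simp
  ultimately have "norm c \<le> 0"
    by (intro tendsto_lowerbound[of _ _ at_top]) (auto simp: eventually_at_top_linorder intro!: exI[of _ 0])
  then show ?thesis using c[of z] by (simp add: P_def)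
qed

section \<open>Extensions without singularities\<close>

text \<open>The derivative of such a logarithm is \<open>k / (z - p)\<close>. Its integral around
  \<open>p\<close> is \<open>2 * pi * \<i> * k\<close>, but it must be 0 because a single-valued
  primitive exists.\<close>

lemma no_logarithm_of_power_int:
  fixes w :: "complex \<Rightarrow> complex"
  assumes r: "r > 0" and w: "w holomorphic_on ball p r - {p}"
    and eq: "\<And>z. z \<in> ball p r - {p} \<Longrightarrow> exp (w z) = (z - p) powi k"
  shows "k = 0"
proof -
  let ?S = "ball p r - {p}"
  have der: "(w has_field_derivative of_int k * (1 / (z - p))) (at z within ?S)" if z: "z \<in> ?S" for z
  proof -
    have op: "open ?S" by auto
    have dw: "(w has_field_derivative deriv w z) (at z)"
      using w z op holomorphic_derivI by blast
    have "((\<lambda>z. exp (w z)) has_field_derivative exp (w z) * deriv w z) (at z)"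
      using dw by (auto intro!: derivative_eq_intros)
    then have "((\<lambda>z. (z - p) powi k) has_field_derivative exp (w z) * deriv w z) (at z)"
      using op z eq by (rule has_field_derivative_transform_within_open)
    moreover have "((\<lambda>z. (z - p) powi k) has_field_derivative of_int k * (z - p) powi (k - 1) * 1) (at z)"
      using z by (intro DERIV_power_int) (auto intro!: derivative_eq_intros)
    ultimately have "exp (w z) * deriv w z = of_int k * (z - p) powi (k - 1) * 1"
      by (rule DERIV_unique)
    then have "(z - p) powi k * deriv w z = (z - p) powi k * (of_int k * (1 / (z - p)))"
      using z eq[OF z] by (simp add: power_int_diff)
    moreover have "(z - p) powi k \<noteq> 0" using eq[OF z] by (metis exp_not_eq_zero)
    ultimately have "deriv w z = of_int k * (1 / (z - p))" by (metis mult_left_cancel)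
    then show ?thesis using dw by (metis has_field_derivative_at_within)
  qed
  have pi: "path_image (circlepath p (r / 2)) \<subseteq> ?S"
  proof
    fix x assume "x \<in> path_image (circlepath p (r / 2))"
    then have "dist p x = r / 2" using r by simp
    then show "x \<in> ?S" using r by auto
  qed
  have "((\<lambda>z. of_int k * (1 / (z - p))) has_contour_integral
     w (pathfinish (circlepath p (r/2))) - w (pathstart (circlepath p (r/2)))) (circlepath p (r/2))"
    by (rule contour_integral_primitive[OF der valid_path_circlepath pi])
  then have "((\<lambda>z. of_int k * (1 / (z - p))) has_contour_integral 0) (circlepath p (r/2))" by simp
  moreover have "((\<lambda>z. of_int k * (1 / (z - p))) has_contour_integral of_int k * (2 * of_real pi * \<i>)) (circlepath p (r/2))"
  proof (rule has_contour_integral_lmul)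
    have "((\<lambda>u. 1 / (u - p)) has_contour_integral 2 * of_real pi * \<i> * 1) (circlepath p (r/2))"
      using r Cauchy_integral_circlepath_simple[of "\<lambda>_. 1" p "r/2" p] by simp
    then show "((\<lambda>u. 1 / (u - p)) has_contour_integral 2 * of_real pi * \<i>) (circlepath p (r/2))" by simp
  qed
  ultimately have "of_int k * (2 * of_real pi * \<i>) = 0"
    by (rule has_contour_integral_unique[symmetric])
  then show ?thesis by simp
qed

text \<open>The relation \<open>H = G * exp (- i t F)\<close> spreads from the real axis to the slit
  plane and from there to every local continuation of \<open>F\<close>. At points outside
  \<open>E\<close> this gives the quotient a nonzero limit; at points of \<open>E\<close> it gives
  the quotient a logarithm on a punctured disk, which forces order 0.\<close>

lemma quotient_sing_empty:
  fixes f :: "real \<Rightarrow> real"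
  assumes G: "G holomorphic_on UNIV" "G a \<noteq> 0" and H: "H holomorphic_on UNIV"
    and eq: "\<And>s. H (of_real s) = exp (- \<i> * of_real (t * f s)) * G (of_real s)"
    and ext: "slit_extension f E F"
    and punct: "\<And>p. p \<in> E \<Longrightarrow> holomorphic_on_punctured_disk_at (slit_plane E) F p"
  shows "quotient_sing H G = {}"
proof -
  define S where "S = slit_plane E"
  obtain s0 where "G (of_real s0) \<noteq> 0" using entire_nonzero_on_reals[OF G] .
  then have Hb: "H (of_real s0) \<noteq> 0" by (simp add: eq)
  note GH = G H Hb
  have Ereal: "E \<inter> \<real> = {}" and Eiso: "\<And>z. \<not> z islimpt E" and Fhol: "F holomorphic_on S"
    and Freal: "\<And>s. F (of_real s) = of_real (f s)"
    using ext by (auto simp: slit_extension_def S_def)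
  have S: "open S" "connected S"
    unfolding S_def using open_slit_plane[OF Eiso] contractible_imp_connected[OF contractible_slit_plane] by auto
  have HS: "H z = G z * exp (- \<i> * of_real t * F z)" if "z \<in> S" for z
  proof -
    have "H z - G z * exp (- \<i> * of_real t * F z) = 0"
    proof (rule zero_on_reals_imp_zero[OF _ S _ _ that])
      show "(\<lambda>z. H z - G z * exp (- \<i> * of_real t * F z)) holomorphic_on S"
        by (intro holomorphic_intros Fhol holomorphic_on_subset[OF G(1)] holomorphic_on_subset[OF H]) auto
      show "range of_real \<subseteq> S" using of_real_in_slit_plane by (auto simp: S_def)
      show "H (of_real s) - G (of_real s) * exp (- \<i> * of_real t * F (of_real s)) = 0" for s
        by (simp add: eq Freal mult_ac)
    qed
    then show ?thesis by simp
  qed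
  \<comment> \<open>A branch \<open>W\<close> that agrees with \<open>F\<close> on some nonempty
    open set inherits the relation by the identity theorem.\<close>
  have cont: "H z = G z * exp (- \<i> * of_real t * W z)"
    if B: "open B" "connected B" "W holomorphic_on B" and A: "open A" "A \<noteq> {}" "A \<subseteq> B" "A \<subseteq> S"
      and WF: "\<And>z. z \<in> A \<Longrightarrow> W z = F z" and z: "z \<in> B" for A B W z
  proof -
    obtain x where x: "x \<in> A" using A by auto
    have "H z - G z * exp (- \<i> * of_real t * W z) = 0"
    proof (rule analytic_continuation[OF _ B(1,2) A(3) _ _ _ z])
      show "(\<lambda>z. H z - G z * exp (- \<i> * of_real t * W z)) holomorphic_on B"
        by (intro holomorphic_intros B(3) holomorphic_on_subset[OF G(1)] holomorphic_on_subset[OF H]) auto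
      show "x \<in> B" using x A by auto
      show "x islimpt A" using x A(1) by (simp add: open_imp_islimpt)
      show "H w - G w * exp (- \<i> * of_real t * W w) = 0" if "w \<in> A" for w
        using that HS[of w] WF[of w] A(4) by auto
    qed
    then show ?thesis by simp
  qed
  \<comment> \<open>Off \<open>p\<close> the quotient is locally an exponential, so its limit at
    \<open>p\<close> exists and is nonzero, whether or not \<open>G\<close> vanishes there.\<close>
  have reg: "p \<notin> quotient_sing H G"
    if B: "open B" "p \<in> B" "W holomorphic_on B" and W: "\<And>z. z \<in> B \<Longrightarrow> H z = G z * exp (- \<i> * of_real t * W z)" for p B W
  proof -
    obtain k U r where U: "r > 0" "\<And>w. w \<in> ball p r - {p} \<Longrightarrow> G w \<noteq> 0"
      by (rule entire_quotient_local[OF GH, of p]) blast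
    have "continuous_on B W" using B(3) by (rule holomorphic_on_imp_continuous_on)
    then have "isCont W p" using B by (simp add: continuous_on_eq_continuous_at)
    then have "((\<lambda>z. exp (- \<i> * of_real t * W z)) \<longlongrightarrow> exp (- \<i> * of_real t * W p)) (at p)"
      by (intro tendsto_intros) (simp add: isCont_def)
    moreover have "eventually (\<lambda>w. w \<in> ball p r \<inter> B - {p}) (at p)"
      using U(1) B by (intro eventually_at_in_open) auto
    then have "eventually (\<lambda>z. exp (- \<i> * of_real t * W z) = H z / G z) (at p)"
      by eventually_elim (use U W in auto)
    ultimately have "((\<lambda>z. H z / G z) \<longlongrightarrow> exp (- \<i> * of_real t * W p)) (at p)"
      by (rule Lim_transform_eventually)
    then show ?thesis unfolding quotient_sing_def using exp_not_eq_zero by blast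
  qed
  \<comment> \<open>Points just to the left of \<open>p\<close> avoid all slits, even if
    \<open>p\<close> lies on one. This is the open set on which a branch at \<open>p\<close> is
    compared with \<open>F\<close>.\<close>
  have left: "\<exists>A. open A \<and> A \<noteq> {} \<and> A \<subseteq> ball p \<rho> - {p} \<and> A \<subseteq> S \<and> (\<forall>z\<in>A. Re z < Re p)" if "\<rho> > 0" for p \<rho>
  proof -
    obtain r where r: "r > 0" "\<And>z. z \<in> ball p r \<Longrightarrow> Re z \<noteq> Re p \<Longrightarrow> z \<in> slit_plane E"
      by (rule slit_plane_local[OF Eiso, of p]) blast
    define A where "A = ball p (min r \<rho>) \<inter> {z. Re z < Re p}"
    have "open A" unfolding A_def by (intro open_Int open_ball open_halfspace_Re_lt)
    moreover have "p - of_real \<mu> \<in> A" if "\<mu> = min r \<rho> / 2" for \<mu>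
    proof -
      have "0 < \<mu>" "\<mu> < min r \<rho>" unfolding that using r(1) \<open>\<rho> > 0\<close> by auto
      then show ?thesis by (auto simp: A_def dist_norm)
    qed
    then have "A \<noteq> {}" by blast
    ultimately show ?thesis using r(2) by (intro exI[of _ A] conjI) (auto simp: A_def S_def)
  qed
  have "p \<notin> quotient_sing H G" for p
  proof (cases "p \<in> S")
    case True
    then show ?thesis using reg[OF S(1) True Fhol HS] by blast
  next
    case pS: False
    show ?thesis
    proof (cases "p \<in> E")
      case False
      then obtain r Fl where r: "r > 0" "Fl holomorphic_on ball p r"
        "\<And>z. z \<in> ball p r \<inter> S \<Longrightarrow> Re z < Re p \<Longrightarrow> Fl z = F z"
      proof -
        have "p \<in> - slit_plane E - E" using pS False by (auto simp: S_def)
        then have "\<exists>r>0. \<exists>Fl Fr. Fl holomorphic_on ball p r \<and> Fr holomorphic_on ball p r \<and>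
          (\<forall>z \<in> ball p r \<inter> slit_plane E. (Re z < Re p \<longrightarrow> Fl z = F z) \<and> (Re z > Re p \<longrightarrow> Fr z = F z))"
          using ext unfolding slit_extension_def by blast
        then show thesis using that unfolding S_def by blast
      qed
      obtain A where A: "open A" "A \<noteq> {}" "A \<subseteq> ball p r - {p}" "A \<subseteq> S" "\<forall>z\<in>A. Re z < Re p"
        by (rule exE[OF left[OF r(1), of p]]) blast
      have AF: "Fl z = F z" if "z \<in> A" for z using r(3)[of z] A(3-5) that by blast
      have Ab: "A \<subseteq> ball p r" using A(3) by blast
      have "H z = G z * exp (- \<i> * of_real t * Fl z)" if "z \<in> ball p r" for z
        by (rule cont[OF open_ball connected_ball r(2) A(1,2) Ab A(4) AF that])
      then show ?thesis using reg[OF open_ball _ r(2)] r(1) by auto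
    next
      case True
      obtain r W where r: "r > 0" "W holomorphic_on ball p r - {p}"
        "\<And>z. z \<in> (ball p r - {p}) \<inter> S \<Longrightarrow> W z = F z"
        using punct[OF True] unfolding holomorphic_on_punctured_disk_at_def S_def by blast
      obtain A where A: "open A" "A \<noteq> {}" "A \<subseteq> ball p r - {p}" "A \<subseteq> S"
        by (rule exE[OF left[OF r(1), of p]]) blast
      have HW: "H z = G z * exp (- \<i> * of_real t * W z)" if "z \<in> ball p r - {p}" for z
      proof (rule cont[OF _ _ r(2) A _ that])
        show "open (ball p r - {p})" by auto
        show "connected (ball p r - {p})" by (rule connected_punctured_ball) simp
        show "W z = F z" if "z \<in> A" for z using r(3)[of z] A(3,4) that by blast
      qed
      obtain k U q where U: "q > 0" "U holomorphic_on ball p q" "\<And>w. w \<in> ball p q \<Longrightarrow> U w \<noteq> 0"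
        "\<And>w. w \<in> ball p q - {p} \<Longrightarrow> G w \<noteq> 0" "\<And>w. w \<in> ball p q - {p} \<Longrightarrow> H w \<noteq> 0"
        "\<And>w. w \<in> ball p q - {p} \<Longrightarrow> H w / G w = U w * (w - p) powi k"
        by (rule entire_quotient_local[OF GH, of p]) blast
      obtain l where l: "l holomorphic_on ball p q" "\<And>z. z \<in> ball p q \<Longrightarrow> U z = exp (l z)"
        by (rule contractible_imp_holomorphic_log[OF U(2) convex_imp_contractible[OF convex_ball] U(3)]) blast+
      \<comment> \<open>Both \<open>exp (- i t W)\<close> and \<open>exp l * (z - p) powi k\<close>
        equal the quotient, so \<open>- i t W - l\<close> is a logarithm of the bare power.\<close>
      have "k = 0"
      proof (rule no_logarithm_of_power_int[of "min r q" "\<lambda>z. - \<i> * of_real t * W z - l z" p])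
        show "min r q > 0" using r U by simp
        show "(\<lambda>z. - \<i> * of_real t * W z - l z) holomorphic_on ball p (min r q) - {p}"
          by (intro holomorphic_intros holomorphic_on_subset[OF r(2)] holomorphic_on_subset[OF l(1)]) auto
        show "exp (- \<i> * of_real t * W z - l z) = (z - p) powi k" if z: "z \<in> ball p (min r q) - {p}" for z
        proof -
          have "exp (- \<i> * of_real t * W z) = H z / G z" using HW[of z] U(4)[of z] z by auto
          also have "\<dots> = exp (l z) * (z - p) powi k" using U(6)[of z] l(2)[of z] z by auto
          finally show ?thesis by (simp add: exp_diff)
        qed
      qed
      have "(U \<longlongrightarrow> U p) (at p)"
        using U(1,2) by (meson centre_in_ball continuous_on_eq_continuous_at holomorphic_on_imp_continuous_on isCont_def open_ball)
      moreover have "eventually (\<lambda>w. w \<in> ball p q - {p}) (at p)"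
        using U(1) by (intro eventually_at_in_open) auto
      then have "eventually (\<lambda>w. U w = H w / G w) (at p)"
        by eventually_elim (use U(6) \<open>k = 0\<close> in auto)
      ultimately have "((\<lambda>w. H w / G w) \<longlongrightarrow> U p) (at p)" by (rule Lim_transform_eventually)
      moreover have "U p \<noteq> 0" using U(1,3) by simp
      ultimately show ?thesis unfolding quotient_sing_def by blast
    qed
  qed
  then show ?thesis by auto
qed

text \<open>Without singularities the quotient is the exponential of an entire function, which
  exponential type makes affine. The slope bound comes from the shift estimate, used for the pair
  \<open>G\<close>, \<open>H\<close> and, with opposite sign, for the pair \<open>H\<close>,
  \<open>G\<close>.\<close>

lemma slice_affine:
  fixes f :: "real \<Rightarrow> real"
  assumes G: "G holomorphic_on UNIV" "G a \<noteq> 0" and H: "H holomorphic_on UNIV"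
    and f: "continuous_on UNIV f" and t: "t \<noteq> 0"
    and eq: "\<And>s. H (of_real s) = exp (- \<i> * of_real (t * f s)) * G (of_real s)"
    and bound: "\<And>z. norm (G z) \<le> C * exp (R * \<bar>Im z\<bar>)" "\<And>z. norm (H z) \<le> C * exp (R * \<bar>Im z\<bar>)"
    and R: "R \<ge> 0"
    and ext: "slit_extension f E F"
    and punct: "\<And>p. p \<in> E \<Longrightarrow> holomorphic_on_punctured_disk_at (slit_plane E) F p"
  obtains m b where "\<And>s. f s = m * s + b" "\<bar>t * m\<bar> \<le> 2 * R"
proof -
  obtain s0 where "G (of_real s0) \<noteq> 0" using entire_nonzero_on_reals[OF G] .
  then have Hb: "H (of_real s0) \<noteq> 0" by (simp add: eq)
  note GH = G H Hb
  define M where "M = remove_sings (\<lambda>z. H z / G z)"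
  have E: "z \<notin> quotient_sing H G" for z using quotient_sing_empty[OF G H eq ext punct] by simp
  then have "- quotient_sing H G = UNIV" by blast
  then have M1: "M holomorphic_on UNIV" using quotient_regular(1)[OF GH] by (simp add: M_def)
  have M2: "M z \<noteq> 0" and M3: "H z = G z * M z" for z
    unfolding M_def by (rule quotient_regular(2,3)[OF GH E])+
  note M = M1 M2 M3
  obtain h where h: "h holomorphic_on UNIV" "\<And>z. M z = exp (h z)"
    by (rule contractible_imp_holomorphic_log[OF M(1) contractible_UNIV M(2)]) blast+
  define u where "u = (\<lambda>s. exp (- \<i> * of_real (t * f s)))"
  have u: "continuous_on UNIV u" "\<And>s. norm (u s) = 1"
    unfolding u_def by (auto intro!: continuous_intros f)
  have Mu: "M (of_real s) = u s" for s
    unfolding M_def by (rule remove_sings_eqI[OF quotient_real_limit[OF GH u]]) (simp add: eq u_def)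
  have C: "C > 0"
  proof -
    have "0 < C * exp (R * \<bar>Im a\<bar>)" using G(2) bound(1)[of a] by (smt (verit) zero_less_norm_iff)
    then show ?thesis by (simp add: zero_less_mult_iff)
  qed
  have bb: "C * exp (R * \<bar>Im z\<bar>) \<le> exp (ln C + R * norm z)" for z
    using C R abs_Im_le_cmod[of z] by (simp add: exp_add mult_left_mono)
  obtain \<alpha> \<beta> where ab: "\<And>z. h z = \<alpha> * z + \<beta>"
    by (rule exponential_type_quotient_affine[OF G H h(1), of "ln C" R])
       (use M(3) h(2) R order_trans[OF bound(1) bb] order_trans[OF bound(2) bb] in auto)
  have c1: "continuous_on UNIV (\<lambda>s. - \<i> * complex_of_real (t * f s))"
    and c2: "continuous_on UNIV (\<lambda>s. h (complex_of_real s))"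
    unfolding ab by (intro continuous_intros f)+
  have ex: "exp (- \<i> * complex_of_real (t * f s)) = exp (h (complex_of_real s))" for s
    using Mu[of s] h(2)[of "of_real s"] by (simp add: u_def)
  obtain c where c: "- \<i> * complex_of_real (t * f s) = \<alpha> * of_real s + \<beta> + c" for s
    by (rule logarithms_differ_by_constant[OF connected_UNIV c1 c2 ex], rule that) (simp add: ab)
  \<comment> \<open>The values at 0 and 1 identify \<open>\<alpha>\<close> as
    \<open>- i t m\<close>, with \<open>m\<close> real because \<open>f\<close> is.\<close>
  define m where "m = f 1 - f 0"
  have \<alpha>: "\<alpha> = - \<i> * complex_of_real (t * m)"
    using c[of 1] c[of 0] by (simp add: m_def algebra_simps)
  have fs: "f s = m * s + f 0" for s
  proof -
    have "- \<i> * complex_of_real (t * f s) = - \<i> * complex_of_real (t * (m * s + f 0))"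
      using c[of s] c[of 0] by (simp add: \<alpha> algebra_simps)
    then have "complex_of_real (t * f s) = complex_of_real (t * (m * s + f 0))"
      by (simp only: mult_cancel_left) simp
    then show ?thesis using t by (simp only: of_real_eq_iff mult_cancel_left) simp
  qed
  have Heq: "H z = G z * exp (- \<i> * of_real (t * m) * z + \<beta>)" for z
    using M(3) h(2) ab \<alpha> by simp
  have Geq: "G z = H z * exp (- \<i> * of_real (- (t * m)) * z + (- \<beta>))" for z
    unfolding Heq by (simp add: mult.assoc flip: exp_add)
  have "\<not> t * m > 2 * R"
    using Paley_Wiener_frequency_shift[OF G(1) Heq bound R] G(2) by blast
  moreover have "\<not> - (t * m) > 2 * R"
    using Paley_Wiener_frequency_shift[OF H Geq bound(2,1) R] Hb by blast
  ultimately have "\<bar>t * m\<bar> \<le> 2 * R" by linarith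
  then show thesis using that fs by blast
qed

section \<open>Smooth functions and test functions\<close>

lemma has_partial_deriv:
  assumes "f differentiable_on UNIV"
  shows "((\<lambda>s. f (x + s *\<^sub>R axis i 1)) has_vector_derivative partial_deriv i f x) (at 0)"
proof -
  obtain f' where "(f has_derivative f') (at (x + 0 *\<^sub>R axis i 1))"
    using assms by (auto simp: differentiable_on_def differentiable_def)
  then have "((\<lambda>s. f (x + s *\<^sub>R axis i 1)) has_derivative (\<lambda>s. f' (s *\<^sub>R axis i 1))) (at 0)"
    by (rule has_derivative_compose[rotated]) (auto intro!: derivative_eq_intros)
  then have "(\<lambda>s. f (x + s *\<^sub>R axis i 1)) differentiable (at 0)"
    by (rule differentiableI)
  then show ?thesis
    unfolding partial_deriv_def by (simp add: vector_derivative_works)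
qed

lemma partial_derivI:
  "((\<lambda>s. f (x + s *\<^sub>R axis i 1)) has_vector_derivative D) (at 0) \<Longrightarrow> partial_deriv i f x = D"
  unfolding partial_deriv_def by (rule vector_derivative_at)

lemma has_partial_deriv_at:
  assumes "f differentiable_on UNIV"
  shows "((\<lambda>s. f (x + s *\<^sub>R axis i 1)) has_vector_derivative partial_deriv i f (x + s *\<^sub>R axis i 1)) (at s)"
proof -
  have "((\<lambda>u. f ((x + s *\<^sub>R axis i 1) + u *\<^sub>R axis i 1)) \<circ> (\<lambda>u. u - s) has_vector_derivative
      1 *\<^sub>R partial_deriv i f (x + s *\<^sub>R axis i 1)) (at s)"
    by (rule vector_diff_chain_at) (use has_partial_deriv[OF assms] in \<open>auto intro!: derivative_eq_intros\<close>)
  then show ?thesis by (simp add: o_def algebra_simps)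
qed

lemma partial_deriv_cong_open:
  assumes "open V" "x \<in> V" "\<And>y. y \<in> V \<Longrightarrow> f y = g y"
  shows "partial_deriv i f x = partial_deriv i g x"
proof -
  have "((\<lambda>s. x + s *\<^sub>R axis i 1) \<longlongrightarrow> x + 0 *\<^sub>R axis i 1) (nhds (0::real))"
    by (intro tendsto_intros filterlim_ident)
  then have "eventually (\<lambda>s. x + s *\<^sub>R axis i 1 \<in> V) (nhds (0::real))"
    using assms(1,2) by (auto simp: tendsto_def)
  then have "eventually (\<lambda>s. s \<in> UNIV \<longrightarrow> f (x + s *\<^sub>R axis i 1) = g (x + s *\<^sub>R axis i 1)) (nhds (0::real))"
    by eventually_elim (use assms(3) in auto)
  then show ?thesis unfolding partial_deriv_def
    by (rule vector_derivative_cong_eq) auto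
qed

lemma differentiable_on_affine_argument:
  fixes f :: "real ^ 'n \<Rightarrow> complex"
  shows "f differentiable_on UNIV \<Longrightarrow> (\<lambda>x. f (c *\<^sub>R x + b)) differentiable_on UNIV"
  unfolding differentiable_on_def
proof
  fix x assume "\<forall>x\<in>UNIV. f differentiable at x within UNIV"
  then obtain f' where "(f has_derivative f') (at (c *\<^sub>R x + b))" by (auto simp: differentiable_def)
  then have "((\<lambda>x. f (c *\<^sub>R x + b)) has_derivative (\<lambda>y. f' (c *\<^sub>R y))) (at x)"
    by (rule has_derivative_compose[rotated]) (auto intro!: derivative_eq_intros)
  then show "(\<lambda>x. f (c *\<^sub>R x + b)) differentiable at x within UNIV" by (auto intro: differentiableI)
qed

lemma differentiable_on_power_complex:
  fixes f :: "real ^ 'n \<Rightarrow> complex"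
  shows "f differentiable_on S \<Longrightarrow> (\<lambda>x. f x ^ k) differentiable_on S"
  by (simp add: differentiable_on_def)

lemma partial_deriv_const [simp]: "partial_deriv i (\<lambda>x. c) = (\<lambda>x. 0)"
  by (intro ext partial_derivI) (auto intro!: derivative_eq_intros)

lemma partial_deriv_add:
  assumes "f differentiable_on UNIV" "g differentiable_on UNIV"
  shows "partial_deriv i (\<lambda>x. f x + g x) = (\<lambda>x. partial_deriv i f x + partial_deriv i g x)"
  by (intro ext partial_derivI has_vector_derivative_add has_partial_deriv assms)

lemma partial_deriv_mult:
  assumes "f differentiable_on UNIV" "g differentiable_on UNIV"
  shows "partial_deriv i (\<lambda>x. f x * g x) = (\<lambda>x. partial_deriv i f x * g x + f x * partial_deriv i g x)"
proof (intro ext partial_derivI)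
  fix x
  show "((\<lambda>s. f (x + s *\<^sub>R axis i 1) * g (x + s *\<^sub>R axis i 1)) has_vector_derivative
     partial_deriv i f x * g x + f x * partial_deriv i g x) (at 0)"
    using has_vector_derivative_mult[OF has_partial_deriv[OF assms(1)] has_partial_deriv[OF assms(2)], of x i x i]
    by (simp add: add.commute)
qed

lemma partial_deriv_cmult:
  assumes "f differentiable_on UNIV"
  shows "partial_deriv i (\<lambda>x. c * f x) = (\<lambda>x. c * partial_deriv i f x)"
  using partial_deriv_mult[of "\<lambda>_. c" f] assms by simp

lemma partial_deriv_affine:
  assumes "f differentiable_on UNIV"
  shows "partial_deriv i (\<lambda>x. f (c *\<^sub>R x + b)) = (\<lambda>x. of_real c * partial_deriv i f (c *\<^sub>R x + b))"
proof (intro ext partial_derivI)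
  fix x
  have "((\<lambda>s. f ((c *\<^sub>R x + b) + s *\<^sub>R axis i 1)) \<circ> (\<lambda>s. c * s) has_vector_derivative c *\<^sub>R partial_deriv i f (c *\<^sub>R x + b)) (at 0)"
    by (rule vector_diff_chain_at) (auto intro!: derivative_eq_intros has_partial_deriv[OF assms])
  then show "((\<lambda>s. f (c *\<^sub>R (x + s *\<^sub>R axis i 1) + b)) has_vector_derivative of_real c * partial_deriv i f (c *\<^sub>R x + b)) (at 0)"
    by (simp add: o_def algebra_simps scaleR_conv_of_real)
qed

section \<open>Iterated partial derivatives and closure properties of smooth functions\<close>

lemma iter_partial_append: "iter_partial (is @ js) f = iter_partial is (iter_partial js f)"
  by (induction "is") auto

lemma smooth_differentiable: "smooth f \<Longrightarrow> f differentiable_on UNIV"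
  unfolding smooth_def by (metis iter_partial.simps(1))

lemma smooth_partial_deriv: "smooth f \<Longrightarrow> smooth (partial_deriv i f)"
  unfolding smooth_def
proof
  fix "is" assume "\<forall>is. iter_partial is f differentiable_on UNIV"
  then have "iter_partial (is @ [i]) f differentiable_on UNIV" by blast
  then show "iter_partial is (partial_deriv i f) differentiable_on UNIV" by (simp add: iter_partial_append)
qed

lemma smooth_iter_partial: "smooth f \<Longrightarrow> smooth (iter_partial is f)"
  by (induction "is") (auto intro: smooth_partial_deriv)

lemma smooth_continuous: "smooth f \<Longrightarrow> continuous_on A f"
  using smooth_differentiable differentiable_imp_continuous_on continuous_on_subset by blast

text \<open>Closure under differentiation replaces explicit formulas for the iterated derivatives;
  each kind of function needs only a class that its derivatives do not leave.\<close>

lemma smoothI_class: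
  assumes "f \<in> C" "\<And>g. g \<in> C \<Longrightarrow> g differentiable_on UNIV" "\<And>g i. g \<in> C \<Longrightarrow> partial_deriv i g \<in> C"
  shows "smooth f"
proof -
  have "iter_partial is f \<in> C" for "is" by (induction "is") (use assms in auto)
  then show ?thesis using assms(2) by (auto simp: smooth_def)
qed

lemma iter_partial_add:
  assumes "smooth f" "smooth g"
  shows "iter_partial is (\<lambda>x. f x + g x) = (\<lambda>x. iter_partial is f x + iter_partial is g x)"
  by (induction "is") (auto simp: partial_deriv_add smooth_differentiable[OF smooth_iter_partial] assms)

lemma iter_partial_cmult:
  assumes "smooth f"
  shows "iter_partial is (\<lambda>x. c * f x) = (\<lambda>x. c * iter_partial is f x)"
  by (induction "is") (auto simp: partial_deriv_cmult smooth_differentiable[OF smooth_iter_partial] assms)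

lemma iter_partial_affine:
  assumes "smooth f"
  shows "iter_partial is (\<lambda>x. f (c *\<^sub>R x + b)) = (\<lambda>x. of_real (c ^ length is) * iter_partial is f (c *\<^sub>R x + b))"
proof (induction "is")
  case (Cons i "is")
  have d: "iter_partial is f differentiable_on UNIV" by (rule smooth_differentiable[OF smooth_iter_partial[OF assms]])
  have "(\<lambda>x. iter_partial is f (c *\<^sub>R x + b)) differentiable_on UNIV"
    by (rule differentiable_on_affine_argument[OF d])
  then show ?case using Cons by (simp add: partial_deriv_cmult partial_deriv_affine[OF d] mult_ac)
qed auto

lemma smooth_const [intro]: "smooth (\<lambda>x. c)"
  by (rule smoothI_class[of _ "range (\<lambda>c x. c)"]) auto

lemma smooth_add [intro]:
  assumes "smooth f" "smooth g"
  shows "smooth (\<lambda>x. f x + g x)"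
  unfolding smooth_def iter_partial_add[OF assms]
  by (intro allI differentiable_on_add smooth_differentiable smooth_iter_partial assms)

lemma smooth_affine: "smooth f \<Longrightarrow> smooth (\<lambda>x. f (c *\<^sub>R x + b))"
  unfolding smooth_def[of "\<lambda>x. f (c *\<^sub>R x + b)"]
proof
  fix "is" assume f: "smooth f"
  have d: "iter_partial is f differentiable_on UNIV" by (rule smooth_differentiable[OF smooth_iter_partial[OF f]])
  have "(\<lambda>x. iter_partial is f (c *\<^sub>R x + b)) differentiable_on UNIV"
    by (rule differentiable_on_affine_argument[OF d])
  then show "iter_partial is (\<lambda>x. f (c *\<^sub>R x + b)) differentiable_on UNIV"
    by (simp add: iter_partial_affine[OF f] differentiable_on_mult)
qed

text \<open>The product rule leaves the class of products, but not that of their finite sums.\<close>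

inductive_set smooth_products :: "(real ^ 'n \<Rightarrow> complex) set" where
  prod: "smooth f \<Longrightarrow> smooth g \<Longrightarrow> (\<lambda>x. f x * g x) \<in> smooth_products"
| sum: "u \<in> smooth_products \<Longrightarrow> v \<in> smooth_products \<Longrightarrow> (\<lambda>x. u x + v x) \<in> smooth_products"

lemma smooth_products_closed:
  "u \<in> smooth_products \<Longrightarrow> u differentiable_on UNIV \<and> (\<forall>i. partial_deriv i u \<in> smooth_products)"
proof (induction rule: smooth_products.induct)
  case (prod f g)
  note d = smooth_differentiable[OF prod(1)] smooth_differentiable[OF prod(2)]
  show ?case
    unfolding partial_deriv_mult[OF d]
    by (intro conjI allI smooth_products.intros smooth_partial_deriv prod differentiable_on_mult d)
next
  case (sum u v)
  then show ?case by (auto simp: partial_deriv_add intro: smooth_products.intros differentiable_on_add)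
qed

lemma smooth_mult [intro]: "smooth f \<Longrightarrow> smooth g \<Longrightarrow> smooth (\<lambda>x. f x * g x)"
  by (rule smoothI_class[of _ smooth_products]) (auto simp: smooth_products_closed intro: smooth_products.prod)

lemma smooth_diff [intro]:
  assumes "smooth f" "smooth g"
  shows "smooth (\<lambda>x. f x - g x)"
  using smooth_add[OF assms(1) smooth_mult[OF smooth_const assms(2)], of "-1"] by simp

text \<open>The quotient rule leads from \<open>a / d ^ k\<close> to a numerator over
  \<open>d ^ Suc k\<close>, so the class of all such quotients is closed under
  differentiation.\<close>

lemma smooth_divide:
  assumes "smooth a" "smooth d" "\<And>x. d x \<noteq> 0"
  shows "smooth (\<lambda>x. a x / d x)"
proof (rule smoothI_class[of _ "{u. \<exists>a k. smooth a \<and> u = (\<lambda>x. a x / d x ^ k)}"])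
  show "(\<lambda>x. a x / d x) \<in> {u. \<exists>a k. smooth a \<and> u = (\<lambda>x. a x / d x ^ k)}"
    using assms(1) by (auto intro!: exI[of _ a] exI[of _ 1])
next
  have key: "g differentiable_on UNIV \<and> partial_deriv i g \<in> {u. \<exists>a k. smooth a \<and> u = (\<lambda>x. a x / d x ^ k)}"
    if g: "g \<in> {u. \<exists>a k. smooth a \<and> u = (\<lambda>x. a x / d x ^ k)}" for g i
  proof -
    obtain a k where a: "smooth a" "g = (\<lambda>x. a x / d x ^ k)" using g by auto
    note da = smooth_differentiable[OF a(1)] and dd = smooth_differentiable[OF assms(2)]
    have dg: "g differentiable_on UNIV"
      unfolding a(2) using da dd assms(3) by (simp add: differentiable_on_def)
    have ddk: "(\<lambda>x. d x ^ k) differentiable_on UNIV" by (rule differentiable_on_power_complex[OF dd])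
    \<comment> \<open>For \<open>k = 0\<close> the truncated exponent \<open>k - 1\<close> is
      harmless, since the factor \<open>of_nat k\<close> vanishes.\<close>
    have pw: "partial_deriv i (\<lambda>x. d x ^ k) = (\<lambda>x. of_nat k * d x ^ (k - 1) * partial_deriv i d x)"
    proof (induction k)
      case (Suc k)
      have ddk: "(\<lambda>x. d x ^ k) differentiable_on UNIV" by (rule differentiable_on_power_complex[OF dd])
      show ?case using partial_deriv_mult[OF dd ddk, of i] Suc
        by (cases k) (auto simp: fun_eq_iff algebra_simps)
    qed simp
    \<comment> \<open>The derivative of \<open>g\<close> is found by differentiating the product
      \<open>g * d ^ k = a\<close> and solving for it.\<close>
    have "partial_deriv i a = (\<lambda>x. partial_deriv i (\<lambda>x. g x * d x ^ k) x)"
      using assms(3) by (simp add: a(2))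
    then have "partial_deriv i a x = partial_deriv i g x * d x ^ k + g x * (of_nat k * d x ^ (k - 1) * partial_deriv i d x)" for x
      unfolding partial_deriv_mult[OF dg ddk] pw by (simp add: fun_eq_iff)
    then have "partial_deriv i g x = (partial_deriv i a x - g x * (of_nat k * d x ^ (k - 1) * partial_deriv i d x)) / d x ^ k" for x
      using assms(3)[of x] by (simp add: field_simps)
    then have "partial_deriv i g x = (partial_deriv i a x * d x - of_nat k * a x * partial_deriv i d x) / d x ^ Suc k" for x
      using assms(3)[of x] by (cases k) (simp_all add: a(2) field_simps)
    then have "partial_deriv i g = (\<lambda>x. (partial_deriv i a x * d x - of_nat k * a x * partial_deriv i d x) / d x ^ Suc k)"
      by (rule ext)
    moreover have "smooth (\<lambda>x. partial_deriv i a x * d x - of_nat k * a x * partial_deriv i d x)"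
      by (intro smooth_diff smooth_mult smooth_partial_deriv a(1) assms(2) smooth_const)
    ultimately show ?thesis using dg by blast
  qed
  show "g differentiable_on UNIV" if "g \<in> {u. \<exists>a k. smooth a \<and> u = (\<lambda>x. a x / d x ^ k)}" for g
    using key[OF that] by blast
  show "partial_deriv i g \<in> {u. \<exists>a k. smooth a \<and> u = (\<lambda>x. a x / d x ^ k)}" if "g \<in> {u. \<exists>a k. smooth a \<and> u = (\<lambda>x. a x / d x ^ k)}" for g i
    using key[OF that] by blast
qed

text \<open>Every derivative doubles the number of terms, whence the power of 2. The induction
  removes the last entry of the list, the derivative taken first, because the product rule applies
  to \<open>a * f\<close> itself and not to its higher derivatives.\<close>

lemma iter_partial_mult_bound:
  assumes "smooth a" "smooth f"
    and "\<And>js. length js \<le> length is \<Longrightarrow> norm (iter_partial js a x) \<le> D"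
    and "\<And>js. length js \<le> length is \<Longrightarrow> norm (iter_partial js f x) \<le> M"
  shows "norm (iter_partial is (\<lambda>x. a x * f x) x) \<le> 2 ^ length is * (D * M)"
  using assms
proof (induction "is" arbitrary: a f rule: rev_induct)
  case Nil
  have "D \<ge> 0" using order_trans[OF norm_ge_zero Nil(3)[of "[]"]] by simp
  then show ?case using Nil(3)[of "[]"] Nil(4)[of "[]"] by (auto simp: norm_mult intro!: mult_mono)
next
  case (snoc i "is")
  note d = smooth_differentiable[OF snoc(2)] smooth_differentiable[OF snoc(3)]
  have 1: "norm (iter_partial is (\<lambda>x. partial_deriv i a x * f x) x) \<le> 2 ^ length is * (D * M)"
  proof (rule snoc.IH)
    show "norm (iter_partial js (partial_deriv i a) x) \<le> D" if "length js \<le> length is" for js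
      using snoc(4)[of "js @ [i]"] that by (simp add: iter_partial_append)
  qed (use snoc smooth_partial_deriv in auto)
  have 2: "norm (iter_partial is (\<lambda>x. a x * partial_deriv i f x) x) \<le> 2 ^ length is * (D * M)"
  proof (rule snoc.IH)
    show "norm (iter_partial js (partial_deriv i f) x) \<le> M" if "length js \<le> length is" for js
      using snoc(5)[of "js @ [i]"] that by (simp add: iter_partial_append)
  qed (use snoc smooth_partial_deriv in auto)
  have "iter_partial (is @ [i]) (\<lambda>x. a x * f x) x
      = iter_partial is (\<lambda>x. partial_deriv i a x * f x) x + iter_partial is (\<lambda>x. a x * partial_deriv i f x) x"
    by (simp add: iter_partial_append partial_deriv_mult[OF d] iter_partial_add smooth_mult smooth_partial_deriv snoc(2,3))
  then have "norm (iter_partial (is @ [i]) (\<lambda>x. a x * f x) x) \<le> 2 ^ length is * (D * M) + 2 ^ length is * (D * M)"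
    using norm_triangle_mono[OF 1 2] by simp
  then show ?case by (simp add: mult_ac)
qed

lemma iter_partial_zero_on_open:
  assumes "open V" "\<And>y. y \<in> V \<Longrightarrow> f y = 0" "x \<in> V"
  shows "iter_partial is f x = 0"
  using assms(3)
proof (induction "is" arbitrary: x)
  case (Cons i "is")
  have "partial_deriv i (iter_partial is f) x = partial_deriv i (\<lambda>_. 0) x"
    by (rule partial_deriv_cong_open[OF assms(1) Cons(2)]) (use Cons(1) in auto)
  then show ?case by simp
qed (use assms in auto)

section \<open>Supports and test functions\<close>

lemma fun_support_subset: "closed K \<Longrightarrow> (\<And>x. x \<notin> K \<Longrightarrow> f x = 0) \<Longrightarrow> fun_support f \<subseteq> K"
  by (rule closure_minimal) auto

lemma notin_fun_support: "x \<notin> fun_support f \<Longrightarrow> f x = 0"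
  using closure_subset[of "{x. f x \<noteq> 0}"] by blast

lemma iter_partial_outside_support: "x \<notin> fun_support f \<Longrightarrow> iter_partial is f x = 0"
  by (rule iter_partial_zero_on_open[of "- fun_support f"]) (blast intro: notin_fun_support)+

lemma test_functionI:
  assumes "smooth f" "compact K" "\<And>x. x \<notin> K \<Longrightarrow> f x = 0"
  shows "f \<in> test_functions"
proof -
  have "fun_support f \<subseteq> K" using fun_support_subset[OF compact_imp_closed[OF assms(2)] assms(3)] .
  then have "fun_support f = K \<inter> fun_support f" by blast
  moreover have "compact (K \<inter> fun_support f)" by (rule compact_Int_closed[OF assms(2) closed_closure])
  ultimately show ?thesis using assms(1) by (simp add: test_functions_def)
qed

lemma test_smooth: "f \<in> test_functions \<Longrightarrow> smooth f"
  by (simp add: test_functions_def)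

lemma test_compact: "f \<in> test_functions \<Longrightarrow> compact (fun_support f)"
  by (simp add: test_functions_def)

lemma test_mult:
  assumes "f \<in> test_functions" "smooth a"
  shows "(\<lambda>x. a x * f x) \<in> test_functions"
proof (rule test_functionI[OF smooth_mult[OF assms(2) test_smooth[OF assms(1)]] test_compact[OF assms(1)]])
  fix x assume "x \<notin> fun_support f"
  then show "a x * f x = 0" using notin_fun_support[of x f] by simp
qed

lemma test_subset_schwartz: "f \<in> test_functions \<Longrightarrow> f \<in> schwartz_functions"
  unfolding schwartz_functions_def
proof (intro CollectI conjI allI test_smooth)
  fix k "is" assume f: "f \<in> test_functions"
  have "compact ((\<lambda>x. (1 + norm x) ^ k * norm (iter_partial is f x)) ` fun_support f)"
    by (intro compact_continuous_image test_compact[OF f] continuous_intros smooth_continuous smooth_iter_partial test_smooth[OF f])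
  then have "bounded (insert 0 ((\<lambda>x. (1 + norm x) ^ k * norm (iter_partial is f x)) ` fun_support f))"
    by (simp add: compact_imp_bounded)
  moreover have "range (\<lambda>x. (1 + norm x) ^ k * norm (iter_partial is f x)) \<subseteq>
     insert 0 ((\<lambda>x. (1 + norm x) ^ k * norm (iter_partial is f x)) ` fun_support f)"
    using iter_partial_outside_support[of _ f] by force
  ultimately show "bounded (range (\<lambda>x. (1 + norm x) ^ k * norm (iter_partial is f x)))"
    by (rule bounded_subset)
qed

section \<open>Plane waves and cutoff functions\<close>

lemma partial_deriv_has_derivative:
  assumes "(f has_derivative f') (at x)"
  shows "partial_deriv i f x = f' (axis i 1)"
proof (rule partial_derivI)
  interpret f': bounded_linear f' using assms by (rule has_derivative_bounded_linear)
  have "(f has_derivative f') (at (x + 0 *\<^sub>R axis i 1))" using assms by simp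
  then have "((\<lambda>s. f (x + s *\<^sub>R axis i 1)) has_derivative (\<lambda>s. f' (s *\<^sub>R axis i 1))) (at 0)"
    by (rule has_derivative_compose[rotated]) (auto intro!: derivative_eq_intros)
  then show "((\<lambda>s. f (x + s *\<^sub>R axis i 1)) has_vector_derivative f' (axis i 1)) (at 0)"
    by (simp add: has_vector_derivative_def f'.scaleR)
qed

lemma smooth_coord: "smooth (\<lambda>x::real^'n. of_real (x $ j))"
proof (rule smoothI_class[of _ "{\<lambda>x. of_real (a * x $ j + b) | a b. True}"])
  show "(\<lambda>x::real^'n. of_real (x $ j)) \<in> {\<lambda>x. of_real (a * x $ j + b) | a b. True}"
    by (intro CollectI exI[of _ 1] exI[of _ 0]) auto
next
  have d: "((\<lambda>x. of_real (a * x $ j + b)) has_derivative (\<lambda>y. complex_of_real (a * y $ j))) (at x)" for a b and x :: "real^'n"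
  proof -
    have "bounded_linear (\<lambda>x::real^'n. x $ j)" by (rule bounded_linear_vec_nth)
    then have "((\<lambda>x. x $ j) has_derivative (\<lambda>y. y $ j)) (at x)" by (rule bounded_linear_imp_has_derivative)
    then show ?thesis by (intro has_derivative_of_real) (auto intro!: derivative_eq_intros)
  qed
  fix g :: "real^'n \<Rightarrow> complex" assume "g \<in> {\<lambda>x. of_real (a * x $ j + b) | a b. True}"
  then obtain a b where g: "g = (\<lambda>x. of_real (a * x $ j + b))" by blast
  show "g differentiable_on UNIV" unfolding g differentiable_on_def
    using d differentiableI by blast
  show "partial_deriv i g \<in> {\<lambda>x. of_real (a * x $ j + b) | a b. True}" for i
  proof -
    have "partial_deriv i g = (\<lambda>x. of_real (0 * x $ j + a * axis i 1 $ j))"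
      unfolding g partial_deriv_has_derivative[OF d] by simp
    then show ?thesis by blast
  qed
qed

text \<open>In these terms the kernel of \<open>fourier\<close> at frequency \<open>\<xi>\<close> is
  \<open>wave (- \<xi>)\<close>.\<close>

definition wave :: "real ^ 'n \<Rightarrow> real ^ 'n \<Rightarrow> complex" where
  "wave \<xi> x = exp (\<i> * of_real (x \<bullet> \<xi>))"

lemma has_derivative_wave: "(wave \<xi> has_derivative (\<lambda>y. \<i> * of_real (y \<bullet> \<xi>) * wave \<xi> x)) (at x)"
proof -
  have 1: "((\<lambda>x. \<i> * of_real (x \<bullet> \<xi>)) has_derivative (\<lambda>y. \<i> * of_real (y \<bullet> \<xi>))) (at x)"
    by (auto intro!: derivative_eq_intros)
  have 2: "(exp has_derivative (\<lambda>y. y * exp (\<i> * of_real (x \<bullet> \<xi>)))) (at (\<i> * complex_of_real (x \<bullet> \<xi>)))"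
    by (simp add: has_field_derivative_imp_has_derivative mult.commute[of _ "exp _"] DERIV_exp)
  show ?thesis unfolding wave_def using has_derivative_compose[OF 1 2] by simp
qed

lemma wave_differentiable: "wave \<xi> differentiable_on UNIV"
  unfolding differentiable_on_def using has_derivative_wave differentiableI by blast

lemma iter_partial_wave:
  "iter_partial is (wave \<xi>) = (\<lambda>x. prod_list (map (\<lambda>j. \<i> * of_real (\<xi> $ j)) is) * wave \<xi> x)"
proof (induction "is")
  case (Cons i "is")
  have "partial_deriv i (wave \<xi>) = (\<lambda>x. \<i> * of_real (\<xi> $ i) * wave \<xi> x)"
    unfolding partial_deriv_has_derivative[OF has_derivative_wave] by (simp add: inner_axis inner_commute)
  then show ?case by (simp only: iter_partial.simps Cons partial_deriv_cmult[OF wave_differentiable]) (simp add: mult_ac)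
qed simp

lemma smooth_wave: "smooth (wave \<xi>)"
  unfolding smooth_def iter_partial_wave
  by (intro allI differentiable_on_mult differentiable_on_const wave_differentiable)

lemma norm_wave [simp]: "norm (wave \<xi> x) = 1"
  by (simp add: wave_def)

text \<open>The derivatives of \<open>flat 1\<close>, that is of \<open>exp (- 1 / s)\<close>, are again of the form \<open>flat p\<close>.\<close>

definition flat :: "real poly \<Rightarrow> real \<Rightarrow> real" where
  "flat p s = (if s > 0 then poly p (1 / s) * exp (- (1 / s)) else 0)"

lemma poly_times_exp_tendsto_0: "((\<lambda>y. poly p y * exp (- y)) \<longlongrightarrow> 0) (at_top :: real filter)"
proof -
  have "((\<lambda>y. \<Sum>i\<le>degree p. coeff p i * (y ^ i / exp y)) \<longlongrightarrow> (\<Sum>i\<le>degree p. coeff p i * 0)) (at_top :: real filter)"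
    by (intro tendsto_intros tendsto_power_div_exp_0)
  then show ?thesis by (simp add: poly_altdef exp_minus sum_distrib_right divide_inverse mult.assoc)
qed

lemma flat_tendsto_0: "(flat p \<longlongrightarrow> 0) (at 0)"
proof -
  have "((\<lambda>s. poly p (inverse s) * exp (- inverse s)) \<longlongrightarrow> 0) (at_right 0)"
    by (rule filterlim_compose[OF poly_times_exp_tendsto_0 filterlim_inverse_at_top_right])
  moreover have "eventually (\<lambda>s. poly p (inverse s) * exp (- inverse s) = flat p s) (at_right 0)"
    by (auto simp: eventually_at_filter flat_def inverse_eq_divide)
  ultimately have r: "(flat p \<longlongrightarrow> 0) (at_right 0)" by (rule Lim_transform_eventually)
  have "eventually (\<lambda>s. 0 = flat p s) (at_left 0)"
    by (auto simp: eventually_at_filter flat_def)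
  then have l: "(flat p \<longlongrightarrow> 0) (at_left 0)" by (rule Lim_transform_eventually[rotated]) simp
  show ?thesis using l r by (simp add: filterlim_split_at)
qed

text \<open>In the variable \<open>y = 1 / s\<close> the derivative of
  \<open>p(y) * exp (- y)\<close> is \<open>y^2 * (p(y) - p'(y)) * exp (- y)\<close>, which explains
  the new polynomial.\<close>

lemma flat_has_derivative:
  "(flat p has_real_derivative flat (monom 1 2 * (p - pderiv p)) s) (at s)"
proof -
  consider "s > 0" | "s < 0" | "s = 0" by linarith
  then show ?thesis
  proof cases
    case 1
    have "((\<lambda>s. poly p (1 / s) * exp (- (1 / s))) has_real_derivative flat (monom 1 2 * (p - pderiv p)) s) (at s)"
      using 1 by (auto intro!: derivative_eq_intros poly_DERIV[THEN DERIV_chain2] simp: flat_def poly_monom power2_eq_square field_simps)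
    then show ?thesis
      by (rule has_field_derivative_transform_within_open[of _ _ _ "{0<..}"]) (use 1 in \<open>auto simp: flat_def\<close>)
  next
    case 2
    have "((\<lambda>s. 0) has_real_derivative flat (monom 1 2 * (p - pderiv p)) s) (at s)"
      using 2 by (auto simp: flat_def)
    then show ?thesis
      by (rule has_field_derivative_transform_within_open[of _ _ _ "{..<0}"]) (use 2 in \<open>auto simp: flat_def\<close>)
  next
    case 3
    \<comment> \<open>The difference quotient at 0 is \<open>flat\<close> of the polynomial
      multiplied by its variable, since division by \<open>h\<close> is multiplication by
      \<open>1 / h\<close>.\<close>
    have "(flat (pCons 0 p) \<longlongrightarrow> 0) (at 0)" by (rule flat_tendsto_0)
    moreover have "eventually (\<lambda>h. flat (pCons 0 p) h = (flat p (0 + h) - flat p 0) / h) (at 0)"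
      by (auto simp: eventually_at_filter flat_def)
    ultimately have "((\<lambda>h. (flat p (0 + h) - flat p 0) / h) \<longlongrightarrow> 0) (at 0)"
      by (rule Lim_transform_eventually)
    then show ?thesis using 3 by (simp add: DERIV_def flat_def)
  qed
qed

inductive_set flat_combinations :: "real \<Rightarrow> real \<Rightarrow> (real ^ 'n \<Rightarrow> complex) set" for \<sigma> c where
  prod: "smooth a \<Longrightarrow> (\<lambda>x. a x * of_real (flat p (\<sigma> * (x \<bullet> x) + c))) \<in> flat_combinations \<sigma> c"
| sum: "u \<in> flat_combinations \<sigma> c \<Longrightarrow> v \<in> flat_combinations \<sigma> c \<Longrightarrow> (\<lambda>x. u x + v x) \<in> flat_combinations \<sigma> c"

lemma has_derivative_flat_radial:
  "((\<lambda>x::real^'n. complex_of_real (flat p (\<sigma> * (x \<bullet> x) + c))) has_derivative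
     (\<lambda>y. of_real (flat (monom 1 2 * (p - pderiv p)) (\<sigma> * (x \<bullet> x) + c) * (2 * \<sigma> * (x \<bullet> y))))) (at x)"
proof (rule has_derivative_of_real)
  have 1: "((\<lambda>x. \<sigma> * (x \<bullet> x) + c) has_derivative (\<lambda>y. 2 * \<sigma> * (x \<bullet> y))) (at x)"
    by (auto intro!: derivative_eq_intros simp: inner_commute algebra_simps)
  have 2: "(flat p has_derivative (*) (flat (monom 1 2 * (p - pderiv p)) (\<sigma> * (x \<bullet> x) + c))) (at (\<sigma> * (x \<bullet> x) + c))"
    using flat_has_derivative by (rule has_field_derivative_imp_has_derivative)
  show "((\<lambda>x. flat p (\<sigma> * (x \<bullet> x) + c)) has_derivative
     (\<lambda>y. flat (monom 1 2 * (p - pderiv p)) (\<sigma> * (x \<bullet> x) + c) * (2 * \<sigma> * (x \<bullet> y)))) (at x)"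
    using has_derivative_compose[OF 1 2] by simp
qed

lemma flat_combinations_closed:
  "u \<in> flat_combinations \<sigma> c \<Longrightarrow> u differentiable_on UNIV \<and> (\<forall>i. partial_deriv i u \<in> flat_combinations \<sigma> c)"
proof (induction rule: flat_combinations.induct)
  case (prod a p)
  let ?fl = "\<lambda>p x::real^'n. complex_of_real (flat p (\<sigma> * (x \<bullet> x) + c))"
  have d: "a differentiable_on UNIV" "?fl p differentiable_on UNIV"
    using smooth_differentiable[OF prod] has_derivative_flat_radial[of p \<sigma> c] differentiableI
    unfolding differentiable_on_def by blast+
  have "partial_deriv i (\<lambda>x. a x * ?fl p x) \<in> flat_combinations \<sigma> c" for i
  proof -
    have "partial_deriv i (\<lambda>x. a x * ?fl p x) =
       (\<lambda>x. partial_deriv i a x * ?fl p x + (a x * (of_real (2 * \<sigma>) * of_real (x $ i))) * ?fl (monom 1 2 * (p - pderiv p)) x)"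
      unfolding partial_deriv_mult[OF d] partial_deriv_has_derivative[OF has_derivative_flat_radial]
      by (simp add: inner_axis mult_ac)
    also have "\<dots> \<in> flat_combinations \<sigma> c"
      by (intro flat_combinations.intros smooth_partial_deriv prod smooth_mult smooth_const smooth_coord)
    finally show ?thesis .
  qed
  then show ?case using d differentiable_on_mult by blast
next
  case (sum u v)
  then show ?case by (auto simp: partial_deriv_add intro: flat_combinations.intros differentiable_on_add)
qed

lemma smooth_flat_radial: "smooth (\<lambda>x::real^'n. of_real (flat p (\<sigma> * (x \<bullet> x) + c)))"
proof (rule smoothI_class[of _ "flat_combinations \<sigma> c"])
  show "(\<lambda>x::real^'n. of_real (flat p (\<sigma> * (x \<bullet> x) + c))) \<in> flat_combinations \<sigma> c"
    using flat_combinations.prod[OF smooth_const[of 1]] by simp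
qed (use flat_combinations_closed in blast)+

text \<open>The numerator is positive exactly where \<open>norm x < 2\<close>, the second summand of
  the denominator exactly where \<open>norm x > 1\<close>. So the denominator never vanishes, and
  the quotient is 1 on the closed unit ball and 0 outside the open ball of radius 2.\<close>

definition cutoff :: "real ^ 'n \<Rightarrow> complex" where
  "cutoff x = of_real (flat 1 (- 1 * (x \<bullet> x) + 4)) /
     (of_real (flat 1 (- 1 * (x \<bullet> x) + 4)) + of_real (flat 1 (1 * (x \<bullet> x) + - 1)))"

lemma smooth_cutoff: "smooth cutoff"
proof -
  have "complex_of_real (flat 1 (- 1 * (x \<bullet> x) + 4)) + of_real (flat 1 (1 * (x \<bullet> x) + - 1)) \<noteq> 0" for x :: "real^'n"
  proof -
    have "flat 1 s \<ge> 0" "s > 0 \<Longrightarrow> flat 1 s > 0" for s by (auto simp: flat_def)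
    then have "flat 1 (- 1 * (x \<bullet> x) + 4) + flat 1 (1 * (x \<bullet> x) + - 1) > 0"
      by (smt (verit))
    then show ?thesis by (metis of_real_add of_real_eq_0_iff less_irrefl)
  qed
  then show ?thesis
    unfolding cutoff_def[abs_def] by (intro smooth_divide smooth_add smooth_flat_radial)
qed

lemma cutoff_eq_1: "norm x \<le> 1 \<Longrightarrow> cutoff x = 1"
proof -
  assume "norm x \<le> 1"
  then have "x \<bullet> x \<le> 1" by (simp add: dot_square_norm power_le_one)
  then have "flat 1 (1 * (x \<bullet> x) + - 1) = 0" "flat 1 (- 1 * (x \<bullet> x) + 4) \<noteq> 0" by (auto simp: flat_def)
  then show ?thesis by (simp add: cutoff_def)
qed

lemma cutoff_eq_0: "norm x \<ge> 2 \<Longrightarrow> cutoff x = 0"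
proof -
  assume "norm x \<ge> 2"
  then have "x \<bullet> x \<ge> 2\<^sup>2" unfolding dot_square_norm by (intro power_mono) auto
  then have "flat 1 (- 1 * (x \<bullet> x) + 4) = 0" by (auto simp: flat_def)
  then show ?thesis by (simp add: cutoff_def)
qed

definition ball_cutoff :: "real ^ 'n \<Rightarrow> real \<Rightarrow> real ^ 'n \<Rightarrow> complex" where
  "ball_cutoff p r x = cutoff ((1 / r) *\<^sub>R x + - ((1 / r) *\<^sub>R p))"

lemma smooth_ball_cutoff: "smooth (ball_cutoff p r)"
  unfolding ball_cutoff_def[abs_def] by (rule smooth_affine[OF smooth_cutoff])

lemma ball_cutoff_eq:
  assumes "r > 0"
  shows "dist p x \<le> r \<Longrightarrow> ball_cutoff p r x = 1" and "dist p x \<ge> 2 * r \<Longrightarrow> ball_cutoff p r x = 0"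
proof -
  have n: "norm ((1 / r) *\<^sub>R x + - ((1 / r) *\<^sub>R p)) = dist p x / r"
  proof -
    have "(1 / r) *\<^sub>R x + - ((1 / r) *\<^sub>R p) = (1 / r) *\<^sub>R (x - p)" by (simp add: algebra_simps)
    then show ?thesis using assms by (simp add: dist_norm norm_minus_commute)
  qed
  show "dist p x \<le> r \<Longrightarrow> ball_cutoff p r x = 1"
    unfolding ball_cutoff_def by (rule cutoff_eq_1) (use n assms in \<open>simp add: divide_le_eq\<close>)
  show "dist p x \<ge> 2 * r \<Longrightarrow> ball_cutoff p r x = 0"
    unfolding ball_cutoff_def by (rule cutoff_eq_0) (use n assms in \<open>simp add: le_divide_eq\<close>)
qed

lemma test_ball_cutoff: "r > 0 \<Longrightarrow> ball_cutoff p r \<in> test_functions"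
  by (rule test_functionI[OF smooth_ball_cutoff compact_cball[of p "2 * r"]])
     (simp add: ball_cutoff_eq)

section \<open>Locality of distributions\<close>

lemma linear_functional_zero:
  assumes "linear_functional_on S u" "f \<in> S"
  shows "u (\<lambda>x. 0) = 0"
proof -
  have "u (\<lambda>x. 0 * f x + 0 * f x) = 0 * u f + 0 * u f"
    using assms unfolding linear_functional_on_def by blast
  then show ?thesis by simp
qed

lemma linear_functional_add:
  assumes "linear_functional_on S u" "f \<in> S" "g \<in> S"
  shows "u (\<lambda>x. f x + g x) = u f + u g"
proof -
  have "u (\<lambda>x. 1 * f x + 1 * g x) = 1 * u f + 1 * u g"
    using assms unfolding linear_functional_on_def by blast
  then show ?thesis by simp
qed

lemma linear_functional_diff:
  assumes "linear_functional_on S u" "f \<in> S" "g \<in> S"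
  shows "u (\<lambda>x. f x - g x) = u f - u g"
proof -
  have "u (\<lambda>x. 1 * f x + (-1) * g x) = 1 * u f + (-1) * u g"
    using assms unfolding linear_functional_on_def by blast
  then show ?thesis by simp
qed

text \<open>A partition of unity unrolled over the cover. The part \<open>c * f\<close> lives in a
  ball of radius \<open>2 * r\<close>, hence inside the null ball of radius \<open>3 * r\<close>;
  the part \<open>(1 - c) * f\<close> vanishes on \<open>ball p r\<close>, so the remaining balls
  cover it.\<close>

lemma vanishes_on_finite_cover:
  assumes u: "linear_functional_on test_functions u"
    and fin: "finite B" and B: "\<And>p r. (p, r) \<in> B \<Longrightarrow> r > 0 \<and>
      (\<forall>h\<in>test_functions. fun_support h \<subseteq> ball p (3 * r) \<longrightarrow> u h = 0)"
    and f: "f \<in> test_functions" "\<And>x. f x \<noteq> 0 \<Longrightarrow> \<exists>(p, r)\<in>B. x \<in> ball p r"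
  shows "u f = 0"
  using fin B f
proof (induction B arbitrary: f rule: finite_induct)
  case empty
  then have "f = (\<lambda>x. 0)" by auto
  then show ?case using linear_functional_zero[OF u empty(2)] by simp
next
  case (insert b B)
  obtain p r where b: "b = (p, r)" by force
  have r: "r > 0" and v: "\<And>h. h \<in> test_functions \<Longrightarrow> fun_support h \<subseteq> ball p (3 * r) \<Longrightarrow> u h = 0"
    using insert.prems(1)[of p r] b by auto
  define c where "c = ball_cutoff p r"
  have f1: "(\<lambda>x. c x * f x) \<in> test_functions" and f2: "(\<lambda>x. (1 - c x) * f x) \<in> test_functions"
    unfolding c_def by (intro test_mult insert.prems(2) smooth_diff smooth_const smooth_ball_cutoff)+
  have "fun_support (\<lambda>x. c x * f x) \<subseteq> cball p (2 * r)"
    by (rule fun_support_subset) (auto simp: c_def ball_cutoff_eq[OF r])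
  also have "\<dots> \<subseteq> ball p (3 * r)" using r by auto
  finally have "u (\<lambda>x. c x * f x) = 0" using v[OF f1] by simp
  moreover have "u (\<lambda>x. (1 - c x) * f x) = 0"
  proof (rule insert.IH[OF _ f2])
    show "r > 0 \<and> (\<forall>h\<in>test_functions. fun_support h \<subseteq> ball p (3 * r) \<longrightarrow> u h = 0)" if "(p, r) \<in> B" for p r
      using insert.prems(1)[of p r] that by blast
    fix x assume x: "(1 - c x) * f x \<noteq> 0"
    then have "c x \<noteq> 1" "f x \<noteq> 0" by auto
    then have "\<not> dist p x \<le> r" using ball_cutoff_eq(1)[OF r, of p x] by (auto simp: c_def)
    then show "\<exists>(p, r)\<in>B. x \<in> ball p r" using insert.prems(3)[OF \<open>f x \<noteq> 0\<close>] b by auto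
  qed
  moreover have "u f = u (\<lambda>x. c x * f x) + u (\<lambda>x. (1 - c x) * f x)"
    unfolding linear_functional_add[OF u f1 f2, symmetric] by (simp add: algebra_simps)
  ultimately show ?case by simp
qed

text \<open>The support is the complement of a union of null open sets. That the union is itself
  null is not part of the definition: compactness of the support of \<open>f\<close> reduces it to
  finitely many small balls.\<close>

lemma vanishes_off_support:
  assumes u: "linear_functional_on test_functions u"
    and f: "f \<in> test_functions" "fun_support f \<inter> distr_support u = {}"
  shows "u f = 0"
proof -
  have "\<exists>r>0. \<forall>h\<in>test_functions. fun_support h \<subseteq> ball p (3 * r) \<longrightarrow> u h = 0" if "p \<in> fun_support f" for p
  proof -
    have "p \<notin> distr_support u" using that f(2) by blast
    then obtain V where V: "open V" "p \<in> V" "\<forall>h\<in>test_functions. fun_support h \<subseteq> V \<longrightarrow> u h = 0"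
      unfolding distr_support_def by blast
    then obtain e where e: "e > 0" "ball p e \<subseteq> V" using open_contains_ball by blast
    \<comment> \<open>A third, because the ball of radius \<open>3 * r\<close> has to stay inside
      \<open>V\<close>.\<close>
    then show ?thesis using V by (intro exI[of _ "e / 3"]) auto
  qed
  then obtain r where r: "\<And>p. p \<in> fun_support f \<Longrightarrow> r p > 0"
    "\<And>p h. p \<in> fun_support f \<Longrightarrow> h \<in> test_functions \<Longrightarrow> fun_support h \<subseteq> ball p (3 * r p) \<Longrightarrow> u h = 0"
    by metis
  obtain D where D: "D \<subseteq> fun_support f" "finite D" "fun_support f \<subseteq> (\<Union>p\<in>D. ball p (r p))"
    by (rule compactE_image[OF test_compact[OF f(1)], of "fun_support f" "\<lambda>p. ball p (r p)"]) (use r(1) in auto)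
  show ?thesis
  proof (rule vanishes_on_finite_cover[OF u _ _ f(1), of "(\<lambda>p. (p, r p)) ` D"])
    fix x assume "f x \<noteq> 0"
    then have "x \<in> fun_support f" using notin_fun_support by blast
    then show "\<exists>(p, r)\<in>(\<lambda>p. (p, r p)) ` D. x \<in> ball p r" using D(3) by blast
  qed (use D r in auto)
qed

section \<open>Schwartz functions\<close>

lemma schwartz_smooth: "f \<in> schwartz_functions \<Longrightarrow> smooth f"
  by (simp add: schwartz_functions_def)

lemma finite_lists_le: "finite {is::'n::finite list. length is \<le> N}"
  using finite_lists_length_le[of "UNIV :: 'n set" N] by simp

text \<open>Each list of indices has its own bound, and their sum over the finitely many lists is a
  common one. This gives the supremum in \<open>schwartz_seminorm\<close> its meaning.\<close>

lemma schwartz_seminorm_bdd: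
  fixes f :: "real ^ 'n \<Rightarrow> complex"
  assumes "f \<in> schwartz_functions"
  shows "bdd_above ((\<lambda>(is, x). (1 + norm x) ^ k * norm (iter_partial is f x)) ` ({is. length is \<le> N} \<times> UNIV))"
proof -
  have "\<forall>is. \<exists>B. \<forall>x. (1 + norm x) ^ k * norm (iter_partial is f x) \<le> B"
  proof
    fix "is"
    have "bounded (range (\<lambda>x. (1 + norm x) ^ k * norm (iter_partial is f x)))"
      using assms unfolding schwartz_functions_def by blast
    then obtain B where "\<And>x. norm ((1 + norm x) ^ k * norm (iter_partial is f x)) \<le> B"
      unfolding bounded_iff by blast
    then show "\<exists>B. \<forall>x. (1 + norm x) ^ k * norm (iter_partial is f x) \<le> B"
      by (intro exI[of _ B]) (metis abs_le_D1 real_norm_def)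
  qed
  then obtain B where B: "\<And>is x. (1 + norm x) ^ k * norm (iter_partial is f x) \<le> B is" by metis
  show ?thesis
  proof (rule bdd_aboveI2)
    fix p assume "p \<in> {is::'n list. length is \<le> N} \<times> (UNIV :: (real^'n) set)"
    then obtain "is" x where p: "p = (is, x)" "length is \<le> N" by auto
    have "(1 + norm x) ^ k * norm (iter_partial is f x) \<le> \<bar>B is\<bar>" using B[of x "is"] by linarith
    also have "\<dots> \<le> (\<Sum>is\<in>{is. length is \<le> N}. \<bar>B is\<bar>)"
      using p(2) by (intro member_le_sum finite_lists_le) auto
    finally show "(case p of (is, x) \<Rightarrow> (1 + norm x) ^ k * norm (iter_partial is f x)) \<le> (\<Sum>is\<in>{is. length is \<le> N}. \<bar>B is\<bar>)"
      by (simp add: p)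
  qed
qed

lemma schwartz_seminorm_ge:
  assumes "f \<in> schwartz_functions" "length is \<le> N"
  shows "(1 + norm x) ^ k * norm (iter_partial is f x) \<le> schwartz_seminorm k N f"
  unfolding schwartz_seminorm_def
  using cSUP_upper[OF _ schwartz_seminorm_bdd[OF assms(1)], of "(is, x)" N k] assms(2) by auto

lemma schwartz_seminorm_le:
  assumes "\<And>is x. length is \<le> N \<Longrightarrow> (1 + norm x) ^ k * norm (iter_partial is f x) \<le> B"
  shows "schwartz_seminorm k N f \<le> B"
  unfolding schwartz_seminorm_def
proof (rule cSUP_least)
  show "{is::'a list. length is \<le> N} \<times> (UNIV :: (real^'a) set) \<noteq> {}" by (auto intro!: exI[of _ "[]"])
qed (use assms in auto)

lemma schwartz_seminorm_nonneg: "f \<in> schwartz_functions \<Longrightarrow> 0 \<le> schwartz_seminorm k N f"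
  by (rule order_trans[OF _ schwartz_seminorm_ge[of f "[]" N 0 k]]) auto

lemma schwartz_decay:
  assumes "f \<in> schwartz_functions" "length is \<le> N"
  shows "norm (iter_partial is f x) \<le> schwartz_seminorm k N f / (1 + norm x) ^ k"
proof -
  have "(1 + norm x) ^ k > 0" by (simp add: add_pos_nonneg)
  then show ?thesis using schwartz_seminorm_ge[OF assms, of x k] by (simp add: field_simps)
qed

lemma schwartzI:
  assumes "smooth f" "\<And>k is. \<exists>B. \<forall>x. (1 + norm x) ^ k * norm (iter_partial is f x) \<le> B"
  shows "f \<in> schwartz_functions"
proof -
  have "bounded (range (\<lambda>x. (1 + norm x) ^ k * norm (iter_partial is f x)))" for k "is"
  proof -
    obtain B where B: "\<And>x. (1 + norm x) ^ k * norm (iter_partial is f x) \<le> B" using assms(2) by blast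
    have "norm ((1 + norm x) ^ k * norm (iter_partial is f x)) \<le> B" for x
      using B[of x] by (simp add: abs_mult)
    then show ?thesis unfolding bounded_iff by blast
  qed
  then show ?thesis using assms(1) by (simp add: schwartz_functions_def)
qed

text \<open>The multipliers of the Schwartz space, often denoted O_M: smooth functions all of whose
  derivatives grow at most polynomially.\<close>

definition moderate :: "(real ^ 'n \<Rightarrow> complex) \<Rightarrow> bool" where
  "moderate a \<longleftrightarrow> smooth a \<and> (\<forall>is. \<exists>C m. \<forall>x. norm (iter_partial is a x) \<le> C * (1 + norm x) ^ m)"

lemma moderate_uniform:
  fixes a :: "real ^ 'n \<Rightarrow> complex"
  assumes "moderate a"
  obtains C m where "C \<ge> 0" "\<And>is x. length is \<le> N \<Longrightarrow> norm (iter_partial is a x) \<le> C * (1 + norm x) ^ m"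
proof -
  obtain C m where Cm: "\<And>is x. norm (iter_partial is a x) \<le> C is * (1 + norm x) ^ m is"
    using assms unfolding moderate_def by metis
  define C' where "C' = (\<Sum>is\<in>{is. length is \<le> N}. \<bar>C is\<bar>)"
  define m' where "m' = (\<Sum>is\<in>{is. length is \<le> N}. m is)"
  show thesis
  proof (rule that[of C' m'])
    show "C' \<ge> 0" by (simp add: C'_def sum_nonneg)
    fix "is" :: "'n list" and x :: "real^'n" assume l: "length is \<le> N"
    have "norm (iter_partial is a x) \<le> \<bar>C is\<bar> * (1 + norm x) ^ m is"
      using Cm[of "is" x] by (rule order_trans) (auto intro!: mult_right_mono)
    also have "\<dots> \<le> C' * (1 + norm x) ^ m'"
    proof (intro mult_mono power_increasing)
      show "\<bar>C is\<bar> \<le> C'" unfolding C'_def using l by (intro member_le_sum finite_lists_le) auto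
      show "m is \<le> m'" unfolding m'_def using l by (intro member_le_sum finite_lists_le) auto
    qed (auto simp: C'_def sum_nonneg)
    finally show "norm (iter_partial is a x) \<le> C' * (1 + norm x) ^ m'" .
  qed
qed

text \<open>Growth of order \<open>m\<close> of the multiplier is paid for by passing from weight
  \<open>k\<close> to weight \<open>k + m\<close> in the seminorm of \<open>f\<close>.\<close>

lemma schwartz_mult:
  fixes f :: "real ^ 'n \<Rightarrow> complex"
  assumes a: "moderate a" and f: "f \<in> schwartz_functions"
  shows "(\<lambda>x. a x * f x) \<in> schwartz_functions"
proof (rule schwartzI)
  have sa: "smooth a" using a by (simp add: moderate_def)
  show "smooth (\<lambda>x. a x * f x)" by (intro smooth_mult sa schwartz_smooth f)
  fix k and "is" :: "'n list"
  obtain C m where C: "C \<ge> 0" "\<And>js x. length js \<le> length is \<Longrightarrow> norm (iter_partial js a x) \<le> C * (1 + norm x) ^ m"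
    using moderate_uniform[OF a] by blast
  define S where "S = schwartz_seminorm (k + m) (length is) f"
  have "(1 + norm x) ^ k * norm (iter_partial is (\<lambda>x. a x * f x) x) \<le> 2 ^ length is * (C * S)" for x
  proof -
    have pos: "1 + norm x > 0" by (simp add: add_pos_nonneg)
    have "norm (iter_partial is (\<lambda>x. a x * f x) x) \<le> 2 ^ length is * ((C * (1 + norm x) ^ m) * (S / (1 + norm x) ^ (k + m)))"
      unfolding S_def by (rule iter_partial_mult_bound[OF sa schwartz_smooth[OF f] C(2) schwartz_decay[OF f]])
    also have "\<dots> = 2 ^ length is * (C * S) / (1 + norm x) ^ k"
      using pos by (simp add: power_add field_simps)
    finally show ?thesis using pos by (simp add: field_simps)
  qed
  then show "\<exists>B. \<forall>x. (1 + norm x) ^ k * norm (iter_partial is (\<lambda>x. a x * f x) x) \<le> B" by blast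
qed

lemma moderate_const: "moderate (\<lambda>x. c)"
proof -
  have "norm (iter_partial is (\<lambda>x. c) x) \<le> norm c * (1 + norm x) ^ 0" for "is" and x :: "real^'a"
  proof (cases "is")
    case (Cons i js)
    have "iter_partial (i # js) (\<lambda>x. c) = (\<lambda>x::real^'a. 0)"
    proof (induction js arbitrary: i)
      case (Cons j js)
      then show ?case by (metis iter_partial.simps(2) partial_deriv_const)
    qed simp
    then show ?thesis using Cons by simp
  qed simp
  then show ?thesis unfolding moderate_def using smooth_const by blast
qed

lemma partial_deriv_coord: "partial_deriv i (\<lambda>x::real^'n. of_real (x $ j)) = (\<lambda>x. if i = j then 1 else 0)"
proof
  fix x :: "real^'n"
  have "((\<lambda>x. x $ j) has_derivative (\<lambda>y. y $ j)) (at x)"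
    by (rule bounded_linear_imp_has_derivative) (rule bounded_linear_vec_nth)
  then have "((\<lambda>x. complex_of_real (x $ j)) has_derivative (\<lambda>y. of_real (y $ j))) (at x)"
    by (rule has_derivative_of_real)
  from partial_deriv_has_derivative[OF this, of i]
  show "partial_deriv i (\<lambda>x::real^'n. of_real (x $ j)) x = (if i = j then 1 else 0)"
    by (auto simp: axis_def)
qed

lemma moderate_coord: "moderate (\<lambda>x::real^'n. of_real (x $ j))"
proof -
  have "\<exists>C m. \<forall>x. norm (iter_partial is (\<lambda>x::real^'n. complex_of_real (x $ j)) x) \<le> C * (1 + norm x) ^ m" for "is"
  proof (cases "is" rule: rev_cases)
    case Nil
    have "\<bar>x $ j\<bar> \<le> 1 * (1 + norm x) ^ 1" for x :: "real^'n" using component_le_norm_cart[of x j] by simp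
    then show ?thesis using Nil by (intro exI[of _ 1]) auto
  next
    case (snoc js i)
    have "\<exists>C m. \<forall>x. norm (iter_partial js (\<lambda>x::real^'n. c) x) \<le> C * (1 + norm x) ^ m" for c
      using moderate_const[of c] unfolding moderate_def by blast
    then show ?thesis unfolding snoc
      by (cases "i = j") (simp_all add: iter_partial_append partial_deriv_coord)
  qed
  then show ?thesis by (simp add: moderate_def smooth_coord)
qed

lemma moderate_wave: "moderate (wave \<xi>)"
proof -
  have "norm (iter_partial is (wave \<xi>) x) \<le> norm (prod_list (map (\<lambda>j. \<i> * complex_of_real (\<xi> $ j)) is)) * (1 + norm x) ^ 0" for "is" x
    by (simp add: iter_partial_wave norm_mult)
  then show ?thesis unfolding moderate_def using smooth_wave by blast
qed

lemma schwartz_add: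
  assumes "f \<in> schwartz_functions" "g \<in> schwartz_functions"
  shows "(\<lambda>x. f x + g x) \<in> schwartz_functions"
proof (rule schwartzI)
  note s = schwartz_smooth[OF assms(1)] schwartz_smooth[OF assms(2)]
  show "smooth (\<lambda>x. f x + g x)" by (intro smooth_add s)
  fix k and "is" :: "'a list"
  have "(1 + norm x) ^ k * norm (iter_partial is (\<lambda>x. f x + g x) x)
     \<le> schwartz_seminorm k (length is) f + schwartz_seminorm k (length is) g" for x
  proof -
    have "(1 + norm x) ^ k * norm (iter_partial is (\<lambda>x. f x + g x) x)
      \<le> (1 + norm x) ^ k * (norm (iter_partial is f x) + norm (iter_partial is g x))"
      unfolding iter_partial_add[OF s] by (intro mult_left_mono norm_triangle_ineq) auto
    then show ?thesis
      using schwartz_seminorm_ge[OF assms(1), of "is" "length is" x k] schwartz_seminorm_ge[OF assms(2), of "is" "length is" x k]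
      by (simp add: distrib_left)
  qed
  then show "\<exists>B. \<forall>x. (1 + norm x) ^ k * norm (iter_partial is (\<lambda>x. f x + g x) x) \<le> B" by blast
qed

lemma schwartz_cmult: "f \<in> schwartz_functions \<Longrightarrow> (\<lambda>x. c * f x) \<in> schwartz_functions"
  by (rule schwartz_mult[OF moderate_const])

lemma schwartz_diff:
  assumes "f \<in> schwartz_functions" "g \<in> schwartz_functions"
  shows "(\<lambda>x. f x - g x) \<in> schwartz_functions"
  using schwartz_add[OF assms(1) schwartz_cmult[OF assms(2), of "-1"]] by simp

lemma schwartz_partial_deriv: "f \<in> schwartz_functions \<Longrightarrow> partial_deriv i f \<in> schwartz_functions"
proof -
  assume f: "f \<in> schwartz_functions"
  have "bounded (range (\<lambda>x. (1 + norm x) ^ k * norm (iter_partial is (partial_deriv i f) x)))" for k "is"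
  proof -
    have "bounded (range (\<lambda>x. (1 + norm x) ^ k * norm (iter_partial (is @ [i]) f x)))"
      using f unfolding schwartz_functions_def by blast
    then show ?thesis by (simp add: iter_partial_append)
  qed
  then show ?thesis using smooth_partial_deriv[OF schwartz_smooth[OF f]] by (simp add: schwartz_functions_def)
qed

lemma test_moderate: "f \<in> test_functions \<Longrightarrow> moderate f"
proof -
  assume f: "f \<in> test_functions"
  have "norm (iter_partial is f x) \<le> schwartz_seminorm 0 (length is) f * (1 + norm x) ^ 0" for "is" x
    using schwartz_seminorm_ge[OF test_subset_schwartz[OF f], of "is" "length is" x 0] by simp
  then show ?thesis unfolding moderate_def using test_smooth[OF f] by blast
qed

text \<open>Rescaling contributes a factor \<open>1 / r\<close> per derivative, which does not
  exceed 1. The bound is therefore uniform in the radius.\<close>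

lemma ball_cutoff_derivatives_bounded:
  obtains D where "\<And>is r x. length is \<le> N \<Longrightarrow> r \<ge> 1 \<Longrightarrow> norm (iter_partial is (ball_cutoff (0::real^'n) r) x) \<le> D"
proof -
  define D where "D = schwartz_seminorm 0 N (cutoff :: real^'n \<Rightarrow> complex)"
  have c: "cutoff \<in> (schwartz_functions :: (real^'n \<Rightarrow> complex) set)"
    by (rule test_subset_schwartz[OF test_functionI[OF smooth_cutoff compact_cball[of 0 2]]]) (simp add: cutoff_eq_0)
  show thesis
  proof (rule that[of D])
    fix "is" :: "'n list" and r :: real and x assume l: "length is \<le> N" and r: "r \<ge> 1"
    have "ball_cutoff (0::real^'n) r = (\<lambda>x. cutoff ((1/r) *\<^sub>R x + 0))"
      by (auto simp: ball_cutoff_def)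
    then have "norm (iter_partial is (ball_cutoff 0 r) x) = (1/r) ^ length is * norm (iter_partial is cutoff ((1/r) *\<^sub>R x))"
      using iter_partial_affine[OF smooth_cutoff, of "is" "1/r" "0::real^'n"] r by (simp add: norm_mult norm_divide norm_power)
    also have "\<dots> \<le> 1 * norm (iter_partial is cutoff ((1/r) *\<^sub>R x))"
      using r by (intro mult_right_mono) (auto simp: power_one_over intro: power_le_one)
    also have "\<dots> \<le> D" using schwartz_seminorm_ge[OF c l, of "(1/r) *\<^sub>R x" 0] by (simp add: D_def)
    finally show "norm (iter_partial is (ball_cutoff 0 r) x) \<le> D" .
  qed
qed

text \<open>The truncated part vanishes in the ball of radius \<open>Suc n\<close>. Outside it, one
  spare power of the weight gains a factor of order \<open>1 / Suc n\<close>.\<close>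

lemma schwartz_approximation:
  fixes h :: "real ^ 'n \<Rightarrow> complex"
  assumes h: "h \<in> schwartz_functions"
  shows "(\<lambda>n. schwartz_seminorm k N (\<lambda>x. (1 - ball_cutoff 0 (real (Suc n)) x) * h x)) \<longlonglongrightarrow> 0"
proof -
  obtain D where D: "\<And>is r x. length is \<le> N \<Longrightarrow> r \<ge> 1 \<Longrightarrow> norm (iter_partial is (ball_cutoff (0::real^'n) r) x) \<le> D"
    using ball_cutoff_derivatives_bounded[of N] by blast
  define S where "S = schwartz_seminorm (Suc k) N h"
  have S: "S \<ge> 0" unfolding S_def by (rule schwartz_seminorm_nonneg[OF h])
  have D0: "D \<ge> 0" using D[of "[]" 1 0] order_trans[OF norm_ge_zero] by force
  define a where "a = (\<lambda>n (x::real^'n). 1 - ball_cutoff 0 (real (Suc n)) x)"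
  have sa: "smooth (a n)" for n unfolding a_def by (intro smooth_diff smooth_const smooth_ball_cutoff)
  have aD: "norm (iter_partial is (a n) x) \<le> 1 + D" if "length is \<le> N" for "is" n x
  proof -
    have "iter_partial is (a n) x = iter_partial is (\<lambda>x. 1) x + iter_partial is (\<lambda>x. (-1) * ball_cutoff 0 (real (Suc n)) x) x"
      using iter_partial_add[OF smooth_const[of 1] smooth_mult[OF smooth_const[of "-1"] smooth_ball_cutoff[of "0::real^'n" "real (Suc n)"]], of "is"]
      by (simp add: a_def)
    also have "norm \<dots> \<le> 1 + D"
    proof (rule norm_triangle_mono)
      show "norm (iter_partial is (\<lambda>x::real^'n. 1) x) \<le> 1"
      proof (cases "is" rule: rev_cases)
        case (snoc js i)
        have "iter_partial js (\<lambda>x::real^'n. 0) x = 0" by (rule iter_partial_zero_on_open[of UNIV]) auto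
        then show ?thesis using snoc by (simp add: iter_partial_append)
      qed simp
      show "norm (iter_partial is (\<lambda>x. (-1) * ball_cutoff 0 (real (Suc n)) x) x) \<le> D"
        unfolding iter_partial_cmult[OF smooth_ball_cutoff] using D[OF that, of "real (Suc n)" x] by simp
    qed
    finally show ?thesis .
  qed
  have le: "schwartz_seminorm k N (\<lambda>x. a n x * h x) \<le> 2 ^ N * ((1 + D) * S) / real (Suc n)" for n
  proof (rule schwartz_seminorm_le)
    fix "is" :: "'n list" and x :: "real^'n" assume l: "length is \<le> N"
    show "(1 + norm x) ^ k * norm (iter_partial is (\<lambda>x. a n x * h x) x) \<le> 2 ^ N * ((1 + D) * S) / real (Suc n)"
    proof (cases "norm x < real (Suc n)")
      case True
      have "iter_partial is (\<lambda>x. a n x * h x) x = 0"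
      proof (rule iter_partial_zero_on_open[of "ball 0 (real (Suc n))"])
        show "a n y * h y = 0" if "y \<in> ball 0 (real (Suc n))" for y
          using ball_cutoff_eq(1)[of "real (Suc n)" 0 y] that by (simp add: a_def)
      qed (use True in auto)
      then show ?thesis using S D0 by simp
    next
      case False
      have pos: "1 + norm x > 0" by (simp add: add_pos_nonneg)
      have "norm (iter_partial is (\<lambda>x. a n x * h x) x) \<le> 2 ^ length is * ((1 + D) * (S / (1 + norm x) ^ Suc k))"
      proof (rule iter_partial_mult_bound[OF sa schwartz_smooth[OF h]])
        fix js :: "'n list" assume "length js \<le> length is"
        then have "length js \<le> N" using l by simp
        then show "norm (iter_partial js (a n) x) \<le> 1 + D" "norm (iter_partial js h x) \<le> S / (1 + norm x) ^ Suc k"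
          unfolding S_def by (rule aD, rule schwartz_decay[OF h])
      qed
      then have "(1 + norm x) ^ k * norm (iter_partial is (\<lambda>x. a n x * h x) x)
          \<le> (1 + norm x) ^ k * (2 ^ length is * ((1 + D) * (S / (1 + norm x) ^ Suc k)))"
        by (intro mult_left_mono) auto
      also have "\<dots> = 2 ^ length is * ((1 + D) * S) / (1 + norm x)"
      proof -
        have "w ^ k * (A * (B * (S / w ^ Suc k))) = A * (B * S) / w" if "w > 0" for w A B :: real
          using that by simp
        then show ?thesis using pos by blast
      qed
      also have "\<dots> \<le> 2 ^ N * ((1 + D) * S) / real (Suc n)"
        using False l S D0 by (intro frac_le mult_right_mono power_increasing mult_nonneg_nonneg) auto
      finally show ?thesis .
    qed
  qed
  show ?thesis
  proof (rule real_tendsto_sandwich[of "\<lambda>n. 0" _ _ "\<lambda>n. 2 ^ N * ((1 + D) * S) / real (Suc n)"])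
    have "(\<lambda>x. a n x * h x) \<in> schwartz_functions" for n
    proof -
      have "(\<lambda>x. h x - ball_cutoff 0 (real (Suc n)) x * h x) \<in> schwartz_functions"
        by (intro schwartz_diff h schwartz_mult test_moderate test_ball_cutoff) simp
      then show ?thesis by (simp add: a_def left_diff_distrib)
    qed
    then show "eventually (\<lambda>n. 0 \<le> schwartz_seminorm k N (\<lambda>x. (1 - ball_cutoff 0 (real (Suc n)) x) * h x)) sequentially"
      unfolding a_def by (intro always_eventually allI schwartz_seminorm_nonneg)
    show "eventually (\<lambda>n. schwartz_seminorm k N (\<lambda>x. (1 - ball_cutoff 0 (real (Suc n)) x) * h x) \<le> 2 ^ N * ((1 + D) * S) / real (Suc n)) sequentially"
      using le unfolding a_def by (intro always_eventually allI)
    show "(\<lambda>n. 2 ^ N * ((1 + D) * S) / real (Suc n)) \<longlonglongrightarrow> 0"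
      by (rule LIMSEQ_Suc) (rule lim_const_over_n)
  qed simp
qed

section \<open>Fourier inversion\<close>

text \<open>Lebesgue measure is the image of the product measure under assembling a vector from its
  coordinates. This reduces Gaussian integrals and decay estimates to dimension one.\<close>

lemma lborel_prod_Basis:
  fixes g :: "'a::euclidean_space \<Rightarrow> real \<Rightarrow> 'c::{real_normed_field,banach,second_countable_topology}"
  assumes g: "\<And>b. b \<in> Basis \<Longrightarrow> integrable lborel (g b)"
  shows "integrable lborel (\<lambda>x. \<Prod>b\<in>Basis. g b (x \<bullet> b))"
    and "(LINT x|lborel. (\<Prod>b\<in>Basis. g b (x \<bullet> b))) = (\<Prod>b\<in>Basis. LINT s|lborel. g b s)"
proof -
  interpret product_sigma_finite "\<lambda>_::'a. lborel :: real measure" ..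
  have m: "g b \<in> borel_measurable borel" if "b \<in> Basis" for b
    using borel_measurable_integrable[OF g[OF that]] by simp
  then have meas: "(\<lambda>x. \<Prod>b\<in>Basis. g b (x \<bullet> b)) \<in> borel_measurable borel"
    by (intro borel_measurable_prod measurable_compose[OF _ m]) auto
  have T: "(\<lambda>f. \<Sum>b\<in>Basis. f b *\<^sub>R b) \<in> measurable (Pi\<^sub>M Basis (\<lambda>_::'a. lborel :: real measure)) borel"
    by measurable
  have eq: "(\<Prod>b\<in>Basis. g b ((\<Sum>b'\<in>Basis. f b' *\<^sub>R b') \<bullet> b)) = (\<Prod>b\<in>Basis. g b (f b))" for f
    by (intro prod.cong refl) (simp add: inner_sum_left inner_Basis if_distrib sum.delta cong: if_cong)
  show "integrable lborel (\<lambda>x. \<Prod>b\<in>Basis. g b (x \<bullet> b))"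
    apply (subst lborel_eq, subst integrable_distr_eq[OF T meas]) unfolding eq
    by (rule product_integrable_prod[OF finite_Basis]) (rule g)
  show "(LINT x|lborel. (\<Prod>b\<in>Basis. g b (x \<bullet> b))) = (\<Prod>b\<in>Basis. LINT s|lborel. g b s)"
    apply (subst lborel_eq, subst integral_distr[OF T meas]) unfolding eq
    by (rule product_integral_prod[OF finite_Basis]) (rule g)
qed

lemma integrable_inverse_1_plus_square_lborel: "integrable lborel (\<lambda>s::real. inverse (1 + s\<^sup>2))"
  using integrable_inverse_1_plus_square by (simp add: set_integrable_def einterval_def)

text \<open>The majorant is a product of one-dimensional functions
  \<open>inverse (1 + s\<^sup>2)\<close>. Each coordinate costs a factor
  \<open>(1 + norm x)\<^sup>2\<close>, which accounts for the exponent twice the dimension.\<close>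

lemma integrable_if_decaying:
  fixes f :: "'a::euclidean_space \<Rightarrow> complex"
  assumes meas: "f \<in> borel_measurable borel"
    and decay: "\<And>x. (1 + norm x) ^ (2 * DIM('a)) * norm (f x) \<le> K"
  shows "integrable lborel f"
proof (rule Bochner_Integration.integrable_bound)
  show "integrable lborel (\<lambda>x::'a. K * (\<Prod>b\<in>Basis. inverse (1 + (x \<bullet> b)\<^sup>2)))"
    by (intro integrable_mult_right lborel_prod_Basis(1) integrable_inverse_1_plus_square_lborel)
  show "f \<in> borel_measurable lborel" using meas by simp
  have "norm (f x) \<le> norm (K * (\<Prod>b\<in>Basis. inverse (1 + (x \<bullet> b)\<^sup>2)))" for x
  proof -
    have "(\<Prod>b\<in>Basis. 1 + (x \<bullet> b)\<^sup>2) \<le> (\<Prod>b\<in>(Basis::'a set). (1 + norm x)\<^sup>2)"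
    proof (intro prod_mono conjI)
      fix b :: 'a assume "b \<in> Basis"
      then have "\<bar>x \<bullet> b\<bar> \<le> norm x" by (rule Basis_le_norm)
      then have "(x \<bullet> b)\<^sup>2 \<le> (norm x)\<^sup>2" by (metis abs_ge_zero power2_abs power_mono)
      then show "1 + (x \<bullet> b)\<^sup>2 \<le> (1 + norm x)\<^sup>2"
        using norm_ge_zero[of x] unfolding power2_sum power_one mult_1_right by linarith
      show "0 \<le> 1 + (x \<bullet> b)\<^sup>2" by simp
    qed
    also have "\<dots> = (1 + norm x) ^ (2 * DIM('a))" by (simp add: power_mult)
    finally have "(\<Prod>b\<in>Basis. 1 + (x \<bullet> b)\<^sup>2) * norm (f x) \<le> K"
      using decay[of x] mult_right_mono[OF _ norm_ge_zero] order_trans by blast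
    moreover have "(\<Prod>b\<in>(Basis::'a set). 1 + (x \<bullet> b)\<^sup>2) > 0" by (intro prod_pos) (simp add: add_pos_nonneg)
    ultimately have "norm (f x) \<le> K * inverse (\<Prod>b\<in>Basis. 1 + (x \<bullet> b)\<^sup>2)"
      by (simp add: field_simps)
    then show ?thesis by (simp add: prod_inversef[symmetric] o_def)
  qed
  then show "AE x in lborel. norm (f x) \<le> norm (K * (\<Prod>b\<in>Basis. inverse (1 + (x \<bullet> b)\<^sup>2)))" by simp
qed

lemma lborel_affine_integrable:
  fixes f :: "'a::euclidean_space \<Rightarrow> 'b::{banach,second_countable_topology}"
  assumes f: "f \<in> borel_measurable borel" and c: "c \<noteq> 0"
  shows "integrable lborel f \<longleftrightarrow> integrable lborel (\<lambda>x. f (t + c *\<^sub>R x))"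
    and "(LINT x|lborel. f x) = \<bar>c\<bar> ^ DIM('a) *\<^sub>R (LINT x|lborel. f (t + c *\<^sub>R x))"
proof -
  have T: "(\<lambda>x. t + c *\<^sub>R x) \<in> measurable lborel (borel :: 'a measure)" by measurable
  have f': "f \<in> borel_measurable (distr lborel borel (\<lambda>x. t + c *\<^sub>R x))" using f by simp
  have eq: "(lborel :: 'a measure) = density (distr lborel borel (\<lambda>x. t + c *\<^sub>R x)) (\<lambda>_. ennreal (\<bar>c\<bar> ^ DIM('a)))"
    using lborel_affine[OF c, of t] by (simp add: ennreal_power)
  have f1: "(\<lambda>x. \<bar>c\<bar> ^ DIM('a) *\<^sub>R f x) \<in> borel_measurable borel" using f by measurable
  have scale: "integrable lborel (\<lambda>x. k *\<^sub>R g x) \<longleftrightarrow> integrable lborel g" if "k \<noteq> 0" for k and g :: "'a \<Rightarrow> 'b"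
  proof
    assume "integrable lborel (\<lambda>x. k *\<^sub>R g x)"
    then have "integrable lborel (\<lambda>x. (1 / k) *\<^sub>R (k *\<^sub>R g x))" by (rule integrable_scaleR_right)
    then show "integrable lborel g" using that by simp
  qed (rule integrable_scaleR_right)
  show "integrable lborel f \<longleftrightarrow> integrable lborel (\<lambda>x. f (t + c *\<^sub>R x))"
    by (subst eq, subst integrable_density[OF f'], (simp; fail), (simp; fail), subst integrable_distr_eq[OF T f1])
       (rule scale, use c in simp)
  show "(LINT x|lborel. f x) = \<bar>c\<bar> ^ DIM('a) *\<^sub>R (LINT x|lborel. f (t + c *\<^sub>R x))"
    by (subst eq, subst integral_density[OF f'], (simp; fail), (simp; fail), subst integral_distr[OF T f1]) simp
qed

definition gauss :: "'a::euclidean_space \<Rightarrow> real" where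
  "gauss x = (\<Prod>b\<in>Basis. std_normal_density (x \<bullet> b))"

lemma gauss_eq: "gauss (x::'a::euclidean_space) = exp (- (x \<bullet> x) / 2) / sqrt (2 * pi) ^ DIM('a)"
proof -
  have "gauss x = (\<Prod>b\<in>(Basis::'a set). 1 / sqrt (2 * pi)) * (\<Prod>b\<in>Basis. exp (- (x \<bullet> b)\<^sup>2 / 2))"
    unfolding gauss_def by (subst prod.distrib[symmetric]) (simp add: normal_density_def)
  also have "(\<Prod>b\<in>Basis. exp (- (x \<bullet> b)\<^sup>2 / 2)) = exp (\<Sum>b\<in>Basis. - (x \<bullet> b)\<^sup>2 / 2)"
    by (simp add: exp_sum)
  also have "(\<Sum>b\<in>Basis. - (x \<bullet> b)\<^sup>2 / 2) = - (x \<bullet> x) / 2"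
    by (subst euclidean_inner[of x x]) (simp add: power2_eq_square sum_negf sum_divide_distrib)
  finally show ?thesis by (simp add: power_one_over)
qed

lemma integrable_gauss: "integrable lborel (gauss :: 'a::euclidean_space \<Rightarrow> real)"
  unfolding gauss_def[abs_def] by (rule lborel_prod_Basis(1)) simp

lemma integral_gauss: "(LINT x|lborel. gauss (x :: 'a::euclidean_space)) = 1"
  unfolding gauss_def[abs_def] by (subst lborel_prod_Basis(2)) (simp_all)

text \<open>In one dimension this is the characteristic function of the standard normal
  distribution; the general case is a product over coordinates.\<close>

lemma fourier_gauss:
  "(LINT x|lborel. complex_of_real (gauss x) * exp (\<i> * of_real (x \<bullet> \<xi>))) = of_real (exp (- (\<xi> \<bullet> \<xi>) / 2))"
proof -
  have 1: "(LINT s|lborel. complex_of_real (std_normal_density s) * exp (\<i> * of_real (s * t))) = of_real (exp (- t\<^sup>2 / 2))" for t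
  proof -
    have "complex_of_real (exp (- t\<^sup>2 / 2)) = char std_normal_distribution t"
      by (simp add: char_std_normal_distribution)
    also have "\<dots> = (LINT s|lborel. std_normal_density s *\<^sub>R exp (\<i> * complex_of_real (t * s)))"
      unfolding char_def by (subst integral_density) auto
    finally show ?thesis by (simp add: scaleR_conv_of_real mult.commute)
  qed
  have int: "integrable lborel (\<lambda>s. complex_of_real (std_normal_density s) * exp (\<i> * of_real (s * t)))" for t
  proof (rule Bochner_Integration.integrable_bound[of _ std_normal_density])
    show "(\<lambda>s. complex_of_real (std_normal_density s) * exp (\<i> * of_real (s * t))) \<in> borel_measurable lborel" by measurable
  qed (auto simp: norm_mult)
  have eq: "complex_of_real (gauss x) * exp (\<i> * of_real (x \<bullet> \<xi>)) =
      (\<Prod>b\<in>Basis. complex_of_real (std_normal_density (x \<bullet> b)) * exp (\<i> * of_real ((x \<bullet> b) * (\<xi> \<bullet> b))))" for x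
  proof -
    have "exp (\<i> * complex_of_real (x \<bullet> \<xi>)) = (\<Prod>b\<in>Basis. exp (\<i> * of_real ((x \<bullet> b) * (\<xi> \<bullet> b))))"
      by (subst euclidean_inner) (simp add: sum_distrib_left exp_sum)
    then show ?thesis by (simp add: gauss_def prod.distrib)
  qed
  have "(LINT x|lborel. complex_of_real (gauss x) * exp (\<i> * of_real (x \<bullet> \<xi>))) = (\<Prod>b\<in>Basis. complex_of_real (exp (- (\<xi> \<bullet> b)\<^sup>2 / 2)))"
    unfolding eq by (subst lborel_prod_Basis(2)[OF int]) (simp only: 1)
  also have "\<dots> = of_real (\<Prod>b\<in>Basis. exp (- (\<xi> \<bullet> b)\<^sup>2 / 2))" by simp
  also have "(\<Prod>b\<in>Basis. exp (- (\<xi> \<bullet> b)\<^sup>2 / 2)) = exp (\<Sum>b\<in>Basis. - (\<xi> \<bullet> b)\<^sup>2 / 2)"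
    by (simp add: exp_sum)
  also have "(\<Sum>b\<in>Basis. - (\<xi> \<bullet> b)\<^sup>2 / 2) = - (\<xi> \<bullet> \<xi>) / 2"
    by (subst euclidean_inner[of \<xi> \<xi>]) (simp add: power2_eq_square sum_negf sum_divide_distrib)
  finally show ?thesis .
qed

text \<open>The power of \<open>N\<close> is the Jacobian of the scaling. One power of
  \<open>sqrt (2 * pi)\<close> comes from undoing the normalization of \<open>gauss\<close>, an
  equal one from restoring it in the transform.\<close>

lemma fourier_scaled_gauss:
  fixes \<zeta> :: "'a::euclidean_space"
  assumes N: "N > 0"
  shows "(LINT x|lborel. complex_of_real (exp (- (x \<bullet> x) / (2 * N\<^sup>2))) * exp (\<i> * of_real (x \<bullet> \<zeta>)))
    = of_real ((2 * pi) ^ DIM('a) * N ^ DIM('a) * gauss (N *\<^sub>R \<zeta>))"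
proof -
  let ?f = "\<lambda>x. complex_of_real (exp (- (x \<bullet> x) / (2 * N\<^sup>2))) * exp (\<i> * of_real (x \<bullet> \<zeta>))"
  let ?s = "sqrt (2 * pi) ^ DIM('a)"
  have "?f \<in> borel_measurable borel" by measurable
  then have "(LINT x|lborel. ?f x) = \<bar>N\<bar> ^ DIM('a) *\<^sub>R (LINT x|lborel. ?f (0 + N *\<^sub>R x))"
    using N by (intro lborel_affine_integrable(2)) auto
  also have "?f (0 + N *\<^sub>R x) = of_real ?s * (complex_of_real (gauss x) * exp (\<i> * of_real (x \<bullet> (N *\<^sub>R \<zeta>))))" for x
    using N by (simp add: gauss_eq power2_eq_square)
  then have "(LINT x|lborel. ?f (0 + N *\<^sub>R x)) = (LINT x|lborel. of_real ?s * (complex_of_real (gauss x) * exp (\<i> * of_real (x \<bullet> (N *\<^sub>R \<zeta>)))))"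
    by presburger
  also have "\<dots> = of_real ?s * of_real (exp (- ((N *\<^sub>R \<zeta>) \<bullet> (N *\<^sub>R \<zeta>)) / 2))"
    by (subst integral_mult_right_zero) (simp only: fourier_gauss)
  also have "exp (- ((N *\<^sub>R \<zeta>) \<bullet> (N *\<^sub>R \<zeta>)) / 2) = ?s * gauss (N *\<^sub>R \<zeta>)"
    by (simp add: gauss_eq)
  finally have "(LINT x|lborel. ?f x) = of_real (\<bar>N\<bar> ^ DIM('a) * (?s * ?s) * gauss (N *\<^sub>R \<zeta>))"
    by (simp add: scaleR_conv_of_real mult_ac)
  note I = this
  have "?s * ?s = (2 * pi) ^ DIM('a)"
    unfolding power_mult_distrib[symmetric] real_sqrt_mult_self by simp
  then have "\<bar>N\<bar> ^ DIM('a) * (?s * ?s) * gauss (N *\<^sub>R \<zeta>) = (2 * pi) ^ DIM('a) * N ^ DIM('a) * gauss (N *\<^sub>R \<zeta>)"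
    by (simp only: abs_of_pos[OF N] mult.commute[of "N ^ DIM('a)" "(2 * pi) ^ DIM('a)"])
  then show ?thesis unfolding I by (rule arg_cong)
qed

text \<open>Inserting a Gaussian of variance \<open>N\<^sup>2\<close> makes Fubini's theorem applicable and turns the double
  integral into a Gaussian average of \<open>K\<close> about \<open>\<eta>\<close> at scale \<open>1 / N\<close>.\<close>

lemma fourier_inversion:
  fixes K :: "'a::euclidean_space \<Rightarrow> complex"
  assumes cont: "continuous_on UNIV K" and K: "integrable lborel K" and B: "\<And>\<xi>. norm (K \<xi>) \<le> B"
  defines "b \<equiv> \<lambda>x. LINT \<xi>|lborel. K \<xi> * exp (\<i> * of_real (x \<bullet> \<xi>))"
  assumes b: "integrable lborel b"
  shows "(LINT x|lborel. b x * exp (- \<i> * of_real (x \<bullet> \<eta>))) = of_real ((2 * pi) ^ DIM('a)) * K \<eta>"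
proof -
  define e where "e = (\<lambda>N (x::'a). exp (- (x \<bullet> x) / (2 * N\<^sup>2)))"
  have [measurable]: "K \<in> borel_measurable borel" using cont by (rule borel_measurable_continuous_onI)
  have [measurable]: "b \<in> borel_measurable borel" using borel_measurable_integrable[OF b] by simp
  have e_int: "integrable lborel (e N)" if "N > 0" for N
  proof -
    have "e N \<in> borel_measurable borel" unfolding e_def by measurable
    moreover have "(\<lambda>x. e N (0 + N *\<^sub>R x)) = (\<lambda>x. sqrt (2 * pi) ^ DIM('a) * gauss x)"
      using that by (auto simp: e_def gauss_eq power2_eq_square)
    ultimately show ?thesis using that integrable_gauss
      by (subst lborel_affine_integrable(1)[of _ N 0]) auto
  qed
  have J: "(LINT x|lborel. b x * exp (- \<i> * of_real (x \<bullet> \<eta>)) * of_real (e N x))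
     = of_real ((2 * pi) ^ DIM('a)) * (LINT y|lborel. K (\<eta> + (1 / N) *\<^sub>R y) * of_real (gauss y))" if N: "N > 0" for N
  proof -
    let ?g = "\<lambda>\<xi> x. K \<xi> * (of_real (e N x) * exp (\<i> * of_real (x \<bullet> (\<xi> - \<eta>))))"
    have int2: "integrable (lborel \<Otimes>\<^sub>M lborel) (\<lambda>(\<xi>, x). ?g \<xi> x)"
    proof (rule lborel_pair.Fubini_integrable)
      show "(\<lambda>(\<xi>, x). ?g \<xi> x) \<in> borel_measurable (lborel \<Otimes>\<^sub>M lborel)"
        unfolding e_def by measurable
      have "(\<lambda>\<xi>. LINT x|lborel. norm (case (\<xi>, x) of (\<xi>, x) \<Rightarrow> ?g \<xi> x)) = (\<lambda>\<xi>. norm (K \<xi>) * (LINT x|lborel. e N x))"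
        by (simp add: norm_mult e_def)
      then show "integrable lborel (\<lambda>\<xi>. LINT x|lborel. norm (case (\<xi>, x) of (\<xi>, x) \<Rightarrow> ?g \<xi> x))"
        using K by simp
      have "integrable lborel (\<lambda>x. ?g \<xi> x)" for \<xi>
      proof (rule Bochner_Integration.integrable_bound[of _ "\<lambda>x. norm (K \<xi>) * e N x"])
        show "integrable lborel (\<lambda>x. norm (K \<xi>) * e N x)" using e_int[OF N] by simp
        show "(\<lambda>x. ?g \<xi> x) \<in> borel_measurable lborel" unfolding e_def by measurable
      qed (simp add: norm_mult e_def)
      then show "AE \<xi> in lborel. integrable lborel (\<lambda>x. case (\<xi>, x) of (\<xi>, x) \<Rightarrow> ?g \<xi> x)" by simp
    qed
    have "(LINT x|lborel. b x * exp (- \<i> * of_real (x \<bullet> \<eta>)) * of_real (e N x)) = (LINT x|lborel. LINT \<xi>|lborel. ?g \<xi> x)"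
    proof (rule Bochner_Integration.integral_cong[OF refl])
      fix x
      have "b x * exp (- \<i> * of_real (x \<bullet> \<eta>)) * of_real (e N x)
        = (LINT \<xi>|lborel. K \<xi> * exp (\<i> * of_real (x \<bullet> \<xi>)) * (exp (- \<i> * of_real (x \<bullet> \<eta>)) * of_real (e N x)))"
        unfolding b_def by (subst integral_mult_left_zero) (simp only: mult.assoc)
      also have "\<dots> = (LINT \<xi>|lborel. ?g \<xi> x)"
        by (intro Bochner_Integration.integral_cong refl)
           (simp add: inner_diff_right algebra_simps exp_diff exp_minus divide_inverse)
      finally show "b x * exp (- \<i> * of_real (x \<bullet> \<eta>)) * of_real (e N x) = (LINT \<xi>|lborel. ?g \<xi> x)" .
    qed
    also have "\<dots> = (LINT \<xi>|lborel. LINT x|lborel. ?g \<xi> x)"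
      using lborel_pair.Fubini_integral[OF int2] .
    also have "\<dots> = (LINT \<xi>|lborel. of_real ((2 * pi) ^ DIM('a) * N ^ DIM('a)) * (K \<xi> * of_real (gauss (N *\<^sub>R (\<xi> - \<eta>)))))"
    proof (intro Bochner_Integration.integral_cong refl)
      fix \<xi>
      have "(LINT x|lborel. ?g \<xi> x) = K \<xi> * (LINT x|lborel. of_real (e N x) * exp (\<i> * of_real (x \<bullet> (\<xi> - \<eta>))))"
        by (rule integral_mult_right_zero)
      then show "(LINT x|lborel. ?g \<xi> x) = of_real ((2 * pi) ^ DIM('a) * N ^ DIM('a)) * (K \<xi> * of_real (gauss (N *\<^sub>R (\<xi> - \<eta>))))"
        unfolding e_def fourier_scaled_gauss[OF N] by (simp add: mult_ac)
    qed
    also have "\<dots> = of_real ((2 * pi) ^ DIM('a) * N ^ DIM('a)) * (LINT \<xi>|lborel. K \<xi> * of_real (gauss (N *\<^sub>R (\<xi> - \<eta>))))"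
      by (rule integral_mult_right_zero)
    \<comment> \<open>The substitution \<open>\<xi> = \<eta> + y / N\<close> centres the Gaussian;
      its Jacobian cancels the power of \<open>N\<close> in front.\<close>
    also have "(LINT \<xi>|lborel. K \<xi> * of_real (gauss (N *\<^sub>R (\<xi> - \<eta>)))) =
      \<bar>1 / N\<bar> ^ DIM('a) *\<^sub>R (LINT y|lborel. K (\<eta> + (1 / N) *\<^sub>R y) * of_real (gauss (N *\<^sub>R ((\<eta> + (1 / N) *\<^sub>R y) - \<eta>))))"
    proof (rule lborel_affine_integrable(2))
      show "(\<lambda>\<xi>. K \<xi> * of_real (gauss (N *\<^sub>R (\<xi> - \<eta>)))) \<in> borel_measurable borel"
        unfolding gauss_eq by measurable
    qed (use N in simp)
    also have "(\<lambda>y. K (\<eta> + (1 / N) *\<^sub>R y) * of_real (gauss (N *\<^sub>R ((\<eta> + (1 / N) *\<^sub>R y) - \<eta>)))) = (\<lambda>y. K (\<eta> + (1 / N) *\<^sub>R y) * of_real (gauss y))"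
      using N by simp
    finally show ?thesis using N by (simp add: scaleR_conv_of_real power_one_over field_simps)
  qed
  \<comment> \<open>As the variance grows the inserted Gaussian increases to 1, and
    \<open>norm (b x)\<close> dominates.\<close>
  have "(\<lambda>n. LINT x|lborel. b x * exp (- \<i> * of_real (x \<bullet> \<eta>)) * of_real (e (real (Suc n)) x))
     \<longlonglongrightarrow> (LINT x|lborel. b x * exp (- \<i> * of_real (x \<bullet> \<eta>)))"
  proof (rule integral_dominated_convergence[where w = "\<lambda>x. norm (b x)"])
    show "integrable lborel (\<lambda>x. norm (b x))" using b by (rule integrable_norm)
    show "AE x in lborel. (\<lambda>n. b x * exp (- \<i> * of_real (x \<bullet> \<eta>)) * of_real (e (real (Suc n)) x)) \<longlonglongrightarrow> b x * exp (- \<i> * of_real (x \<bullet> \<eta>))"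
    proof (rule AE_I2)
      fix x :: 'a
      have "(\<lambda>n. - (x \<bullet> x) / (2 * (real (Suc n))\<^sup>2)) \<longlonglongrightarrow> 0" by real_asymp
      then have "(\<lambda>n. e (real (Suc n)) x) \<longlonglongrightarrow> exp 0" unfolding e_def by (rule tendsto_exp)
      then have "(\<lambda>n. b x * exp (- \<i> * of_real (x \<bullet> \<eta>)) * of_real (e (real (Suc n)) x)) \<longlonglongrightarrow> b x * exp (- \<i> * of_real (x \<bullet> \<eta>)) * of_real (exp 0)"
        by (intro tendsto_intros)
      then show "(\<lambda>n. b x * exp (- \<i> * of_real (x \<bullet> \<eta>)) * of_real (e (real (Suc n)) x)) \<longlonglongrightarrow> b x * exp (- \<i> * of_real (x \<bullet> \<eta>))"
        by simp
    qed
    show "AE x in lborel. norm (b x * exp (- \<i> * of_real (x \<bullet> \<eta>)) * of_real (e (real (Suc n)) x)) \<le> norm (b x)" for n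
      by (rule AE_I2) (simp add: norm_mult e_def mult_left_le divide_nonpos_pos)
    show "(\<lambda>x. b x * exp (- \<i> * of_real (x \<bullet> \<eta>)) * of_real (e (real (Suc n)) x)) \<in> borel_measurable lborel" for n
      unfolding e_def by measurable
    show "(\<lambda>x. b x * exp (- \<i> * of_real (x \<bullet> \<eta>))) \<in> borel_measurable lborel" by measurable
  qed
  \<comment> \<open>On the other side the averages concentrate at \<open>\<eta>\<close>; the
    dominating function is \<open>B * gauss y\<close>.\<close>
  moreover have "(\<lambda>n. LINT y|lborel. K (\<eta> + (1 / real (Suc n)) *\<^sub>R y) * of_real (gauss y)) \<longlonglongrightarrow> (LINT y::'a|lborel. K \<eta> * of_real (gauss y))"
  proof (rule integral_dominated_convergence[where w = "\<lambda>y::'a. B * gauss y"])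
    show "integrable lborel (\<lambda>y::'a. B * gauss y)" by (intro integrable_mult_right integrable_gauss)
    show "AE y in lborel. (\<lambda>n. K (\<eta> + (1 / real (Suc n)) *\<^sub>R y) * of_real (gauss y)) \<longlonglongrightarrow> K \<eta> * of_real (gauss y)"
    proof (rule AE_I2)
      fix y :: 'a
      have "(\<lambda>n. \<eta> + (1 / real (Suc n)) *\<^sub>R y) \<longlonglongrightarrow> \<eta> + 0 *\<^sub>R y"
        by (intro tendsto_intros LIMSEQ_Suc[OF lim_1_over_n])
      moreover have "isCont K \<eta>" using cont by (simp add: continuous_on_eq_continuous_at)
      ultimately have "(\<lambda>n. K (\<eta> + (1 / real (Suc n)) *\<^sub>R y)) \<longlonglongrightarrow> K \<eta>"
        using isCont_tendsto_compose[of \<eta> K "\<lambda>n. \<eta> + (1 / real (Suc n)) *\<^sub>R y" sequentially] by simp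
      then show "(\<lambda>n. K (\<eta> + (1 / real (Suc n)) *\<^sub>R y) * of_real (gauss y)) \<longlonglongrightarrow> K \<eta> * of_real (gauss y)"
        by (intro tendsto_intros)
    qed
    have g: "gauss y \<ge> 0" for y :: 'a by (simp add: gauss_eq)
    show "AE y in lborel. norm (K (\<eta> + (1 / real (Suc n)) *\<^sub>R y) * of_real (gauss y)) \<le> B * gauss y" for n
      by (rule AE_I2) (simp add: norm_mult g B mult_right_mono)
    show "(\<lambda>y. K (\<eta> + (1 / real (Suc n)) *\<^sub>R y) * of_real (gauss y)) \<in> borel_measurable lborel" for n
      unfolding gauss_eq by measurable
    show "(\<lambda>y::'a. K \<eta> * of_real (gauss y)) \<in> borel_measurable lborel"
      unfolding gauss_eq by measurable
  qed
  then have "(\<lambda>n. of_real ((2 * pi) ^ DIM('a)) * (LINT y|lborel. K (\<eta> + (1 / real (Suc n)) *\<^sub>R y) * of_real (gauss y)))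
     \<longlonglongrightarrow> of_real ((2 * pi) ^ DIM('a)) * (LINT y::'a|lborel. K \<eta> * of_real (gauss y))"
    by (rule tendsto_mult_left)
  ultimately have "(LINT x|lborel. b x * exp (- \<i> * of_real (x \<bullet> \<eta>))) = of_real ((2 * pi) ^ DIM('a)) * (LINT y::'a|lborel. K \<eta> * of_real (gauss y))"
    using J[of "real (Suc n)" for n] by (simp add: LIMSEQ_unique)
  also have "(LINT y::'a|lborel. K \<eta> * of_real (gauss y)) = K \<eta>"
    using integral_gauss[where 'a = 'a] by simp
  finally show ?thesis .
qed

section \<open>Fourier transforms of Schwartz functions\<close>

lemma schwartz_measurable: "f \<in> schwartz_functions \<Longrightarrow> f \<in> borel_measurable borel"
  by (intro borel_measurable_continuous_onI smooth_continuous schwartz_smooth)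

lemma schwartz_power_integrable:
  fixes f :: "real ^ 'n \<Rightarrow> complex"
  assumes f: "f \<in> schwartz_functions"
  shows "integrable lborel (\<lambda>x. of_real ((1 + norm x) ^ k) * f x)"
proof (rule integrable_if_decaying)
  show "(\<lambda>x. of_real ((1 + norm x) ^ k) * f x) \<in> borel_measurable borel"
    using schwartz_measurable[OF f] by measurable
  show "(1 + norm x) ^ (2 * DIM(real^'n)) * norm (of_real ((1 + norm x) ^ k) * f x)
      \<le> schwartz_seminorm (2 * DIM(real^'n) + k) 0 f" for x
  proof -
    have "norm (complex_of_real ((1 + norm x) ^ k)) = (1 + norm x) ^ k"
      unfolding norm_of_real by simp
    then show ?thesis
      using schwartz_seminorm_ge[OF f, of "[]" 0 x "2 * DIM(real^'n) + k"]
      by (simp add: norm_mult power_add mult.assoc del: norm_of_real of_real_power)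
  qed
qed

lemma schwartz_integrable: "f \<in> schwartz_functions \<Longrightarrow> integrable lborel f"
  using schwartz_power_integrable[of f 0] by simp

lemma schwartz_power_norm_integrable:
  assumes "f \<in> schwartz_functions"
  shows "integrable lborel (\<lambda>x. (1 + norm x) ^ k * norm (f x))"
proof -
  have "norm (of_real ((1 + norm x) ^ k) * f x) = (1 + norm x) ^ k * norm (f x)" for x
    unfolding norm_mult norm_of_real by simp
  then show ?thesis using integrable_norm[OF schwartz_power_integrable[OF assms, of k]] by presburger
qed

lemma integrable_mult_wave:
  assumes "integrable lborel f"
  shows "integrable lborel (\<lambda>x. f x * wave \<xi> x)"
proof (rule Bochner_Integration.integrable_bound[OF assms])
  have "wave \<xi> \<in> borel_measurable borel"
    by (intro borel_measurable_continuous_onI smooth_continuous smooth_wave)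
  then show "(\<lambda>x. f x * wave \<xi> x) \<in> borel_measurable lborel"
    using borel_measurable_integrable[OF assms] by simp
qed (simp add: norm_mult)

lemma fourier_wave: "fourier f \<xi> = (LINT x|lborel. f x * wave (- \<xi>) x)"
  by (simp add: fourier_def wave_def)

lemma inv_fourier_eq: "inv_fourier (f :: real^'n \<Rightarrow> complex) x = fourier f (- x) / of_real ((2 * pi) ^ CARD('n))"
  by (simp add: inv_fourier_def fourier_def inner_commute)

lemma fourier_cmult: "fourier (\<lambda>x. c * f x) \<xi> = c * fourier f \<xi>"
  unfolding fourier_wave mult.assoc by (rule integral_mult_right_zero)

lemma fourier_add:
  "integrable lborel f \<Longrightarrow> integrable lborel g \<Longrightarrow> fourier (\<lambda>x. f x + g x) \<xi> = fourier f \<xi> + fourier g \<xi>"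
  unfolding fourier_wave distrib_right by (intro Bochner_Integration.integral_add integrable_mult_wave)

lemma norm_fourier_le: "norm (fourier f \<xi>) \<le> (LINT x|lborel. norm (f x))"
  unfolding fourier_wave using integral_norm_bound[of lborel "\<lambda>x. f x * wave (- \<xi>) x"] by (simp add: norm_mult)

lemma norm_cexp_remainder: "norm (exp (\<i> * of_real \<theta>) - 1 - \<i> * of_real \<theta>) \<le> \<theta>\<^sup>2 / 2"
proof -
  have "norm (exp (\<i> * of_real \<theta>) - (\<Sum>k\<le>1. (\<i> * of_real \<theta>) ^ k / fact k)) \<le> \<bar>\<theta>\<bar> ^ Suc 1 / fact (Suc 1)"
    by (rule iexp_approx1)
  then show ?thesis by (simp add: power2_eq_square algebra_simps diff_diff_eq)
qed

lemma schwartz_coord: "f \<in> schwartz_functions \<Longrightarrow> (\<lambda>x. - \<i> * of_real (x $ j) * f x) \<in> schwartz_functions"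
  using schwartz_cmult[OF schwartz_mult[OF moderate_coord[of j]], of f "- \<i>"] by (simp add: mult.assoc)

text \<open>Differentiation under the integral by a direct estimate: the second-order remainder of
  the exponential is at most \<open>(x \<bullet> h)\<^sup>2 / 2\<close>, which the decay of
  \<open>f\<close> makes integrable with total \<open>C * (norm h)\<^sup>2\<close>.\<close>

lemma fourier_has_derivative:
  fixes f :: "real ^ 'n \<Rightarrow> complex"
  assumes f: "f \<in> schwartz_functions"
  shows "(fourier f has_derivative (\<lambda>h. \<Sum>j\<in>UNIV. of_real (h $ j) * fourier (\<lambda>x. - \<i> * of_real (x $ j) * f x) \<xi>)) (at \<xi>)"
proof -
  define C where "C = (LINT x|lborel. (1 + norm x) ^ 2 * norm (f x))"
  define L where "L = (\<lambda>h::real^'n. \<Sum>j\<in>UNIV. of_real (h $ j) * fourier (\<lambda>x. - \<i> * of_real (x $ j) * f x) \<xi>)"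
  have int: "integrable lborel (\<lambda>x. (- \<i> * of_real (x $ j) * f x) * wave (- \<xi>) x)" for j
    by (intro integrable_mult_wave schwartz_integrable schwartz_coord f)
  have Lh: "L h = (LINT x|lborel. (- \<i> * of_real (x \<bullet> h) * f x) * wave (- \<xi>) x)" for h
  proof -
    have "L h = (\<Sum>j\<in>UNIV. (LINT x|lborel. of_real (h $ j) * ((- \<i> * of_real (x $ j) * f x) * wave (- \<xi>) x)))"
      unfolding L_def fourier_wave by (intro sum.cong refl integral_mult_right_zero[symmetric])
    also have "\<dots> = (LINT x|lborel. (\<Sum>j\<in>UNIV. of_real (h $ j) * ((- \<i> * of_real (x $ j) * f x) * wave (- \<xi>) x)))"
      by (rule Bochner_Integration.integral_sum[symmetric]) (intro integrable_mult_right int)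
    also have "\<dots> = (LINT x|lborel. (- \<i> * of_real (x \<bullet> h) * f x) * wave (- \<xi>) x)"
      by (intro Bochner_Integration.integral_cong refl)
         (simp add: inner_vec_def sum_distrib_left sum_distrib_right sum_negf mult_ac)
    finally show ?thesis .
  qed
  have intL: "integrable lborel (\<lambda>x. (- \<i> * of_real (x \<bullet> h) * f x) * wave (- \<xi>) x)" for h
  proof -
    have "integrable lborel (\<lambda>x. \<Sum>j\<in>UNIV. of_real (h $ j) * ((- \<i> * of_real (x $ j) * f x) * wave (- \<xi>) x))"
      by (intro Bochner_Integration.integrable_sum integrable_mult_right int)
    also have "(\<lambda>x. \<Sum>j\<in>UNIV. of_real (h $ j) * ((- \<i> * of_real (x $ j) * f x) * wave (- \<xi>) x)) = (\<lambda>x. (- \<i> * of_real (x \<bullet> h) * f x) * wave (- \<xi>) x)"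
      by (rule ext) (simp add: inner_vec_def sum_distrib_left sum_distrib_right sum_negf mult_ac)
    finally show ?thesis .
  qed
  have bound: "norm (fourier f (\<xi> + h) - fourier f \<xi> - L h) \<le> C * (norm h)\<^sup>2" for h
  proof -
    have i1: "integrable lborel (\<lambda>x. f x * wave (- \<zeta>) x)" for \<zeta>
      by (intro integrable_mult_wave schwartz_integrable f)
    have "fourier f (\<xi> + h) - fourier f \<xi> - L h
      = (LINT x|lborel. f x * wave (- (\<xi> + h)) x - f x * wave (- \<xi>) x - (- \<i> * of_real (x \<bullet> h) * f x) * wave (- \<xi>) x)"
      unfolding Lh fourier_wave
      by (simp only: Bochner_Integration.integral_diff[OF Bochner_Integration.integrable_diff[OF i1 i1] intL]
            Bochner_Integration.integral_diff[OF i1 i1])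
    also have "norm \<dots> \<le> (LINT x|lborel. (norm h)\<^sup>2 * ((1 + norm x) ^ 2 * norm (f x)))"
    proof (rule Bochner_Integration.integral_norm_bound_integral)
      show "integrable lborel (\<lambda>x. f x * wave (- (\<xi> + h)) x - f x * wave (- \<xi>) x - (- \<i> * of_real (x \<bullet> h) * f x) * wave (- \<xi>) x)"
        by (intro Bochner_Integration.integrable_diff i1 intL)
      show "integrable lborel (\<lambda>x. (norm h)\<^sup>2 * ((1 + norm x) ^ 2 * norm (f x)))"
        by (intro integrable_mult_right schwartz_power_norm_integrable f)
      fix x :: "real^'n"
      have "wave (- (\<xi> + h)) x = wave (- \<xi>) x * exp (\<i> * of_real (- (x \<bullet> h)))"
        by (simp add: wave_def inner_diff_right inner_add_right algebra_simps exp_add[symmetric] flip: exp_diff)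
      then have "f x * wave (- (\<xi> + h)) x - f x * wave (- \<xi>) x - (- \<i> * of_real (x \<bullet> h) * f x) * wave (- \<xi>) x
        = f x * wave (- \<xi>) x * (exp (\<i> * of_real (- (x \<bullet> h))) - 1 - \<i> * of_real (- (x \<bullet> h)))"
        by (simp add: algebra_simps)
      then have "norm (f x * wave (- (\<xi> + h)) x - f x * wave (- \<xi>) x - (- \<i> * of_real (x \<bullet> h) * f x) * wave (- \<xi>) x)
        = norm (f x) * norm (exp (\<i> * of_real (- (x \<bullet> h))) - 1 - \<i> * of_real (- (x \<bullet> h)))"
        by (simp only: norm_mult norm_wave mult_1_right)
      also have "\<dots> \<le> norm (f x) * ((- (x \<bullet> h))\<^sup>2 / 2)"
        by (intro mult_left_mono norm_cexp_remainder) auto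
      also have "\<dots> \<le> norm (f x) * ((1 + norm x) * norm h)\<^sup>2"
      proof (intro mult_left_mono)
        have "\<bar>x \<bullet> h\<bar> \<le> norm x * norm h" by (rule Cauchy_Schwarz_ineq2)
        also have "\<dots> \<le> (1 + norm x) * norm h" by (intro mult_right_mono) auto
        finally have "\<bar>x \<bullet> h\<bar>\<^sup>2 \<le> ((1 + norm x) * norm h)\<^sup>2" by (intro power_mono) auto
        moreover have "(x \<bullet> h)\<^sup>2 \<ge> 0" by simp
        ultimately show "(- (x \<bullet> h))\<^sup>2 / 2 \<le> ((1 + norm x) * norm h)\<^sup>2"
          unfolding power2_abs power2_minus by linarith
      qed auto
      also have "\<dots> = (norm h)\<^sup>2 * ((1 + norm x) ^ 2 * norm (f x))" by (simp add: power_mult_distrib)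
      finally show "norm (f x * wave (- (\<xi> + h)) x - f x * wave (- \<xi>) x - (- \<i> * of_real (x \<bullet> h) * f x) * wave (- \<xi>) x)
        \<le> (norm h)\<^sup>2 * ((1 + norm x) ^ 2 * norm (f x))" .
    qed
    also have "\<dots> = (norm h)\<^sup>2 * C" unfolding C_def by (rule integral_mult_right_zero)
    finally show ?thesis by (simp add: mult.commute)
  qed
  have "(fourier f has_derivative L) (at \<xi>)"
  proof (rule has_derivativeI_sandwich[of 1 _ _ _ _ "\<lambda>y. C * norm (y - \<xi>)"])
    have "linear L" unfolding L_def
      by (rule linearI) (simp_all add: algebra_simps sum.distrib sum_distrib_left scaleR_conv_of_real[where 'a = complex])
    then show "bounded_linear L" by (simp add: linear_conv_bounded_linear)
    show "norm (fourier f y - fourier f \<xi> - L (y - \<xi>)) / norm (y - \<xi>) \<le> C * norm (y - \<xi>)" if "y \<noteq> \<xi>" for y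
      using bound[of "y - \<xi>"] that by (simp add: divide_le_eq power2_eq_square mult.assoc)
    have "((\<lambda>y. C * norm (y - \<xi>)) \<longlongrightarrow> C * norm (\<xi> - \<xi>)) (at \<xi>)" by (intro tendsto_intros)
    then show "((\<lambda>y. C * norm (y - \<xi>)) \<longlongrightarrow> 0) (at \<xi>)" by simp
  qed auto
  then show ?thesis unfolding L_def .
qed

lemma partial_deriv_fourier:
  assumes f: "f \<in> schwartz_functions"
  shows "partial_deriv j (fourier f) = fourier (\<lambda>x. - \<i> * of_real (x $ j) * f x)"
proof
  fix \<xi>
  have "partial_deriv j (fourier f) \<xi> = (\<Sum>i\<in>UNIV. of_real ((axis j 1 :: real^'a) $ i) * fourier (\<lambda>x. - \<i> * of_real (x $ i) * f x) \<xi>)"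
    by (rule partial_deriv_has_derivative[OF fourier_has_derivative[OF f]])
  also have "\<dots> = (\<Sum>i\<in>UNIV. if i = j then fourier (\<lambda>x. - \<i> * of_real (x $ i) * f x) \<xi> else 0)"
    by (intro sum.cong refl) (auto simp: axis_def)
  also have "\<dots> = fourier (\<lambda>x. - \<i> * of_real (x $ j) * f x) \<xi>" by simp
  finally show "partial_deriv j (fourier f) \<xi> = fourier (\<lambda>x. - \<i> * of_real (x $ j) * f x) \<xi>" .
qed

lemma iter_partial_fourier:
  assumes f: "f \<in> schwartz_functions"
  shows "(\<lambda>x. prod_list (map (\<lambda>j. - \<i> * of_real (x $ j)) is) * f x) \<in> schwartz_functions"
    and "iter_partial is (fourier f) = fourier (\<lambda>x. prod_list (map (\<lambda>j. - \<i> * of_real (x $ j)) is) * f x)"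
proof (induction "is")
  case (Cons i "is")
  {
    case 1
    show ?case using schwartz_coord[OF Cons(1), of i] by (simp add: mult.assoc)
  next
    case 2
    show ?case using partial_deriv_fourier[OF Cons(1), of i] Cons(2) by (simp add: mult.assoc)
  }
qed (use f in auto)

lemma smooth_fourier: "f \<in> schwartz_functions \<Longrightarrow> smooth (fourier f)"
proof (rule smoothI_class[of _ "fourier ` schwartz_functions"])
  fix g :: "real^'a \<Rightarrow> complex" assume "g \<in> fourier ` schwartz_functions"
  then obtain f where f: "g = fourier f" "f \<in> schwartz_functions" by auto
  show "g differentiable_on UNIV"
    unfolding f differentiable_on_def using fourier_has_derivative[OF f(2)] differentiableI by blast
  show "partial_deriv i g \<in> fourier ` schwartz_functions" for i
    unfolding f partial_deriv_fourier[OF f(2)] using schwartz_coord[OF f(2)] by blast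
qed auto

text \<open>By translation invariance \<open>h\<close> and its translate by \<open>s\<close> have
  the same integral. So the integral of the derivative, multiplied by \<open>s\<close>, equals minus
  the integral of the Taylor remainder, which is of order \<open>s\<^sup>2\<close>; divide by
  \<open>s\<close> and let it tend to 0.\<close>

lemma integral_partial_deriv_eq_0:
  fixes h :: "real ^ 'n \<Rightarrow> complex"
  assumes h: "h \<in> schwartz_functions"
  shows "(LINT x|lborel. partial_deriv j h x) = 0"
proof -
  define e where "e = (axis j 1 :: real^'n)"
  define m where "m = 2 * DIM(real^'n)"
  define S where "S = schwartz_seminorm m 2 h"
  \<comment> \<open>Dominates the second derivative along segments of length at most 1 from
    \<open>x\<close>. The factor \<open>2 ^ m\<close> reflects that \<open>1 + norm x\<close> at
    most doubles relative to its value along the segment.\<close>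
  define B where "B = (\<lambda>x::real^'n. S * 2 ^ m / (1 + norm x) ^ m)"
  have S: "S \<ge> 0" unfolding S_def by (rule schwartz_seminorm_nonneg[OF h])
  have ne: "norm e = 1" by (simp add: e_def)
  have d2: "norm (partial_deriv j (partial_deriv j h) (x + t *\<^sub>R e)) \<le> B x" if "\<bar>t\<bar> \<le> 1" for x t
  proof -
    have "norm x \<le> norm (x + t *\<^sub>R e) + norm (t *\<^sub>R e)" by (metis add_diff_cancel norm_triangle_ineq4)
    then have "1 + norm x \<le> 2 * (1 + norm (x + t *\<^sub>R e))" using that norm_ge_zero[of "x + t *\<^sub>R e"] unfolding norm_scaleR ne by (smt (verit) mult_cancel_left2)
    then have le: "(1 + norm x) ^ m \<le> 2 ^ m * (1 + norm (x + t *\<^sub>R e)) ^ m"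
      unfolding power_mult_distrib[symmetric] by (intro power_mono) auto
    have "norm (iter_partial [j, j] h (x + t *\<^sub>R e)) \<le> S / (1 + norm (x + t *\<^sub>R e)) ^ m"
      unfolding S_def by (rule schwartz_decay[OF h]) simp
    also have "\<dots> \<le> S * (2 ^ m / (1 + norm x) ^ m)"
    proof -
      have "(1 + norm x) ^ m > 0" "(1 + norm (x + t *\<^sub>R e)) ^ m > 0" by (simp_all add: add_pos_nonneg)
      then have "1 / (1 + norm (x + t *\<^sub>R e)) ^ m \<le> 2 ^ m / (1 + norm x) ^ m"
        using le by (simp add: field_simps)
      then show ?thesis using mult_left_mono[OF _ S] by fastforce
    qed
    finally show ?thesis by (simp add: B_def)
  qed
  have B_nonneg: "B x \<ge> 0" for x using S by (simp add: B_def)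
  have dh: "((\<lambda>s. h (x + s *\<^sub>R e)) has_vector_derivative partial_deriv j h (x + s *\<^sub>R e)) (at s)" for x s
    unfolding e_def by (rule has_partial_deriv_at[OF smooth_differentiable[OF schwartz_smooth[OF h]]])
  have ddh: "((\<lambda>s. partial_deriv j h (x + s *\<^sub>R e)) has_vector_derivative partial_deriv j (partial_deriv j h) (x + s *\<^sub>R e)) (at s)" for x s
    unfolding e_def by (rule has_partial_deriv_at[OF smooth_differentiable[OF smooth_partial_deriv[OF schwartz_smooth[OF h]]]])
  have d1: "norm (partial_deriv j h (x + t *\<^sub>R e) - partial_deriv j h x) \<le> s * B x" if t: "0 \<le> t" "t \<le> s" "s \<le> 1" for x t s
  proof -
    have "norm (partial_deriv j h (x + t *\<^sub>R e) - partial_deriv j h (x + 0 *\<^sub>R e)) \<le> B x * norm (t - 0)"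
    proof (rule differentiable_bound[of "{0..s}" "\<lambda>t. partial_deriv j h (x + t *\<^sub>R e)" "\<lambda>t u. u *\<^sub>R partial_deriv j (partial_deriv j h) (x + t *\<^sub>R e)"])
      show "((\<lambda>t. partial_deriv j h (x + t *\<^sub>R e)) has_derivative (\<lambda>u. u *\<^sub>R partial_deriv j (partial_deriv j h) (x + t *\<^sub>R e))) (at t within {0..s})" for t
        using ddh[of x t] unfolding has_vector_derivative_def by (rule has_derivative_at_withinI)
      show "onorm (\<lambda>u. u *\<^sub>R partial_deriv j (partial_deriv j h) (x + t *\<^sub>R e)) \<le> B x" if "t \<in> {0..s}" for t
        using that \<open>s \<le> 1\<close> d2[of t x] by (intro onorm_le) (simp, metis abs_ge_zero mult.commute mult_left_mono)
    qed (use t in auto)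
    also have "\<dots> \<le> B x * s" using t B_nonneg by (intro mult_left_mono) auto
    finally show ?thesis by (simp add: mult.commute)
  qed
  have key: "norm (h (s *\<^sub>R e + x) - h x - s *\<^sub>R partial_deriv j h x) \<le> s * (s * B x)" if s: "0 \<le> s" "s \<le> 1" for x s
  proof -
    have "norm (h (x + s *\<^sub>R e) - h (x + 0 *\<^sub>R e) - (s - 0) *\<^sub>R partial_deriv j h (x + 0 *\<^sub>R e)) \<le> norm (s - 0) * (s * B x)"
    proof (rule vector_differentiable_bound_linearization[of "{0..s}" "\<lambda>s. h (x + s *\<^sub>R e)" "\<lambda>s. partial_deriv j h (x + s *\<^sub>R e)"])
      show "((\<lambda>s. h (x + s *\<^sub>R e)) has_vector_derivative partial_deriv j h (x + t *\<^sub>R e)) (at t within {0..s})" for t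
        using dh by (rule has_vector_derivative_at_within)
      show "closed_segment 0 s \<subseteq> {0..s}" using s by (simp add: closed_segment_eq_real_ivl)
      show "norm (partial_deriv j h (x + t *\<^sub>R e) - partial_deriv j h (x + 0 *\<^sub>R e)) \<le> s * B x" if "t \<in> {0..s}" for t
        using d1[of t s x] that s by simp
    qed (use s in auto)
    then show ?thesis using s by (simp add: add.commute)
  qed
  have intB: "integrable lborel B"
  proof -
    have "integrable lborel (\<lambda>x. complex_of_real (B x))"
    proof (rule integrable_if_decaying[of _ "S * 2 ^ m"])
      show "(\<lambda>x. complex_of_real (B x)) \<in> borel_measurable borel" unfolding B_def by measurable
      show "(1 + norm x) ^ (2 * DIM(real^'n)) * norm (complex_of_real (B x)) \<le> S * 2 ^ m" for x
      proof -
        have "1 + norm x \<noteq> 0" using norm_ge_zero[of x] by linarith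
        then have "(1 + norm x) ^ m * B x = S * 2 ^ m" by (simp add: B_def)
        then show ?thesis using B_nonneg[of x] by (simp add: m_def)
      qed
    qed
    then show ?thesis by (simp add: complex_of_real_integrable_eq)
  qed
  let ?I = "LINT x|lborel. partial_deriv j h x"
  have ih: "integrable lborel h" and idh: "integrable lborel (partial_deriv j h)"
    by (intro schwartz_integrable h schwartz_partial_deriv)+
  have le: "norm ?I \<le> (LINT x|lborel. B x) / real (Suc n)" for n
  proof -
    define s where "s = 1 / real (Suc n)"
    have s: "0 < s" "s \<le> 1" by (auto simp: s_def)
    have hm: "h \<in> borel_measurable borel" by (rule schwartz_measurable[OF h])
    have shift: "integrable lborel (\<lambda>x. h (s *\<^sub>R e + x))" "(LINT x|lborel. h (s *\<^sub>R e + x)) = (LINT x|lborel. h x)"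
      using lborel_affine_integrable[OF hm, of 1 "s *\<^sub>R e"] ih by auto
    have "(LINT x|lborel. h (s *\<^sub>R e + x) - h x - s *\<^sub>R partial_deriv j h x) = - (s *\<^sub>R ?I)"
      using shift ih idh by simp
    moreover have "norm (LINT x|lborel. h (s *\<^sub>R e + x) - h x - s *\<^sub>R partial_deriv j h x) \<le> (LINT x|lborel. s * (s * B x))"
      by (rule Bochner_Integration.integral_norm_bound_integral) (use shift ih idh intB key s in auto)
    ultimately have "s * norm ?I \<le> s * (s * (LINT x|lborel. B x))" using s by simp
    then have "norm ?I \<le> s * (LINT x|lborel. B x)" using s by simp
    then show ?thesis by (simp add: s_def)
  qed
  have "(\<lambda>n. (LINT x|lborel. B x) / real (Suc n)) \<longlonglongrightarrow> 0" by (rule LIMSEQ_Suc) (rule lim_const_over_n)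
  then have "norm ?I \<le> 0" by (rule LIMSEQ_le_const) (use le in auto)
  then show ?thesis by simp
qed

text \<open>Integration by parts: the derivative of \<open>wave (- \<xi>) * f\<close> has integral
  0.\<close>

lemma fourier_partial_deriv:
  assumes f: "f \<in> schwartz_functions"
  shows "of_real (\<xi> $ j) * fourier f \<xi> = fourier (\<lambda>x. - \<i> * partial_deriv j f x) \<xi>"
proof -
  have w: "(\<lambda>x. wave (- \<xi>) x * f x) \<in> schwartz_functions" by (rule schwartz_mult[OF moderate_wave f])
  have "partial_deriv j (wave (- \<xi>)) = (\<lambda>x. \<i> * of_real (- \<xi> $ j) * wave (- \<xi>) x)"
    using iter_partial_wave[of "[j]" "- \<xi>"] by simp
  then have pd: "partial_deriv j (\<lambda>x. wave (- \<xi>) x * f x) = (\<lambda>x. (- \<i> * of_real (\<xi> $ j)) * (f x * wave (- \<xi>) x) + partial_deriv j f x * wave (- \<xi>) x)"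
    unfolding partial_deriv_mult[OF wave_differentiable smooth_differentiable[OF schwartz_smooth[OF f]]]
    by (simp add: mult_ac)
  have "0 = (LINT x|lborel. (- \<i> * of_real (\<xi> $ j)) * (f x * wave (- \<xi>) x) + partial_deriv j f x * wave (- \<xi>) x)"
    using integral_partial_deriv_eq_0[OF w, of j] unfolding pd by simp
  also have "\<dots> = (LINT x|lborel. (- \<i> * of_real (\<xi> $ j)) * (f x * wave (- \<xi>) x)) + (LINT x|lborel. partial_deriv j f x * wave (- \<xi>) x)"
    by (intro Bochner_Integration.integral_add integrable_mult_right integrable_mult_wave schwartz_integrable schwartz_partial_deriv f)
  also have "(LINT x|lborel. (- \<i> * of_real (\<xi> $ j)) * (f x * wave (- \<xi>) x)) = (- \<i> * of_real (\<xi> $ j)) * fourier f \<xi>"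
    unfolding fourier_wave by (rule integral_mult_right_zero)
  also have "(LINT x|lborel. partial_deriv j f x * wave (- \<xi>) x) = fourier (partial_deriv j f) \<xi>"
    by (rule fourier_wave[symmetric])
  finally have "fourier (partial_deriv j f) \<xi> = \<i> * of_real (\<xi> $ j) * fourier f \<xi>" by (simp add: algebra_simps eq_neg_iff_add_eq_0)
  then show ?thesis unfolding fourier_cmult by (simp add: mult.assoc[symmetric])
qed

text \<open>Each power of the weight in \<open>\<xi>\<close> is traded for a partial derivative of
  the function before transformation, so the induction must range over all Schwartz functions.
  Derivatives in \<open>\<xi>\<close> merely multiply by polynomials.\<close>

lemma fourier_schwartz:
  fixes f :: "real ^ 'n \<Rightarrow> complex"
  assumes f: "f \<in> schwartz_functions"
  shows "fourier f \<in> schwartz_functions"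
proof (rule schwartzI[OF smooth_fourier[OF f]])
  have *: "\<exists>B. \<forall>\<xi>. (1 + norm \<xi>) ^ k * norm (fourier g \<xi>) \<le> B" if "g \<in> schwartz_functions" for k and g :: "real^'n \<Rightarrow> complex"
    using that
  proof (induction k arbitrary: g)
    case 0
    then show ?case using norm_fourier_le[of g] by auto
  next
    case (Suc k)
    obtain B where B: "\<And>\<xi>. (1 + norm \<xi>) ^ k * norm (fourier g \<xi>) \<le> B" using Suc by blast
    have "\<exists>B. \<forall>\<xi>. (1 + norm \<xi>) ^ k * norm (fourier (\<lambda>x. - \<i> * partial_deriv j g x) \<xi>) \<le> B" for j
      by (intro Suc.IH schwartz_cmult schwartz_partial_deriv Suc.prems)
    then obtain D where D: "\<And>j \<xi>. (1 + norm \<xi>) ^ k * norm (fourier (\<lambda>x. - \<i> * partial_deriv j g x) \<xi>) \<le> D j" by metis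
    have "(1 + norm \<xi>) ^ Suc k * norm (fourier g \<xi>) \<le> B + (\<Sum>j\<in>UNIV. D j)" for \<xi>
    proof -
      have "norm \<xi> * norm (fourier g \<xi>) \<le> (\<Sum>j\<in>UNIV. \<bar>\<xi> $ j\<bar>) * norm (fourier g \<xi>)"
        by (intro mult_right_mono norm_le_l1_cart) auto
      also have "\<dots> = (\<Sum>j\<in>UNIV. norm (of_real (\<xi> $ j) * fourier g \<xi>))"
        by (simp add: sum_distrib_right norm_mult)
      also have "\<dots> = (\<Sum>j\<in>UNIV. norm (fourier (\<lambda>x. - \<i> * partial_deriv j g x) \<xi>))"
        by (simp only: fourier_partial_deriv[OF Suc.prems])
      finally have "(1 + norm \<xi>) ^ k * (norm \<xi> * norm (fourier g \<xi>)) \<le> (1 + norm \<xi>) ^ k * (\<Sum>j\<in>UNIV. norm (fourier (\<lambda>x. - \<i> * partial_deriv j g x) \<xi>))"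
        by (intro mult_left_mono) auto
      also have "\<dots> \<le> (\<Sum>j\<in>UNIV. D j)" unfolding sum_distrib_left by (intro sum_mono D)
      finally show ?thesis using B[of \<xi>] by (simp add: algebra_simps)
    qed
    then show ?case by blast
  qed
  fix k and "is" :: "'n list"
  show "\<exists>B. \<forall>x. (1 + norm x) ^ k * norm (iter_partial is (fourier f) x) \<le> B"
    unfolding iter_partial_fourier(2)[OF f] by (rule *[OF iter_partial_fourier(1)[OF f]])
qed

section \<open>The inverse transform on Schwartz functions\<close>

lemma schwartz_reflect:
  fixes f :: "real ^ 'n \<Rightarrow> complex"
  assumes f: "f \<in> schwartz_functions"
  shows "(\<lambda>x. f (- x)) \<in> schwartz_functions"
proof -
  have eq: "(\<lambda>x. f (- x)) = (\<lambda>x. f ((-1) *\<^sub>R x + 0))" by simp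
  show ?thesis unfolding eq
  proof (rule schwartzI[OF smooth_affine[OF schwartz_smooth[OF f]]])
    fix k and "is" :: "'n list"
    have "(1 + norm x) ^ k * norm (iter_partial is (\<lambda>x. f ((-1) *\<^sub>R x + 0)) x) \<le> schwartz_seminorm k (length is) f" for x
      unfolding iter_partial_affine[OF schwartz_smooth[OF f]]
      using schwartz_seminorm_ge[OF f, of "is" "length is" "- x" k] by (simp add: norm_mult norm_power)
    then show "\<exists>B. \<forall>x. (1 + norm x) ^ k * norm (iter_partial is (\<lambda>x. f ((-1) *\<^sub>R x + 0)) x) \<le> B" by blast
  qed
qed

lemma inv_fourier_schwartz:
  fixes f :: "real ^ 'n \<Rightarrow> complex"
  assumes f: "f \<in> schwartz_functions"
  shows "inv_fourier f \<in> schwartz_functions"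
proof -
  have "inv_fourier f = (\<lambda>x. (1 / of_real ((2 * pi) ^ CARD('n))) * fourier f (- x))"
    by (rule ext) (simp add: inv_fourier_eq)
  then show ?thesis by (rule ssubst) (intro schwartz_cmult schwartz_reflect fourier_schwartz f)
qed

lemma schwartz_bounded: "f \<in> schwartz_functions \<Longrightarrow> norm (f x) \<le> schwartz_seminorm 0 0 f"
  using schwartz_seminorm_ge[of f "[]" 0 x 0] by simp

lemma fourier_inv_fourier:
  fixes f :: "real ^ 'n \<Rightarrow> complex"
  assumes f: "f \<in> schwartz_functions"
  shows "fourier (inv_fourier f) = f"
proof
  fix \<eta>
  let ?c = "complex_of_real ((2 * pi) ^ CARD('n))"
  have b: "(LINT \<xi>|lborel. f \<xi> * exp (\<i> * of_real (x \<bullet> \<xi>))) = ?c * inv_fourier f x" for x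
    by (simp add: inv_fourier_def)
  have "(LINT x|lborel. (LINT \<xi>|lborel. f \<xi> * exp (\<i> * of_real (x \<bullet> \<xi>))) * exp (- \<i> * of_real (x \<bullet> \<eta>)))
      = of_real ((2 * pi) ^ DIM(real^'n)) * f \<eta>"
  proof (rule fourier_inversion[OF smooth_continuous[OF schwartz_smooth[OF f]] schwartz_integrable[OF f] schwartz_bounded[OF f]])
    show "integrable lborel (\<lambda>x. LINT \<xi>|lborel. f \<xi> * exp (\<i> * of_real (x \<bullet> \<xi>)))"
      unfolding b by (intro integrable_mult_right schwartz_integrable inv_fourier_schwartz f)
  qed
  then have "fourier (\<lambda>x. ?c * inv_fourier f x) \<eta> = ?c * f \<eta>"
    unfolding b by (simp add: fourier_def)
  then show "fourier (inv_fourier f) \<eta> = f \<eta>" unfolding fourier_cmult by simp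
qed

section \<open>Compactly supported distributions\<close>

lemma test_add:
  assumes "f \<in> test_functions" "g \<in> test_functions"
  shows "(\<lambda>x. f x + g x) \<in> test_functions"
proof (rule test_functionI)
  show "smooth (\<lambda>x. f x + g x)" by (intro smooth_add test_smooth assms)
  show "compact (fun_support f \<union> fun_support g)" by (intro compact_Un test_compact assms)
  show "f x + g x = 0" if "x \<notin> fun_support f \<union> fun_support g" for x
    using that notin_fun_support[of x f] notin_fun_support[of x g] by simp
qed

lemma test_cmult: "f \<in> test_functions \<Longrightarrow> (\<lambda>x. c * f x) \<in> test_functions"
  by (rule test_mult) (auto intro: smooth_const)

lemma test_diff:
  assumes "f \<in> test_functions" "g \<in> test_functions"
  shows "(\<lambda>x. f x - g x) \<in> test_functions"
  using test_add[OF assms(1) test_cmult[OF assms(2), of "-1"]] by simp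

text \<open>Agreement on an open neighbourhood of the support, not on the support alone, confines
  the support of the difference to the closed set \<open>- U\<close>.\<close>

lemma eq_if_agree_near_support:
  assumes u: "linear_functional_on test_functions u"
    and U: "open U" "distr_support u \<subseteq> U"
    and f: "f \<in> test_functions" and g: "g \<in> test_functions" and eq: "\<And>x. x \<in> U \<Longrightarrow> f x = g x"
  shows "u f = u g"
proof -
  have "fun_support (\<lambda>x. f x - g x) \<subseteq> - U"
    by (rule fun_support_subset) (use U eq in auto)
  then have "u (\<lambda>x. f x - g x) = 0"
    by (intro vanishes_off_support[OF u test_diff[OF f g]]) (use U in blast)
  then show ?thesis using linear_functional_diff[OF u f g] by simp
qed

lemma linear_functional_comb:
  assumes "linear_functional_on S u" "f \<in> S" "g \<in> S"
  shows "u (\<lambda>x. a * f x + b * g x) = a * u f + b * u g"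
  using assms unfolding linear_functional_on_def by blast

lemma linear_functional_sum:
  fixes u :: "(real ^ 'n \<Rightarrow> complex) \<Rightarrow> complex" and z :: "real ^ 'n \<Rightarrow> complex"
  assumes u: "linear_functional_on test_functions u" and fin: "finite F" and z: "z \<in> test_functions"
    and h: "\<And>c. c \<in> F \<Longrightarrow> h c \<in> test_functions"
  shows "(\<lambda>x. \<Sum>c\<in>F. a c * h c x) \<in> test_functions \<and> u (\<lambda>x. \<Sum>c\<in>F. a c * h c x) = (\<Sum>c\<in>F. a c * u (h c))"
  using fin h
proof (induction F rule: finite_induct)
  case empty
  then show ?case using linear_functional_zero[OF u z] test_cmult[OF z, of 0] by simp
next
  case (insert c F)
  have hc: "h c \<in> test_functions" and IH: "(\<lambda>x. \<Sum>c\<in>F. a c * h c x) \<in> test_functions"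
    "u (\<lambda>x. \<Sum>c\<in>F. a c * h c x) = (\<Sum>c\<in>F. a c * u (h c))" using insert by auto
  have "u (\<lambda>x. a c * h c x + 1 * (\<Sum>c\<in>F. a c * h c x)) = a c * u (h c) + 1 * u (\<lambda>x. \<Sum>c\<in>F. a c * h c x)"
    by (rule linear_functional_comb[OF u hc IH(1)])
  moreover have "(\<lambda>x. a c * h c x + (\<Sum>c\<in>F. a c * h c x)) \<in> test_functions"
    by (intro test_add test_cmult hc IH)
  ultimately show ?case using insert IH by simp
qed

lemma iter_partial_sum:
  assumes fin: "finite F" and h: "\<And>c. c \<in> F \<Longrightarrow> smooth (h c)"
  shows "smooth (\<lambda>x. \<Sum>c\<in>F. a c * h c x) \<and> iter_partial is (\<lambda>x. \<Sum>c\<in>F. a c * h c x) = (\<lambda>x. \<Sum>c\<in>F. a c * iter_partial is (h c) x)"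
  using fin h
proof (induction F rule: finite_induct)
  case empty
  have "iter_partial is (\<lambda>x::real^'b. 0) = (\<lambda>x. 0)"
    using iter_partial_zero_on_open[of UNIV "\<lambda>x. 0" _ "is"] by auto
  then show ?case using smooth_const[of 0] by simp
next
  case (insert c F)
  have hc: "smooth (\<lambda>x. a c * h c x)" and hF: "smooth (\<lambda>x. \<Sum>c\<in>F. a c * h c x)"
    using insert by (auto intro: smooth_mult smooth_const)
  show ?case using insert iter_partial_add[OF hc hF, of "is"] iter_partial_cmult[of "h c" "is" "a c"] smooth_add[OF hc hF]
    by simp
qed

lemma cutoff_real: "\<exists>\<beta>\<ge>0. ball_cutoff p r x = complex_of_real \<beta>"
proof -
  have "flat 1 s \<ge> 0" for s by (simp add: flat_def)
  then have "\<exists>\<beta>\<ge>0. cutoff y = complex_of_real \<beta>" for y :: "real^'a"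
    unfolding cutoff_def
    by (intro exI[of _ "flat 1 (- 1 * (y \<bullet> y) + 4) / (flat 1 (- 1 * (y \<bullet> y) + 4) + flat 1 (1 * (y \<bullet> y) + - 1))"]) simp
  then show ?thesis by (simp add: ball_cutoff_def)
qed

text \<open>Multiplication by the conjugate of the difference \<open>d\<close> at \<open>p\<close>
  makes the real part of the difference positive near \<open>p\<close>, and a nonnegative bump there
  has a strictly positive pairing. This uniqueness pins down \<open>density_of\<close>.\<close>

lemma continuous_eq_if_pairings_eq:
  fixes g1 g2 :: "real ^ 'n \<Rightarrow> complex"
  assumes cont: "continuous_on UNIV g1" "continuous_on UNIV g2"
    and int: "\<And>f. f \<in> test_functions \<Longrightarrow> integrable lborel (\<lambda>x. g1 x * f x)"
      "\<And>f. f \<in> test_functions \<Longrightarrow> integrable lborel (\<lambda>x. g2 x * f x)"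
    and eq: "\<And>f. f \<in> test_functions \<Longrightarrow> (LINT x|lborel. g1 x * f x) = (LINT x|lborel. g2 x * f x)"
  shows "g1 = g2"
proof (rule ccontr)
  assume "g1 \<noteq> g2"
  then obtain p where p: "g1 p \<noteq> g2 p" by auto
  define d where "d = g1 p - g2 p"
  define q where "q = (\<lambda>x. Re (cnj d * (g1 x - g2 x)))"
  have d: "d \<noteq> 0" using p by (simp add: d_def)
  have qp: "q p = (norm d)\<^sup>2"
    unfolding q_def d_def[symmetric] using complex_norm_square[of d] by (metis Re_complex_of_real mult.commute)
  have "continuous_on UNIV q" unfolding q_def by (intro continuous_intros cont)
  then have "isCont q p" by (meson UNIV_I continuous_on_eq_continuous_at open_UNIV)
  moreover have pos: "(norm d)\<^sup>2 / 2 > 0" using d by simp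
  ultimately obtain e where e: "e > 0" "\<And>x. dist x p < e \<Longrightarrow> dist (q x) (q p) < (norm d)\<^sup>2 / 2"
    unfolding continuous_at_eps_delta by blast
  \<comment> \<open>Half of \<open>e\<close>, since the bump with plateau of radius \<open>r\<close>
    extends to radius \<open>2 * r\<close>.\<close>
  define r where "r = e / 2"
  have r: "r > 0" using e by (simp add: r_def)
  have qge: "q x \<ge> (norm d)\<^sup>2 / 2" if "dist p x < 2 * r" for x
  proof -
    have "dist (q x) (q p) < (norm d)\<^sup>2 / 2" using e(2)[of x] that by (simp add: r_def dist_commute)
    then have "\<bar>q x - (norm d)\<^sup>2\<bar> < (norm d)\<^sup>2 / 2" unfolding dist_real_def qp .
    then show ?thesis by linarith
  qed
  define f where "f = (\<lambda>x. cnj d * ball_cutoff p r x)"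
  have f: "f \<in> test_functions" unfolding f_def by (intro test_cmult test_ball_cutoff r)
  have i: "integrable lborel (\<lambda>x. g1 x * f x - g2 x * f x)" by (intro Bochner_Integration.integrable_diff int f)
  have "(LINT x|lborel. g1 x * f x - g2 x * f x) = 0"
    using eq[OF f] int[OF f] by simp
  then have z: "(LINT x|lborel. Re (g1 x * f x - g2 x * f x)) = 0"
    using integral_Re[OF i] by simp
  have ptw: "(norm d)\<^sup>2 / 2 * indicator (ball p r) x \<le> Re (g1 x * f x - g2 x * f x)" for x
  proof -
    obtain \<beta> where \<beta>: "\<beta> \<ge> 0" "ball_cutoff p r x = complex_of_real \<beta>" using cutoff_real by blast
    have "g1 x * f x - g2 x * f x = (cnj d * (g1 x - g2 x)) * of_real \<beta>"
      by (simp add: f_def \<beta> algebra_simps)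
    then have re: "Re (g1 x * f x - g2 x * f x) = q x * \<beta>" by (simp add: q_def)
    consider "dist p x < r" | "r \<le> dist p x" "dist p x < 2 * r" | "dist p x \<ge> 2 * r" by linarith
    then show ?thesis
    proof cases
      case 1
      then have "complex_of_real \<beta> = 1" using \<beta> ball_cutoff_eq(1)[OF r, of p x] by simp
      then have "\<beta> = 1" by simp
      then show ?thesis using re qge[of x] 1 r by simp
    next
      case 2
      then have "q x \<ge> 0" using qge[of x] pos by linarith
      then have "q x * \<beta> \<ge> 0" using \<beta>(1) by (rule mult_nonneg_nonneg)
      then show ?thesis unfolding re using 2 by simp
    next
      case 3
      then have "\<beta> = 0" using \<beta> ball_cutoff_eq(2)[OF r, of p x] by simp
      then show ?thesis using re 3 r by simp
    qed
  qed
  have "(LINT x|lborel. (norm d)\<^sup>2 / 2 * indicator (ball p r) x) \<le> (LINT x|lborel. Re (g1 x * f x - g2 x * f x))"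
  proof (rule integral_mono)
    show "integrable lborel (\<lambda>x. (norm d)\<^sup>2 / 2 * indicator (ball p r) x)"
      by (intro integrable_mult_right integrable_real_indicator) (use emeasure_bounded_finite[OF bounded_ball[of p r]] in auto)
    show "integrable lborel (\<lambda>x. Re (g1 x * f x - g2 x * f x))" using i by (rule integrable_Re)
  qed (rule ptw)
  moreover have "(LINT x|lborel. (norm d)\<^sup>2 / 2 * indicator (ball p r) x) = (norm d)\<^sup>2 / 2 * measure lborel (ball p r)"
    by simp
  moreover have "measure lborel (ball p r) > 0" using content_ball_pos[OF r, of p] by simp
  ultimately show False using z pos mult_pos_pos[OF pos] by (smt (verit))
qed

text \<open>What compact support adds: after multiplication by a cutoff equal to 1 near the support,
  every smooth function can be paired with \<open>\<phi>\<close>, plane waves in particular.\<close>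

locale compactly_supported =
  fixes \<phi> :: "(real ^ 'n \<Rightarrow> complex) \<Rightarrow> complex"
  assumes \<phi>: "\<phi> \<in> compactly_supported_distributions"
begin

lemma linear: "linear_functional_on test_functions \<phi>"
  using \<phi> by (simp add: compactly_supported_distributions_def distribution_def)

text \<open>The lower bound 1 places the cutoff among those whose derivatives are bounded uniformly
  in the radius.\<close>

definition radius :: real where
  "radius = (SOME R. R \<ge> 1 \<and> distr_support \<phi> \<subseteq> ball 0 R)"

lemma radius: "radius \<ge> 1" "distr_support \<phi> \<subseteq> ball 0 radius"
proof -
  have "compact (distr_support \<phi>)" using \<phi> by (simp add: compactly_supported_distributions_def)
  then obtain R where R: "distr_support \<phi> \<subseteq> ball 0 R"
    using bounded_subset_ballD[OF compact_imp_bounded] by metis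
  have "ball 0 R \<subseteq> ball (0::real^'n) (max 1 R)" by auto
  then have "max 1 R \<ge> 1 \<and> distr_support \<phi> \<subseteq> ball 0 (max 1 R)" using R by auto
  then have "radius \<ge> 1 \<and> distr_support \<phi> \<subseteq> ball 0 radius" unfolding radius_def by (rule someI)
  then show "radius \<ge> 1" "distr_support \<phi> \<subseteq> ball 0 radius" by auto
qed

abbreviation \<theta> :: "real ^ 'n \<Rightarrow> complex" where "\<theta> \<equiv> ball_cutoff 0 radius"

lemma \<theta>_mult_test: "smooth f \<Longrightarrow> (\<lambda>x. \<theta> x * f x) \<in> test_functions"
  using test_mult[OF test_ball_cutoff[of radius 0], of f] radius(1) by (simp add: mult.commute)

lemma localize:
  assumes "f \<in> test_functions" "smooth g" "\<And>x. norm x < radius \<Longrightarrow> f x = g x"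
  shows "\<phi> f = \<phi> (\<lambda>x. \<theta> x * g x)"
proof (rule eq_if_agree_near_support[OF linear open_ball radius(2) assms(1) \<theta>_mult_test[OF assms(2)]])
  fix x :: "real^'n" assume "x \<in> ball 0 radius"
  then show "f x = \<theta> x * g x" using assms(3)[of x] ball_cutoff_eq(1)[of radius 0 x] radius(1) by simp
qed

text \<open>Only derivatives up to a fixed order on the ball carrying \<open>\<theta>\<close> enter.
  The form suits functions without compact support and with explicit derivatives, such as plane
  waves and their finite combinations.\<close>

lemma continuity:
  obtains C N where "C \<ge> 0" "\<And>f M. smooth f \<Longrightarrow>
    (\<And>is x. length is \<le> N \<Longrightarrow> norm x \<le> 2 * radius \<Longrightarrow> norm (iter_partial is f x) \<le> M) \<Longrightarrow>
    norm (\<phi> (\<lambda>x. \<theta> x * f x)) \<le> C * M"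
proof -
  let ?K = "cball (0::real^'n) (2 * radius)"
  obtain C N where CN: "\<And>f. f \<in> test_functions \<Longrightarrow> fun_support f \<subseteq> ?K \<Longrightarrow> norm (\<phi> f) \<le> C * schwartz_seminorm 0 N f"
  proof -
    have "\<forall>K. compact K \<longrightarrow> (\<exists>C N. \<forall>f\<in>test_functions. fun_support f \<subseteq> K \<longrightarrow> norm (\<phi> f) \<le> C * schwartz_seminorm 0 N f)"
      using \<phi> by (simp add: compactly_supported_distributions_def distribution_def)
    from this[rule_format, OF compact_cball[of 0 "2 * radius"]] show thesis using that by blast
  qed
  obtain D where D: "\<And>is r x. length is \<le> N \<Longrightarrow> r \<ge> 1 \<Longrightarrow> norm (iter_partial is (ball_cutoff (0::real^'n) r) x) \<le> D"
    by (rule ball_cutoff_derivatives_bounded[of N]) blast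
  have D0: "D \<ge> 0" using order_trans[OF norm_ge_zero D[of "[]" 1 0]] by simp
  show thesis
  proof (rule that[of "\<bar>C\<bar> * (2 ^ N * D)" N])
    show "0 \<le> \<bar>C\<bar> * (2 ^ N * D)" using D0 by simp
    fix f :: "real^'n \<Rightarrow> complex" and M
    assume f: "smooth f" and M: "\<And>is x. length is \<le> N \<Longrightarrow> norm x \<le> 2 * radius \<Longrightarrow> norm (iter_partial is f x) \<le> M"
    have M0: "M \<ge> 0" using order_trans[OF norm_ge_zero M[of "[]" 0]] radius(1) by simp
    have t: "(\<lambda>x. \<theta> x * f x) \<in> test_functions" by (rule \<theta>_mult_test[OF f])
    have supp: "fun_support (\<lambda>x. \<theta> x * f x) \<subseteq> ?K"
    proof (rule fun_support_subset)
      fix x assume "x \<notin> ?K"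
      then show "\<theta> x * f x = 0" using ball_cutoff_eq(2)[of radius 0 x] radius(1) by simp
    qed simp
    have "schwartz_seminorm 0 N (\<lambda>x. \<theta> x * f x) \<le> 2 ^ N * (D * M)"
    proof (rule schwartz_seminorm_le)
      fix "is" :: "'n list" and x :: "real^'n" assume l: "length is \<le> N"
      have "norm (iter_partial is (\<lambda>x. \<theta> x * f x) x) \<le> 2 ^ N * (D * M)"
      proof (cases "x \<in> ?K")
        case True
        have "norm (iter_partial is (\<lambda>x. \<theta> x * f x) x) \<le> 2 ^ length is * (D * M)"
        proof (rule iter_partial_mult_bound[OF smooth_ball_cutoff f])
          fix js :: "'n list" assume "length js \<le> length is"
          then have js: "length js \<le> N" using l by simp
          show "norm (iter_partial js \<theta> x) \<le> D" by (rule D[OF js radius(1)])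
          show "norm (iter_partial js f x) \<le> M" by (rule M[OF js]) (use True in simp)
        qed
        also have "\<dots> \<le> 2 ^ N * (D * M)" using l D0 M0 by (intro mult_right_mono power_increasing) auto
        finally show ?thesis .
      next
        case False
        then have "iter_partial is (\<lambda>x. \<theta> x * f x) x = 0"
          using supp by (intro iter_partial_outside_support) blast
        then show ?thesis using D0 M0 by simp
      qed
      then show "(1 + norm x) ^ 0 * norm (iter_partial is (\<lambda>x. \<theta> x * f x) x) \<le> 2 ^ N * (D * M)" by simp
    qed
    then have "\<bar>C\<bar> * schwartz_seminorm 0 N (\<lambda>x. \<theta> x * f x) \<le> \<bar>C\<bar> * (2 ^ N * (D * M))"
      by (intro mult_left_mono) auto
    moreover have "C * schwartz_seminorm 0 N (\<lambda>x. \<theta> x * f x) \<le> \<bar>C\<bar> * schwartz_seminorm 0 N (\<lambda>x. \<theta> x * f x)"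
      by (intro mult_right_mono schwartz_seminorm_nonneg test_subset_schwartz t) auto
    ultimately show "norm (\<phi> (\<lambda>x. \<theta> x * f x)) \<le> \<bar>C\<bar> * (2 ^ N * D) * M"
      using CN[OF t supp] by (simp add: mult.assoc)
  qed
qed

lemma cutoff_linear:
  assumes "smooth f" "smooth g"
  shows "\<phi> (\<lambda>x. \<theta> x * (a * f x + b * g x)) = a * \<phi> (\<lambda>x. \<theta> x * f x) + b * \<phi> (\<lambda>x. \<theta> x * g x)"
proof -
  have "\<phi> (\<lambda>x. a * (\<theta> x * f x) + b * (\<theta> x * g x)) = a * \<phi> (\<lambda>x. \<theta> x * f x) + b * \<phi> (\<lambda>x. \<theta> x * g x)"
    by (rule linear_functional_comb[OF linear \<theta>_mult_test[OF assms(1)] \<theta>_mult_test[OF assms(2)]])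
  moreover have "(\<lambda>x. a * (\<theta> x * f x) + b * (\<theta> x * g x)) = (\<lambda>x. \<theta> x * (a * f x + b * g x))"
    by (simp add: fun_eq_iff algebra_simps)
  ultimately show ?thesis by simp
qed

lemma cutoff_diff:
  assumes "smooth f" "smooth g"
  shows "\<phi> (\<lambda>x. \<theta> x * (f x - g x)) = \<phi> (\<lambda>x. \<theta> x * f x) - \<phi> (\<lambda>x. \<theta> x * g x)"
  using cutoff_linear[OF assms, of 1 "-1"] by simp

text \<open>Pairing after multiplication by \<open>\<theta>\<close> is one tempered extension, so
  the choice in the definition has a candidate.\<close>

lemma tempered_extension:
  "tempered_distribution (tempered_extension \<phi>)" "\<And>f. f \<in> test_functions \<Longrightarrow> tempered_extension \<phi> f = \<phi> f"
proof -
  define T where "T = (\<lambda>f. \<phi> (\<lambda>x. \<theta> x * f x))"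
  obtain C N where C: "C \<ge> 0" and CN: "\<And>f M. smooth f \<Longrightarrow>
    (\<And>is x. length is \<le> N \<Longrightarrow> norm x \<le> 2 * radius \<Longrightarrow> norm (iter_partial is f x) \<le> M) \<Longrightarrow>
    norm (\<phi> (\<lambda>x. \<theta> x * f x)) \<le> C * M" by (rule continuity) blast
  have "norm (T f) \<le> C * schwartz_seminorm N N f" if f: "f \<in> schwartz_functions" for f
    unfolding T_def
  proof (rule CN[OF schwartz_smooth[OF f]])
    fix "is" :: "'n list" and x :: "real^'n" assume "length is \<le> N"
    from schwartz_seminorm_ge[OF f this, of x N]
    have "(1 + norm x) ^ N * norm (iter_partial is f x) \<le> schwartz_seminorm N N f" .
    moreover have "1 * norm (iter_partial is f x) \<le> (1 + norm x) ^ N * norm (iter_partial is f x)"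
      by (intro mult_right_mono one_le_power) auto
    ultimately show "norm (iter_partial is f x) \<le> schwartz_seminorm N N f" by simp
  qed
  then have "tempered_distribution T"
    unfolding tempered_distribution_def linear_functional_on_def
    using cutoff_linear[OF schwartz_smooth schwartz_smooth] by (auto simp: T_def)
  moreover have "T f = \<phi> f" if "f \<in> test_functions" for f
    unfolding T_def by (rule localize[OF that test_smooth[OF that], symmetric]) simp
  ultimately have "tempered_distribution T \<and> (\<forall>f\<in>test_functions. T f = \<phi> f)" by blast
  then have "tempered_distribution (tempered_extension \<phi>) \<and> (\<forall>f\<in>test_functions. tempered_extension \<phi> f = \<phi> f)"
    unfolding tempered_extension_def
    by (rule someI[of "\<lambda>v. tempered_distribution v \<and> (\<forall>f\<in>test_functions. v f = \<phi> f)"])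
  then show "tempered_distribution (tempered_extension \<phi>)" "\<And>f. f \<in> test_functions \<Longrightarrow> tempered_extension \<phi> f = \<phi> f"
    by auto
qed

text \<open>The chosen extension may be any one, so it is determined by density: truncations of
  \<open>h\<close> are test functions and converge to \<open>h\<close> in the seminorm that controls
  the extension.\<close>

lemma tempered_extension_eq:
  assumes h: "h \<in> schwartz_functions"
  shows "tempered_extension \<phi> h = \<phi> (\<lambda>x. \<theta> x * h x)"
proof -
  define v where "v = tempered_extension \<phi>"
  have lin: "linear_functional_on schwartz_functions v"
    using tempered_extension(1) by (simp add: v_def tempered_distribution_def)
  obtain C N where CN: "\<And>f. f \<in> schwartz_functions \<Longrightarrow> norm (v f) \<le> C * schwartz_seminorm N N f"
    using tempered_extension(1) unfolding v_def tempered_distribution_def by blast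
  define a where "a = (\<lambda>n. schwartz_seminorm N N (\<lambda>x. (1 - ball_cutoff 0 (real (Suc n)) x) * h x))"
  have a: "a \<longlonglongrightarrow> 0" unfolding a_def by (rule schwartz_approximation[OF h])
  \<comment> \<open>For such \<open>n\<close> the truncation equals \<open>h\<close> on the ball
    containing the support, where \<open>\<theta>\<close> is 1 as well.\<close>
  have "norm (v h - \<phi> (\<lambda>x. \<theta> x * h x)) \<le> C * a n" if n: "real (Suc n) \<ge> radius" for n
  proof -
    let ?c = "ball_cutoff (0::real^'n) (real (Suc n))"
    have t: "(\<lambda>x. ?c x * h x) \<in> test_functions"
      using test_mult[OF test_ball_cutoff[of "real (Suc n)" 0] schwartz_smooth[OF h]] by (simp add: mult.commute)
    have "\<phi> (\<lambda>x. ?c x * h x) = \<phi> (\<lambda>x. \<theta> x * h x)"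
      by (rule localize[OF t schwartz_smooth[OF h]]) (use n ball_cutoff_eq(1)[of "real (Suc n)" "0::real^'n"] in auto)
    then have "v (\<lambda>x. ?c x * h x) = \<phi> (\<lambda>x. \<theta> x * h x)"
      using tempered_extension(2)[OF t] by (simp add: v_def)
    then have "v h - \<phi> (\<lambda>x. \<theta> x * h x) = v (\<lambda>x. h x - ?c x * h x)"
      using linear_functional_diff[OF lin h test_subset_schwartz[OF t]] by simp
    also have "(\<lambda>x. h x - ?c x * h x) = (\<lambda>x. (1 - ?c x) * h x)" by (simp add: left_diff_distrib)
    finally have "v h - \<phi> (\<lambda>x. \<theta> x * h x) = v (\<lambda>x. (1 - ?c x) * h x)" .
    moreover have "(\<lambda>x. (1 - ?c x) * h x) \<in> schwartz_functions"
      using schwartz_diff[OF h test_subset_schwartz[OF t]] by (simp add: left_diff_distrib)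
    ultimately show ?thesis using CN by (simp add: a_def)
  qed
  moreover have "eventually (\<lambda>n. real (Suc n) \<ge> radius) sequentially"
  proof -
    obtain m :: nat where "radius \<le> real m" using real_arch_simple by blast
    then have "\<forall>n\<ge>m. real (Suc n) \<ge> radius" by auto
    then show ?thesis unfolding eventually_sequentially by blast
  qed
  ultimately have "eventually (\<lambda>n. norm (v h - \<phi> (\<lambda>x. \<theta> x * h x)) \<le> C * a n) sequentially"
    by (auto elim: eventually_mono)
  moreover have "(\<lambda>n. C * a n) \<longlonglongrightarrow> C * 0" by (intro tendsto_intros a)
  ultimately have "norm (v h - \<phi> (\<lambda>x. \<theta> x * h x)) \<le> C * 0"
    by (intro tendsto_lowerbound[of "\<lambda>n. C * a n"]) auto
  then show ?thesis by (simp add: v_def)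
qed

end

section \<open>Fourier transforms of compactly supported distributions\<close>

lemma iter_partial_diff:
  assumes "smooth f" "smooth g"
  shows "iter_partial is (\<lambda>x. f x - g x) = (\<lambda>x. iter_partial is f x - iter_partial is g x)"
  using iter_partial_add[OF assms(1) smooth_mult[OF smooth_const assms(2)], of "is" "-1"] iter_partial_cmult[OF assms(2), of "is" "-1"]
  by simp

text \<open>The factor that differentiation along \<open>is\<close> brings down from
  \<open>wave (- \<xi>)\<close>.\<close>

abbreviation wave_factor :: "'n list \<Rightarrow> real ^ 'n \<Rightarrow> complex" where
  "wave_factor is \<xi> \<equiv> prod_list (map (\<lambda>j. \<i> * of_real ((- \<xi>) $ j)) is)"

lemma continuous_wave_factor: "continuous_on UNIV (wave_factor is)"
  by (induction "is") (auto intro!: continuous_intros)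

lemma norm_wave_factor_le: "norm (wave_factor is \<xi>) \<le> (1 + norm \<xi>) ^ length is"
proof (induction "is")
  case (Cons i "is")
  have "\<bar>\<xi> $ i\<bar> \<le> 1 + norm \<xi>" using component_le_norm_cart[of \<xi> i] by simp
  then have "\<bar>\<xi> $ i\<bar> * norm (wave_factor is \<xi>) \<le> (1 + norm \<xi>) * (1 + norm \<xi>) ^ length is"
    using Cons by (intro mult_mono) auto
  then show ?case by (simp add: norm_mult)
qed simp

lemma wave_swap: "wave (- x) \<xi> = wave (- \<xi>) x"
  by (simp add: wave_def inner_commute)

text \<open>A chord of the unit circle is no longer than its arc.\<close>

lemma norm_wave_diff: "norm (wave (- \<xi>) x - wave (- \<eta>) x) \<le> norm (\<xi> - \<eta>) * norm x"
proof -
  have "norm (wave (- \<xi>) x - wave (- \<eta>) x) = norm (exp (\<i> * of_real (x \<bullet> (- \<xi>))) - exp (\<i> * of_real (x \<bullet> (- \<eta>))))"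
    by (simp add: wave_def)
  also have "\<dots> \<le> \<bar>x \<bullet> (- \<xi>) - x \<bullet> (- \<eta>)\<bar>"
  proof -
    have "norm (exp (\<i> * complex_of_real a) - exp (\<i> * complex_of_real b)) \<le> \<bar>a - b\<bar>" for a b
    proof -
      have "exp (\<i> * complex_of_real a) = exp (\<i> * complex_of_real b) * exp (\<i> * complex_of_real (a - b))"
        by (simp add: algebra_simps flip: exp_add)
      then have "exp (\<i> * complex_of_real a) - exp (\<i> * complex_of_real b) = exp (\<i> * complex_of_real b) * (exp (\<i> * complex_of_real (a - b)) - 1)"
        by (simp only: right_diff_distrib mult_1_right)
      then have "norm (exp (\<i> * complex_of_real a) - exp (\<i> * complex_of_real b)) = norm (exp (\<i> * complex_of_real (a - b)) - 1)"
        by (simp only: norm_mult norm_exp_i_times mult_1_left)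
      also have "\<dots> \<le> \<bar>a - b\<bar>" using iexp_approx1[of "a - b" 0] by simp
      finally show ?thesis .
    qed
    then show ?thesis .
  qed
  also have "\<dots> = \<bar>x \<bullet> (\<xi> - \<eta>)\<bar>" by (simp add: inner_diff_right)
  also have "\<dots> \<le> norm x * norm (\<xi> - \<eta>)" by (rule Cauchy_Schwarz_ineq2)
  finally show ?thesis by (simp add: mult.commute)
qed

lemma moderate_growth_schwartz_integrable:
  fixes f :: "real ^ 'n \<Rightarrow> complex"
  assumes g: "continuous_on UNIV g" "\<And>\<xi>. norm (g \<xi>) \<le> C * (1 + norm \<xi>) ^ N" and f: "f \<in> schwartz_functions"
  shows "integrable lborel (\<lambda>\<xi>. g \<xi> * f \<xi>)"
proof (rule Bochner_Integration.integrable_bound[of _ "\<lambda>\<xi>. C * ((1 + norm \<xi>) ^ N * norm (f \<xi>))"])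
  show "integrable lborel (\<lambda>\<xi>. C * ((1 + norm \<xi>) ^ N * norm (f \<xi>)))"
    by (intro integrable_mult_right schwartz_power_norm_integrable f)
  show "(\<lambda>\<xi>. g \<xi> * f \<xi>) \<in> borel_measurable lborel"
    using borel_measurable_continuous_onI[OF g(1)] schwartz_measurable[OF f] by simp
  have "norm (g \<xi> * f \<xi>) \<le> C * ((1 + norm \<xi>) ^ N * norm (f \<xi>))" for \<xi>
    using mult_right_mono[OF g(2)[of \<xi>] norm_ge_zero[of "f \<xi>"]] by (simp add: norm_mult mult.assoc)
  then show "AE \<xi> in lborel. norm (g \<xi> * f \<xi>) \<le> norm (C * ((1 + norm \<xi>) ^ N * norm (f \<xi>)))"
    by (intro AE_I2) (smt (verit) real_norm_def)
qed

text \<open>As \<open>s\<close> takes finitely many values, the integral is a finite combination of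
  the \<open>\<Psi> c\<close>. A linear functional can be applied to this without exchanging it with
  an integral.\<close>

lemma integral_simple_function_argument:
  fixes f :: "real ^ 'n \<Rightarrow> complex" and \<Psi> :: "real ^ 'n \<Rightarrow> complex"
  assumes s: "simple_function lborel s" and f: "integrable lborel f"
  shows "(LINT \<xi>|lborel. f \<xi> * \<Psi> (s \<xi>)) = (\<Sum>c\<in>range s. (LINT \<xi>|lborel. f \<xi> * indicator (s -` {c}) \<xi>) * \<Psi> c)"
    and "integrable lborel (\<lambda>\<xi>. f \<xi> * \<Psi> (s \<xi>))"
proof -
  have fin: "finite (range s)" using s by (simp add: simple_function_def)
  have meas: "s -` {c} \<in> sets lborel" for c
  proof (cases "c \<in> range s")
    case True
    then obtain x where "c = s x" by blast
    then show ?thesis using s by (simp add: simple_function_def)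
  next
    case False
    then have "s -` {c} = {}" by auto
    then show ?thesis by simp
  qed
  have eq: "f \<xi> * \<Psi> (s \<xi>) = (\<Sum>c\<in>range s. (f \<xi> * indicator (s -` {c}) \<xi>) * \<Psi> c)" for \<xi>
  proof -
    have "(\<Sum>c\<in>range s. (f \<xi> * indicator (s -` {c}) \<xi>) * \<Psi> c) = (\<Sum>c\<in>range s. if c = s \<xi> then f \<xi> * \<Psi> c else 0)"
      by (intro sum.cong refl) (auto simp: indicator_def)
    then show ?thesis using fin by simp
  qed
  have i: "integrable lborel (\<lambda>\<xi>. f \<xi> * indicator (s -` {c}) \<xi>)" for c
  proof -
    have "(\<lambda>\<xi>. f \<xi> * indicator (s -` {c}) \<xi>) = (\<lambda>\<xi>. indicator (s -` {c}) \<xi> *\<^sub>R f \<xi>)"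
      by (auto simp: indicator_def)
    then show ?thesis using integrable_mult_indicator[OF meas f, of c] by simp
  qed
  show "integrable lborel (\<lambda>\<xi>. f \<xi> * \<Psi> (s \<xi>))" unfolding eq
    by (intro Bochner_Integration.integrable_sum integrable_mult_left i)
  show "(LINT \<xi>|lborel. f \<xi> * \<Psi> (s \<xi>)) = (\<Sum>c\<in>range s. (LINT \<xi>|lborel. f \<xi> * indicator (s -` {c}) \<xi>) * \<Psi> c)"
    unfolding eq by (subst Bochner_Integration.integral_sum) (auto intro: i)
qed

context compactly_supported
begin

text \<open>The classical formula for the transform of \<open>\<phi>\<close>: its value on a plane
  wave, cut off away from the support.\<close>

definition fourier_density :: "real ^ 'n \<Rightarrow> complex" where
  "fourier_density \<xi> = \<phi> (\<lambda>x. \<theta> x * wave (- \<xi>) x)"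

text \<open>A modulus of continuity for \<open>wave (- \<xi>)\<close> as a function of
  \<open>\<xi>\<close>, measured by the derivatives up to order \<open>N\<close> on the ball of
  radius \<open>2 * radius\<close>.\<close>

definition modulus :: "nat \<Rightarrow> real ^ 'n \<Rightarrow> real ^ 'n \<Rightarrow> real" where
  "modulus N \<xi> \<eta> = (\<Sum>is\<in>{is. length is \<le> N}. norm (wave_factor is \<xi> - wave_factor is \<eta>)
      + norm (wave_factor is \<eta>) * (norm (\<xi> - \<eta>) * (2 * radius)))"

lemma modulus_bound:
  assumes "length is \<le> N" "norm x \<le> 2 * radius"
  shows "norm (wave_factor is \<xi> * wave (- \<xi>) x - wave_factor is \<eta> * wave (- \<eta>) x) \<le> modulus N \<xi> \<eta>"
proof -
  have "wave_factor is \<xi> * wave (- \<xi>) x - wave_factor is \<eta> * wave (- \<eta>) x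
     = (wave_factor is \<xi> - wave_factor is \<eta>) * wave (- \<xi>) x + wave_factor is \<eta> * (wave (- \<xi>) x - wave (- \<eta>) x)"
    by (simp add: algebra_simps)
  also have "norm \<dots> \<le> norm (wave_factor is \<xi> - wave_factor is \<eta>) + norm (wave_factor is \<eta>) * (norm (\<xi> - \<eta>) * (2 * radius))"
  proof (rule norm_triangle_mono)
    show "norm ((wave_factor is \<xi> - wave_factor is \<eta>) * wave (- \<xi>) x) \<le> norm (wave_factor is \<xi> - wave_factor is \<eta>)"
      by (simp add: norm_mult)
    have "norm (wave (- \<xi>) x - wave (- \<eta>) x) \<le> norm (\<xi> - \<eta>) * norm x" by (rule norm_wave_diff)
    also have "\<dots> \<le> norm (\<xi> - \<eta>) * (2 * radius)" using assms by (intro mult_left_mono) auto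
    finally show "norm (wave_factor is \<eta> * (wave (- \<xi>) x - wave (- \<eta>) x)) \<le> norm (wave_factor is \<eta>) * (norm (\<xi> - \<eta>) * (2 * radius))"
      unfolding norm_mult by (intro mult_left_mono) auto
  qed
  also have "\<dots> \<le> modulus N \<xi> \<eta>"
    unfolding modulus_def using assms(1) radius(1)
    by (intro member_le_sum[of "is" "{is. length is \<le> N}" "\<lambda>is. norm (wave_factor is \<xi> - wave_factor is \<eta>)
      + norm (wave_factor is \<eta>) * (norm (\<xi> - \<eta>) * (2 * radius))"] finite_lists_le) auto
  finally show ?thesis .
qed

lemma modulus_nonneg: "modulus N \<xi> \<eta> \<ge> 0"
  unfolding modulus_def using radius(1) by (intro sum_nonneg) auto

lemma modulus_refl: "modulus N \<xi> \<xi> = 0"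
  by (simp add: modulus_def)

lemma continuous_modulus: "continuous_on UNIV (modulus N \<xi>)"
  unfolding modulus_def by (intro continuous_intros continuous_wave_factor)

lemma measurable_modulus:
  assumes "s \<in> borel_measurable borel"
  shows "(\<lambda>\<xi>. modulus N \<xi> (s \<xi>)) \<in> borel_measurable borel"
proof -
  have w: "wave_factor is \<in> borel_measurable borel" for "is"
    by (rule borel_measurable_continuous_onI[OF continuous_wave_factor])
  define W where "W = (\<lambda>is::'n list. \<lambda>\<xi>. wave_factor is \<xi>)"
  have [measurable]: "W is \<in> borel_measurable borel" for "is" using w by (simp add: W_def)
  note [measurable] = assms
  have "(\<lambda>\<xi>. \<Sum>is\<in>{is. length is \<le> N}. norm (W is \<xi> - W is (s \<xi>)) + norm (W is (s \<xi>)) * (norm (\<xi> - s \<xi>) * (2 * radius))) \<in> borel_measurable borel"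
    by measurable
  then show ?thesis by (simp only: modulus_def W_def)
qed

text \<open>Gives the integrable majorant when \<open>\<eta>\<close> is a simple approximation of
  \<open>\<xi>\<close>; these satisfy the bound \<open>2 * norm \<xi>\<close>.\<close>

lemma modulus_growth:
  obtains C where "\<And>\<xi> \<eta>. norm \<eta> \<le> 2 * norm \<xi> \<Longrightarrow> modulus N \<xi> \<eta> \<le> C * (1 + norm \<xi>) ^ (N + 1)"
proof -
  define n where "n = real (card {is::'n list. length is \<le> N})"
  \<comment> \<open>The summands bound \<open>wave_factor\<close> at \<open>\<xi>\<close>, at
    \<open>\<eta>\<close>, and the term with \<open>norm (\<xi> - \<eta>)\<close>; the 6 is the 3
    from \<open>norm (\<xi> - \<eta>) \<le> 3 * (1 + norm \<xi>)\<close> times the 2 of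
    \<open>2 * radius\<close>.\<close>
  define c where "c = 1 + 2 ^ N + 2 ^ N * (6 * radius)"
  show thesis
  proof (rule that[of "n * c"])
    fix \<xi> \<eta> :: "real^'n" assume le: "norm \<eta> \<le> 2 * norm \<xi>"
    let ?w = "1 + norm \<xi>"
    have w1: "?w \<ge> 1" by simp
    have "norm (wave_factor is \<xi> - wave_factor is \<eta>) + norm (wave_factor is \<eta>) * (norm (\<xi> - \<eta>) * (2 * radius)) \<le> c * ?w ^ (N + 1)"
      if l: "length is \<le> N" for "is" :: "'n list"
    proof -
      have p: "norm (wave_factor is \<xi>) \<le> ?w ^ (N + 1)"
        by (rule order_trans[OF norm_wave_factor_le power_increasing]) (use l w1 in auto)
      have "norm (wave_factor is \<eta>) \<le> (1 + norm \<eta>) ^ length is" by (rule norm_wave_factor_le)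
      also have "\<dots> \<le> (2 * ?w) ^ length is" using le by (intro power_mono) auto
      also have "\<dots> \<le> (2 * ?w) ^ N" using l w1 by (intro power_increasing) auto
      also have "\<dots> = 2 ^ N * ?w ^ N" by (rule power_mult_distrib)
      finally have q: "norm (wave_factor is \<eta>) \<le> 2 ^ N * ?w ^ N" .
      have q': "2 ^ N * ?w ^ N \<le> 2 ^ N * ?w ^ (N + 1)" using w1 by (intro mult_left_mono power_increasing) auto
      have d: "norm (\<xi> - \<eta>) * (2 * radius) \<le> (3 * ?w) * (2 * radius)"
      proof (rule mult_right_mono)
        have "norm (\<xi> - \<eta>) \<le> norm \<xi> + norm \<eta>" by (rule norm_triangle_ineq4)
        then show "norm (\<xi> - \<eta>) \<le> 3 * ?w" using le by (smt (verit) norm_ge_zero)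
      qed (use radius(1) in simp)
      have "norm (wave_factor is \<eta>) * (norm (\<xi> - \<eta>) * (2 * radius)) \<le> (2 ^ N * ?w ^ N) * ((3 * ?w) * (2 * radius))"
        using q d radius(1) by (intro mult_mono) auto
      also have "\<dots> = 2 ^ N * (6 * radius) * ?w ^ (N + 1)" by simp
      finally have r: "norm (wave_factor is \<eta>) * (norm (\<xi> - \<eta>) * (2 * radius)) \<le> 2 ^ N * (6 * radius) * ?w ^ (N + 1)" .
      have "norm (wave_factor is \<xi> - wave_factor is \<eta>) \<le> norm (wave_factor is \<xi>) + norm (wave_factor is \<eta>)"
        by (rule norm_triangle_ineq4)
      then have "norm (wave_factor is \<xi> - wave_factor is \<eta>) \<le> ?w ^ (N + 1) + 2 ^ N * ?w ^ (N + 1)"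
        using p q q' by linarith
      then show ?thesis using r unfolding c_def by (simp only: distrib_right mult_1_left)
    qed
    then have "modulus N \<xi> \<eta> \<le> (\<Sum>is\<in>{is::'n list. length is \<le> N}. c * ?w ^ (N + 1))"
      unfolding modulus_def by (intro sum_mono) auto
    then show "modulus N \<xi> \<eta> \<le> n * c * ?w ^ (N + 1)" by (simp add: n_def)
  qed
qed

text \<open>Each derivative of a plane wave costs at most one factor \<open>1 + norm \<xi>\<close>,
  so the order of \<open>\<phi>\<close> bounds the degree of growth.\<close>

lemma fourier_density_growth:
  obtains C N where "\<And>\<xi>. norm (fourier_density \<xi>) \<le> C * (1 + norm \<xi>) ^ N"
proof -
  obtain C N where CN: "C \<ge> 0" "\<And>f M. smooth f \<Longrightarrow>
    (\<And>is x. length is \<le> N \<Longrightarrow> norm x \<le> 2 * radius \<Longrightarrow> norm (iter_partial is f x) \<le> M) \<Longrightarrow>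
    norm (\<phi> (\<lambda>x. \<theta> x * f x)) \<le> C * M" by (rule continuity) blast
  show thesis
  proof (rule that[of C N])
    fix \<xi>
    show "norm (fourier_density \<xi>) \<le> C * (1 + norm \<xi>) ^ N" unfolding fourier_density_def
    proof (rule CN(2)[OF smooth_wave])
      fix "is" :: "'n list" and x assume l: "length is \<le> N"
      have "norm (iter_partial is (wave (- \<xi>)) x) \<le> (1 + norm \<xi>) ^ length is"
        unfolding iter_partial_wave norm_mult norm_wave mult_1_right by (rule norm_wave_factor_le)
      also have "\<dots> \<le> (1 + norm \<xi>) ^ N" using l by (intro power_increasing) auto
      finally show "norm (iter_partial is (wave (- \<xi>)) x) \<le> (1 + norm \<xi>) ^ N" .
    qed
  qed
qed

lemma continuous_fourier_density: "continuous_on UNIV fourier_density"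
proof -
  obtain C N where CN: "C \<ge> 0" "\<And>f M. smooth f \<Longrightarrow>
    (\<And>is x. length is \<le> N \<Longrightarrow> norm x \<le> 2 * radius \<Longrightarrow> norm (iter_partial is f x) \<le> M) \<Longrightarrow>
    norm (\<phi> (\<lambda>x. \<theta> x * f x)) \<le> C * M" by (rule continuity) blast
  have le: "norm (fourier_density \<xi> - fourier_density \<eta>) \<le> C * modulus N \<xi> \<eta>" for \<xi> \<eta>
  proof -
    have "fourier_density \<xi> - fourier_density \<eta> = \<phi> (\<lambda>x. \<theta> x * (wave (- \<xi>) x - wave (- \<eta>) x))"
      unfolding fourier_density_def by (rule cutoff_diff[OF smooth_wave smooth_wave, symmetric])
    also have "norm \<dots> \<le> C * modulus N \<xi> \<eta>"
    proof (rule CN(2)[OF smooth_diff[OF smooth_wave smooth_wave]])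
      fix "is" :: "'n list" and x :: "real^'n" assume l: "length is \<le> N" "norm x \<le> 2 * radius"
      have "iter_partial is (\<lambda>x. wave (- \<xi>) x - wave (- \<eta>) x) x = wave_factor is \<xi> * wave (- \<xi>) x - wave_factor is \<eta> * wave (- \<eta>) x"
        by (simp only: iter_partial_diff[OF smooth_wave smooth_wave] iter_partial_wave)
      then show "norm (iter_partial is (\<lambda>x. wave (- \<xi>) x - wave (- \<eta>) x) x) \<le> modulus N \<xi> \<eta>"
        using modulus_bound[OF l] by simp
    qed
    finally show ?thesis .
  qed
  have "isCont fourier_density \<xi>" for \<xi>
  proof -
    have "((\<lambda>\<eta>. C * modulus N \<xi> \<eta>) \<longlongrightarrow> C * modulus N \<xi> \<xi>) (at \<xi>)"
      using continuous_modulus[of N \<xi>] by (intro tendsto_intros) (simp add: continuous_on_def)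
    then have lim: "((\<lambda>\<eta>. C * modulus N \<xi> \<eta>) \<longlongrightarrow> 0) (at \<xi>)" by (simp add: modulus_refl)
    have "norm (fourier_density \<eta> - fourier_density \<xi>) \<le> C * modulus N \<xi> \<eta>" for \<eta>
      using le[of \<xi> \<eta>] by (simp only: norm_minus_commute)
    then have "eventually (\<lambda>\<eta>. norm (fourier_density \<eta> - fourier_density \<xi>) \<le> C * modulus N \<xi> \<eta>) (at \<xi>)"
      by (intro always_eventually allI)
    from Lim_null_comparison[OF this lim]
    have "((\<lambda>\<eta>. fourier_density \<eta> - fourier_density \<xi>) \<longlongrightarrow> 0) (at \<xi>)" .
    then show ?thesis unfolding isCont_def by (simp add: LIM_zero_iff)
  qed
  then show ?thesis by (simp add: continuous_at_imp_continuous_on)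
qed

text \<open>If \<open>\<xi>\<close> is replaced by simple functions of \<open>\<xi>\<close> converging to it, then \<open>fourier f\<close> becomes a
  finite combination of plane waves, to which the linearity of \<open>\<phi>\<close> applies.\<close>

lemma pairing_with_fourier:
  assumes f: "f \<in> schwartz_functions"
  shows "\<phi> (\<lambda>x. \<theta> x * fourier f x) = (LINT \<xi>|lborel. fourier_density \<xi> * f \<xi>)"
proof -
  obtain C N where CN: "C \<ge> 0" "\<And>f M. smooth f \<Longrightarrow>
    (\<And>is x. length is \<le> N \<Longrightarrow> norm x \<le> 2 * radius \<Longrightarrow> norm (iter_partial is f x) \<le> M) \<Longrightarrow>
    norm (\<phi> (\<lambda>x. \<theta> x * f x)) \<le> C * M" by (rule continuity) blast
  note fi = schwartz_integrable[OF f]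
  have [measurable]: "f \<in> borel_measurable borel" by (rule schwartz_measurable[OF f])
  obtain s :: "nat \<Rightarrow> real^'n \<Rightarrow> real^'n" where s: "\<And>n. simple_function lborel (s n)"
    "\<And>\<xi>. (\<lambda>n. s n \<xi>) \<longlonglongrightarrow> \<xi>" "\<And>n \<xi>. norm (s n \<xi>) \<le> 2 * norm \<xi>"
    using borel_measurable_implies_sequence_metric[of "\<lambda>\<xi>::real^'n. \<xi>" lborel 0] by auto
  have sm: "s n \<in> borel_measurable borel" for n
    using borel_measurable_simple_function[OF s(1)[of n]] by simp
  define a where "a = (\<lambda>n c. LINT \<xi>|lborel. f \<xi> * indicator (s n -` {c}) \<xi>)"
  have fin: "finite (range (s n))" for n using s(1)[of n] by (simp add: simple_function_def)
  \<comment> \<open>Replacing \<open>\<xi>\<close> by \<open>s n \<xi>\<close> in the exponential of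
    \<open>fourier f\<close> produces this finite sum of waves; the coefficients are integrals of
    \<open>f\<close> over the level sets.\<close>
  define S where "S = (\<lambda>n x. \<Sum>c\<in>range (s n). a n c * wave (- c) x)"
  have smS: "smooth (S n)" for n
    unfolding S_def using iter_partial_sum[OF fin smooth_wave] by blast
  have \<phi>S: "\<phi> (\<lambda>x. \<theta> x * S n x) = (LINT \<xi>|lborel. f \<xi> * fourier_density (s n \<xi>))" for n
  proof -
    have "(\<lambda>x. \<theta> x * S n x) = (\<lambda>x. \<Sum>c\<in>range (s n). a n c * (\<theta> x * wave (- c) x))"
      by (simp add: S_def sum_distrib_left mult_ac)
    moreover have "\<phi> (\<lambda>x. \<Sum>c\<in>range (s n). a n c * (\<theta> x * wave (- c) x)) = (\<Sum>c\<in>range (s n). a n c * \<phi> (\<lambda>x. \<theta> x * wave (- c) x))"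
      using linear_functional_sum[OF linear fin \<theta>_mult_test[OF smooth_wave[of 0]], of n "\<lambda>c x. \<theta> x * wave (- c) x" "a n"]
        \<theta>_mult_test[OF smooth_wave] by blast
    ultimately show ?thesis
      using integral_simple_function_argument(1)[OF s(1) fi, of fourier_density n]
      by (simp add: fourier_density_def a_def)
  qed
  define M where "M = (\<lambda>n. LINT \<xi>|lborel. norm (f \<xi>) * modulus N \<xi> (s n \<xi>))"
  obtain c where c: "\<And>\<xi> \<eta>. norm \<eta> \<le> 2 * norm \<xi> \<Longrightarrow> modulus N \<xi> \<eta> \<le> c * (1 + norm \<xi>) ^ (N + 1)"
    by (rule modulus_growth[of N]) blast
  have dom: "integrable lborel (\<lambda>\<xi>. c * ((1 + norm \<xi>) ^ (N + 1) * norm (f \<xi>)))"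
    by (intro integrable_mult_right schwartz_power_norm_integrable f)
  have dombound: "norm (norm (f \<xi>) * modulus N \<xi> (s n \<xi>)) \<le> c * ((1 + norm \<xi>) ^ (N + 1) * norm (f \<xi>))" for n \<xi>
    using mult_left_mono[OF c[OF s(3)[of n \<xi>]] norm_ge_zero[of "f \<xi>"]] modulus_nonneg[of N \<xi> "s n \<xi>"]
    by (simp add: abs_mult mult_ac)
  have mm: "(\<lambda>\<xi>. norm (f \<xi>) * modulus N \<xi> (s n \<xi>)) \<in> borel_measurable lborel" for n
    using measurable_modulus[OF sm[of n], of N] by simp
  have Mi: "integrable lborel (\<lambda>\<xi>. norm (f \<xi>) * modulus N \<xi> (s n \<xi>))" for n
  proof (rule Bochner_Integration.integrable_bound[OF dom mm])
    show "AE \<xi> in lborel. norm (norm (f \<xi>) * modulus N \<xi> (s n \<xi>)) \<le> norm (c * ((1 + norm \<xi>) ^ (N + 1) * norm (f \<xi>)))"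
      using dombound by (intro AE_I2) (metis abs_ge_self order_trans real_norm_def)
  qed
  have M0: "M \<longlonglongrightarrow> 0"
  proof -
    have "M \<longlonglongrightarrow> (LINT \<xi>::real^'n|lborel. (0::real))" unfolding M_def
    proof (rule integral_dominated_convergence[where w = "\<lambda>\<xi>. c * ((1 + norm \<xi>) ^ (N + 1) * norm (f \<xi>))"])
      show "AE \<xi> in lborel. (\<lambda>n. norm (f \<xi>) * modulus N \<xi> (s n \<xi>)) \<longlonglongrightarrow> 0"
      proof (rule AE_I2)
        fix \<xi> :: "real^'n"
        have "isCont (modulus N \<xi>) \<xi>"
          using continuous_modulus[of N \<xi>] by (meson UNIV_I continuous_on_eq_continuous_at open_UNIV)
        then have "(\<lambda>n. modulus N \<xi> (s n \<xi>)) \<longlonglongrightarrow> modulus N \<xi> \<xi>"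
          using s(2) by (rule isCont_tendsto_compose)
        then have "(\<lambda>n. norm (f \<xi>) * modulus N \<xi> (s n \<xi>)) \<longlonglongrightarrow> norm (f \<xi>) * modulus N \<xi> \<xi>"
          by (intro tendsto_intros)
        then show "(\<lambda>n. norm (f \<xi>) * modulus N \<xi> (s n \<xi>)) \<longlonglongrightarrow> 0" by (simp add: modulus_refl)
      qed
    qed (use dom mm dombound in auto)
    then show ?thesis by simp
  qed
  \<comment> \<open>All derivatives that \<open>\<phi>\<close> sees differ by at most
    \<open>M n\<close>, uniformly on the ball, so continuity of \<open>\<phi>\<close> transfers the
    convergence of the sums.\<close>
  have diff: "norm (\<phi> (\<lambda>x. \<theta> x * fourier f x) - \<phi> (\<lambda>x. \<theta> x * S n x)) \<le> C * M n" for n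
    unfolding cutoff_diff[OF smooth_fourier[OF f] smS, symmetric]
  proof (rule CN(2)[OF smooth_diff[OF smooth_fourier[OF f] smS]])
    fix "is" :: "'n list" and x :: "real^'n" assume l: "length is \<le> N" "norm x \<le> 2 * radius"
    have wf: "prod_list (map (\<lambda>j. - \<i> * complex_of_real (\<xi> $ j)) is) = wave_factor is \<xi>" for \<xi> by simp
    have 1: "iter_partial is (fourier f) x = (LINT \<xi>|lborel. f \<xi> * (wave_factor is \<xi> * wave (- \<xi>) x))"
      unfolding iter_partial_fourier(2)[OF f] fourier_wave wf
      by (intro Bochner_Integration.integral_cong refl) (simp add: wave_swap[of x] mult_ac)
    have i1: "integrable lborel (\<lambda>\<xi>. f \<xi> * (wave_factor is \<xi> * wave (- \<xi>) x))"
    proof -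
      have "integrable lborel (\<lambda>\<xi>. (wave_factor is \<xi> * f \<xi>) * wave (- x) \<xi>)"
        using integrable_mult_wave[OF schwartz_integrable[OF iter_partial_fourier(1)[OF f, of "is"]], of "- x"]
        unfolding wf .
      then show ?thesis by (simp add: wave_swap[of x] mult_ac)
    qed
    have "iter_partial is (S n) x = (\<Sum>c\<in>range (s n). a n c * (wave_factor is c * wave (- c) x))"
    proof -
      have "iter_partial is (\<lambda>x. \<Sum>c\<in>range (s n). a n c * wave (- c) x) = (\<lambda>x. \<Sum>c\<in>range (s n). a n c * iter_partial is (wave (- c)) x)"
        by (rule iter_partial_sum[THEN conjunct2, OF fin smooth_wave])
      then show ?thesis by (simp only: S_def iter_partial_wave)
    qed
    also have "\<dots> = (LINT \<xi>|lborel. f \<xi> * (wave_factor is (s n \<xi>) * wave (- s n \<xi>) x))"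
      using integral_simple_function_argument(1)[OF s(1) fi, of "\<lambda>c. wave_factor is c * wave (- c) x" n] by (simp add: a_def)
    finally have 2: "iter_partial is (S n) x = (LINT \<xi>|lborel. f \<xi> * (wave_factor is (s n \<xi>) * wave (- s n \<xi>) x))" .
    have i2: "integrable lborel (\<lambda>\<xi>. f \<xi> * (wave_factor is (s n \<xi>) * wave (- s n \<xi>) x))"
      by (rule integral_simple_function_argument(2)[OF s(1) fi, of "\<lambda>c. wave_factor is c * wave (- c) x"])
    have "iter_partial is (\<lambda>x. fourier f x - S n x) x = iter_partial is (fourier f) x - iter_partial is (S n) x"
      by (simp only: iter_partial_diff[OF smooth_fourier[OF f] smS])
    also have "\<dots> = (LINT \<xi>|lborel. f \<xi> * (wave_factor is \<xi> * wave (- \<xi>) x) - f \<xi> * (wave_factor is (s n \<xi>) * wave (- s n \<xi>) x))"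
      unfolding 1 2 by (rule Bochner_Integration.integral_diff[OF i1 i2, symmetric])
    also have "norm \<dots> \<le> M n" unfolding M_def
    proof (rule Bochner_Integration.integral_norm_bound_integral[OF Bochner_Integration.integrable_diff[OF i1 i2] Mi])
      fix \<xi>
      have "norm (f \<xi> * (wave_factor is \<xi> * wave (- \<xi>) x) - f \<xi> * (wave_factor is (s n \<xi>) * wave (- s n \<xi>) x))
        = norm (f \<xi>) * norm (wave_factor is \<xi> * wave (- \<xi>) x - wave_factor is (s n \<xi>) * wave (- s n \<xi>) x)"
        by (simp only: right_diff_distrib[symmetric] norm_mult)
      also have "\<dots> \<le> norm (f \<xi>) * modulus N \<xi> (s n \<xi>)"
        by (intro mult_left_mono modulus_bound l) auto
      finally show "norm (f \<xi> * (wave_factor is \<xi> * wave (- \<xi>) x) - f \<xi> * (wave_factor is (s n \<xi>) * wave (- s n \<xi>) x)) \<le> norm (f \<xi>) * modulus N \<xi> (s n \<xi>)" .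
    qed
    finally show "norm (iter_partial is (\<lambda>x. fourier f x - S n x) x) \<le> M n" .
  qed
  have lim1: "(\<lambda>n. \<phi> (\<lambda>x. \<theta> x * S n x)) \<longlonglongrightarrow> \<phi> (\<lambda>x. \<theta> x * fourier f x)"
  proof -
    have "(\<lambda>n. C * M n) \<longlonglongrightarrow> C * 0" by (intro tendsto_intros M0)
    then have lim: "(\<lambda>n. C * M n) \<longlonglongrightarrow> 0" by simp
    have "norm (\<phi> (\<lambda>x. \<theta> x * S n x) - \<phi> (\<lambda>x. \<theta> x * fourier f x)) \<le> C * M n" for n
      using diff[of n] by (simp only: norm_minus_commute)
    then have "eventually (\<lambda>n. norm (\<phi> (\<lambda>x. \<theta> x * S n x) - \<phi> (\<lambda>x. \<theta> x * fourier f x)) \<le> C * M n) sequentially"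
      by (intro always_eventually allI)
    from Lim_null_comparison[OF this lim]
    have "(\<lambda>n. \<phi> (\<lambda>x. \<theta> x * S n x) - \<phi> (\<lambda>x. \<theta> x * fourier f x)) \<longlonglongrightarrow> 0" .
    then show ?thesis by (simp add: LIM_zero_iff)
  qed
  obtain D m where D: "\<And>\<xi>. norm (fourier_density \<xi>) \<le> D * (1 + norm \<xi>) ^ m" by (rule fourier_density_growth) blast
  have D0: "D \<ge> 0" using order_trans[OF norm_ge_zero D[of 0]] by simp
  have [measurable]: "fourier_density \<in> borel_measurable borel" by (rule borel_measurable_continuous_onI[OF continuous_fourier_density])
  have "(\<lambda>n. LINT \<xi>|lborel. f \<xi> * fourier_density (s n \<xi>)) \<longlonglongrightarrow> (LINT \<xi>|lborel. f \<xi> * fourier_density \<xi>)"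
  proof (rule integral_dominated_convergence[where w = "\<lambda>\<xi>. (D * 2 ^ m) * ((1 + norm \<xi>) ^ m * norm (f \<xi>))"])
    show "(\<lambda>\<xi>. f \<xi> * fourier_density \<xi>) \<in> borel_measurable lborel" by measurable
    show "(\<lambda>\<xi>. f \<xi> * fourier_density (s n \<xi>)) \<in> borel_measurable lborel" for n
      using measurable_compose[OF sm[of n], of fourier_density borel] by simp
    show "integrable lborel (\<lambda>\<xi>. (D * 2 ^ m) * ((1 + norm \<xi>) ^ m * norm (f \<xi>)))"
      by (intro integrable_mult_right schwartz_power_norm_integrable f)
    show "AE \<xi> in lborel. (\<lambda>n. f \<xi> * fourier_density (s n \<xi>)) \<longlonglongrightarrow> f \<xi> * fourier_density \<xi>"
    proof (rule AE_I2)
      fix \<xi>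
      have "isCont fourier_density \<xi>"
        using continuous_fourier_density by (meson UNIV_I continuous_on_eq_continuous_at open_UNIV)
      then have "(\<lambda>n. fourier_density (s n \<xi>)) \<longlonglongrightarrow> fourier_density \<xi>"
        using s(2) by (rule isCont_tendsto_compose)
      then show "(\<lambda>n. f \<xi> * fourier_density (s n \<xi>)) \<longlonglongrightarrow> f \<xi> * fourier_density \<xi>" by (intro tendsto_intros)
    qed
    show "AE \<xi> in lborel. norm (f \<xi> * fourier_density (s n \<xi>)) \<le> (D * 2 ^ m) * ((1 + norm \<xi>) ^ m * norm (f \<xi>))" for n
    proof (rule AE_I2)
      fix \<xi>
      have "norm (fourier_density (s n \<xi>)) \<le> D * (1 + norm (s n \<xi>)) ^ m" by (rule D)
      also have "\<dots> \<le> D * (2 * (1 + norm \<xi>)) ^ m" using s(3)[of n \<xi>] D0 by (intro mult_left_mono power_mono) auto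
      finally have "norm (fourier_density (s n \<xi>)) \<le> D * 2 ^ m * (1 + norm \<xi>) ^ m" unfolding power_mult_distrib mult.assoc .
      from mult_right_mono[OF this norm_ge_zero[of "f \<xi>"]]
      show "norm (f \<xi> * fourier_density (s n \<xi>)) \<le> (D * 2 ^ m) * ((1 + norm \<xi>) ^ m * norm (f \<xi>))"
        unfolding norm_mult by (simp add: mult_ac)
    qed
  qed
  then have "(\<lambda>n. \<phi> (\<lambda>x. \<theta> x * S n x)) \<longlonglongrightarrow> (LINT \<xi>|lborel. f \<xi> * fourier_density \<xi>)" unfolding \<phi>S .
  from LIMSEQ_unique[OF lim1 this] show ?thesis by (simp add: mult.commute)
qed

text \<open>The explicit density qualifies for the choice, so the chosen one qualifies too; both
  represent the same functional and are continuous, hence equal.\<close>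

lemma density_of_eq: "density_of (fourier_distr (tempered_extension \<phi>)) = fourier_density"
proof -
  let ?P = "\<lambda>g. continuous_on UNIV g \<and>
    (\<forall>f\<in>schwartz_functions. integrable lborel (\<lambda>\<xi>. g \<xi> * f \<xi>) \<and> fourier_distr (tempered_extension \<phi>) f = function_distr g f)"
  obtain C N where CN: "\<And>\<xi>. norm (fourier_density \<xi>) \<le> C * (1 + norm \<xi>) ^ N" by (rule fourier_density_growth) blast
  have P: "?P fourier_density"
    using continuous_fourier_density moderate_growth_schwartz_integrable[OF continuous_fourier_density CN]
      tempered_extension_eq[OF fourier_schwartz] pairing_with_fourier
    by (simp add: fourier_distr_def function_distr_def)
  then have Q: "?P (density_of (fourier_distr (tempered_extension \<phi>)))"
    unfolding density_of_def by (rule someI[of ?P])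
  show ?thesis
  proof (rule continuous_eq_if_pairings_eq)
    fix f :: "real^'n \<Rightarrow> complex" assume "f \<in> test_functions"
    then have f: "f \<in> schwartz_functions" by (rule test_subset_schwartz)
    show "integrable lborel (\<lambda>x. density_of (fourier_distr (tempered_extension \<phi>)) x * f x)" using Q f by blast
    show "integrable lborel (\<lambda>x. fourier_density x * f x)" using P f by blast
    show "(LINT x|lborel. density_of (fourier_distr (tempered_extension \<phi>)) x * f x) = (LINT x|lborel. fourier_density x * f x)"
      using P Q f unfolding function_distr_def by metis
  qed (use P Q in auto)
qed

text \<open>Brings \<open>\<phi>\<close> into the form that the propagator has by definition, so
  that one regularization argument serves both.\<close>

lemma \<phi>_eq_inv_fourier:
  assumes f: "f \<in> test_functions"
  shows "\<phi> f = (LINT \<xi>|lborel. fourier_density \<xi> * inv_fourier f \<xi>)"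
proof -
  note fs = test_subset_schwartz[OF f]
  have "\<phi> f = \<phi> (\<lambda>x. \<theta> x * f x)" by (rule localize[OF f test_smooth[OF f]]) simp
  also have "\<dots> = \<phi> (\<lambda>x. \<theta> x * fourier (inv_fourier f) x)" by (simp only: fourier_inv_fourier[OF fs])
  also have "\<dots> = (LINT \<xi>|lborel. fourier_density \<xi> * inv_fourier f \<xi>)"
    by (rule pairing_with_fourier[OF inv_fourier_schwartz[OF fs]])
  finally show ?thesis .
qed

lemma propagator_eq:
  "propagator \<omega> t \<phi> f = (LINT \<xi>|lborel. (exp (- \<i> * of_real (t * \<omega> \<xi>)) * fourier_density \<xi>) * inv_fourier f \<xi>)"
  by (simp add: propagator_def fourier_multiplier_def inv_fourier_distr_def function_distr_def density_of_eq)

end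

section \<open>Regularization\<close>

lemma inv_fourier_translate:
  fixes f :: "real ^ 'n \<Rightarrow> complex"
  assumes f: "f \<in> borel_measurable borel"
  shows "inv_fourier (\<lambda>y. f (y - x)) \<xi> = exp (\<i> * of_real (x \<bullet> \<xi>)) * inv_fourier f \<xi>"
proof -
  have m: "(\<lambda>y. f (y - x) * exp (\<i> * of_real (\<xi> \<bullet> y))) \<in> borel_measurable borel" using f by measurable
  have "(LINT y|lborel. f (y - x) * exp (\<i> * of_real (\<xi> \<bullet> y))) = (LINT y|lborel. f ((x + 1 *\<^sub>R y) - x) * exp (\<i> * of_real (\<xi> \<bullet> (x + 1 *\<^sub>R y))))"
    using lborel_affine_integrable(2)[OF m, of 1 x] by simp
  also have "\<dots> = (LINT y|lborel. exp (\<i> * of_real (x \<bullet> \<xi>)) * (f y * exp (\<i> * of_real (\<xi> \<bullet> y))))"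
    by (intro Bochner_Integration.integral_cong refl)
       (simp add: inner_add_right distrib_left exp_add inner_commute mult_ac)
  also have "\<dots> = exp (\<i> * of_real (x \<bullet> \<xi>)) * (LINT y|lborel. f y * exp (\<i> * of_real (\<xi> \<bullet> y)))"
    by (rule integral_mult_right_zero)
  finally show ?thesis by (simp add: inv_fourier_def)
qed

lemma inv_fourier_comb:
  fixes f :: "real ^ 'n \<Rightarrow> complex"
  assumes "f \<in> schwartz_functions" "g \<in> schwartz_functions"
  shows "inv_fourier (\<lambda>x. a * f x + b * g x) \<xi> = a * inv_fourier f \<xi> + b * inv_fourier g \<xi>"
  unfolding inv_fourier_eq
  by (subst fourier_add) (intro schwartz_integrable schwartz_cmult assms | simp add: fourier_cmult add_divide_distrib)+

text \<open>The evolved functional is known only through its density. Linearity is what lets it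
  vanish on test functions supported off its support.\<close>

lemma linear_functional_pairing:
  fixes \<kappa> :: "real ^ 'n \<Rightarrow> complex"
  assumes \<kappa>: "continuous_on UNIV \<kappa>" "\<And>\<xi>. norm (\<kappa> \<xi>) \<le> C * (1 + norm \<xi>) ^ N"
    and u: "\<And>h. h \<in> test_functions \<Longrightarrow> u h = (LINT \<xi>|lborel. \<kappa> \<xi> * inv_fourier h \<xi>)"
  shows "linear_functional_on test_functions u"
  unfolding linear_functional_on_def
proof (intro ballI allI)
  fix f g :: "real ^ 'n \<Rightarrow> complex" and a b :: complex
  assume fg: "f \<in> test_functions" "g \<in> test_functions"
  note s = test_subset_schwartz[OF fg(1)] test_subset_schwartz[OF fg(2)]
  have i: "integrable lborel (\<lambda>\<xi>. \<kappa> \<xi> * inv_fourier f \<xi>)" "integrable lborel (\<lambda>\<xi>. \<kappa> \<xi> * inv_fourier g \<xi>)"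
    by (intro moderate_growth_schwartz_integrable[OF \<kappa>] inv_fourier_schwartz s)+
  have "u (\<lambda>x. a * f x + b * g x) = (LINT \<xi>|lborel. \<kappa> \<xi> * (a * inv_fourier f \<xi> + b * inv_fourier g \<xi>))"
    using u[OF test_add[OF test_cmult[OF fg(1)] test_cmult[OF fg(2)]]] by (simp only: inv_fourier_comb[OF s])
  also have "\<dots> = (LINT \<xi>|lborel. a * (\<kappa> \<xi> * inv_fourier f \<xi>) + b * (\<kappa> \<xi> * inv_fourier g \<xi>))"
    by (simp only: distrib_left mult.left_commute)
  also have "\<dots> = (LINT \<xi>|lborel. a * (\<kappa> \<xi> * inv_fourier f \<xi>)) + (LINT \<xi>|lborel. b * (\<kappa> \<xi> * inv_fourier g \<xi>))"
    by (intro Bochner_Integration.integral_add integrable_mult_right i)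
  also have "\<dots> = a * u f + b * u g"
    by (simp only: integral_mult_right_zero u fg)
  finally show "u (\<lambda>x. a * f x + b * g x) = a * u f + b * u g" .
qed

text \<open>Regularizing the distribution with transform \<open>\<kappa>\<close> by a test function gives a continuous
  function of compact support, so that Fourier inversion for functions applies.\<close>

lemma compactly_supported_regularization:
  fixes \<kappa> :: "real ^ 'n \<Rightarrow> complex"
  assumes \<kappa>: "continuous_on UNIV \<kappa>" "\<And>\<xi>. norm (\<kappa> \<xi>) \<le> C * (1 + norm \<xi>) ^ N"
    and u: "\<And>h. h \<in> test_functions \<Longrightarrow> u h = (LINT \<xi>|lborel. \<kappa> \<xi> * inv_fourier h \<xi>)"
    and supp: "compact (distr_support u)" and f: "f \<in> test_functions"
  obtains b \<rho> where "continuous_on UNIV b" "\<rho> \<ge> 0" "\<And>x. norm x > \<rho> \<Longrightarrow> b x = 0"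
    "\<And>\<eta>. \<kappa> \<eta> * inv_fourier f \<eta> = fourier b \<eta>"
proof -
  note fs = test_subset_schwartz[OF f] and lin = linear_functional_pairing[OF \<kappa> u]
  define K where "K = (\<lambda>\<xi>. \<kappa> \<xi> * inv_fourier f \<xi>)"
  note ifs = inv_fourier_schwartz[OF fs]
  have Kcont: "continuous_on UNIV K"
    unfolding K_def by (intro continuous_on_mult \<kappa> smooth_continuous schwartz_smooth ifs)
  have Kint: "integrable lborel K"
    unfolding K_def by (rule moderate_growth_schwartz_integrable[OF \<kappa> ifs])
  have [measurable]: "K \<in> borel_measurable borel" by (rule borel_measurable_continuous_onI[OF Kcont])
  have Kb: "norm (K \<xi>) \<le> C * schwartz_seminorm N 0 (inv_fourier f)" for \<xi>
  proof -
    have C: "C \<ge> 0" using order_trans[OF norm_ge_zero \<kappa>(2)[of 0]] by simp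
    have "norm (K \<xi>) \<le> C * (1 + norm \<xi>) ^ N * norm (inv_fourier f \<xi>)"
      unfolding K_def norm_mult by (intro mult_right_mono \<kappa>) auto
    also have "\<dots> \<le> C * schwartz_seminorm N 0 (inv_fourier f)"
      using schwartz_seminorm_ge[OF ifs, of "[]" 0 \<xi> N] C by (simp add: mult.assoc mult_left_mono)
    finally show ?thesis .
  qed
  define B where "B = (\<lambda>x. LINT \<xi>|lborel. K \<xi> * exp (\<i> * of_real (x \<bullet> \<xi>)))"
  have tr: "(\<lambda>y. f (y - x)) \<in> test_functions" and trs: "fun_support (\<lambda>y. f (y - x)) \<subseteq> (+) x ` fun_support f" for x
  proof -
    have sm: "smooth (\<lambda>y. f (y - x))" using smooth_affine[OF test_smooth[OF f], of 1 "- x"] by simp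
    have c: "compact ((+) x ` fun_support f)" using compact_translation[OF test_compact[OF f]] .
    have z: "f (y - x) = 0" if "y \<notin> (+) x ` fun_support f" for y
    proof -
      have "y - x \<notin> fun_support f"
      proof
        assume "y - x \<in> fun_support f"
        then have "x + (y - x) \<in> (+) x ` fun_support f" by (rule imageI)
        then show False using that by simp
      qed
      then show ?thesis by (rule notin_fun_support)
    qed
    show "(\<lambda>y. f (y - x)) \<in> test_functions" by (rule test_functionI[OF sm c z])
    show "fun_support (\<lambda>y. f (y - x)) \<subseteq> (+) x ` fun_support f" by (rule fun_support_subset[OF compact_imp_closed[OF c] z])
  qed
  \<comment> \<open>Translating \<open>f\<close> multiplies its inverse transform by a wave, so the
    regularization \<open>x \<mapsto> u (f (- x + \<cdot>))\<close> is the inverse-type integral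
    \<open>B\<close> of \<open>K\<close>.\<close>
  have uB: "u (\<lambda>y. f (y - x)) = B x" for x
  proof -
    have "u (\<lambda>y. f (y - x)) = (LINT \<xi>|lborel. \<kappa> \<xi> * (exp (\<i> * of_real (x \<bullet> \<xi>)) * inv_fourier f \<xi>))"
      by (simp only: u[OF tr] inv_fourier_translate[OF schwartz_measurable[OF fs]])
    then show ?thesis by (simp add: B_def K_def mult_ac)
  qed
  obtain R where R: "distr_support u \<subseteq> cball 0 R"
    using bounded_subset_ballD[OF compact_imp_bounded[OF supp]] ball_subset_cball by (metis order_trans)
  obtain A where A: "fun_support f \<subseteq> cball 0 A"
    using bounded_subset_ballD[OF compact_imp_bounded[OF test_compact[OF f]]] ball_subset_cball by (metis order_trans)
  \<comment> \<open>Beyond the sum of the two radii the translated support of \<open>f\<close>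
    misses the support of \<open>u\<close>.\<close>
  define \<rho> where "\<rho> = \<bar>R\<bar> + \<bar>A\<bar>"
  have B0: "B x = 0" if "norm x > \<rho>" for x
  proof -
    have "fun_support (\<lambda>y. f (y - x)) \<inter> distr_support u = {}"
    proof (rule ccontr)
      assume "fun_support (\<lambda>y. f (y - x)) \<inter> distr_support u \<noteq> {}"
      then obtain y where y: "y \<in> (+) x ` fun_support f" "norm y \<le> R" using trs[of x] R by fastforce
      then obtain w where w: "y = x + w" "norm w \<le> A" using A by auto
      have "norm x \<le> norm y + norm w" using w(1) by (metis add_diff_cancel_right' norm_triangle_ineq4)
      then show False using that y w by (simp add: \<rho>_def)
    qed
    then show ?thesis using vanishes_off_support[OF lin tr] uB by metis
  qed
  have Bm: "(\<lambda>\<xi>. K \<xi> * exp (\<i> * of_real (x \<bullet> \<xi>))) \<in> borel_measurable lborel" for x by measurable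
  have Bcont: "continuous_on UNIV B"
  proof -
    have "isCont B x" for x
    proof (rule continuous_at_sequentiallyI)
      fix s :: "nat \<Rightarrow> real^'n" assume s: "s \<longlonglongrightarrow> x"
      show "(\<lambda>n. B (s n)) \<longlonglongrightarrow> B x" unfolding B_def
      proof (rule integral_dominated_convergence[OF Bm Bm integrable_norm[OF Kint]])
        show "AE \<xi> in lborel. (\<lambda>n. K \<xi> * exp (\<i> * of_real (s n \<bullet> \<xi>))) \<longlonglongrightarrow> K \<xi> * exp (\<i> * of_real (x \<bullet> \<xi>))"
          by (intro AE_I2 tendsto_intros s)
        show "AE \<xi> in lborel. norm (K \<xi> * exp (\<i> * of_real (s n \<bullet> \<xi>))) \<le> norm (K \<xi>)" for n
          by (intro AE_I2) (simp add: norm_mult)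
      qed
    qed
    then show ?thesis by (simp add: continuous_at_imp_continuous_on)
  qed
  have Bint: "integrable lborel B"
  proof (rule integrable_if_decaying[of _ "(1 + \<rho>) ^ (2 * DIM(real^'n)) * (LINT \<xi>|lborel. norm (K \<xi>))"])
    show "B \<in> borel_measurable borel" by (rule borel_measurable_continuous_onI[OF Bcont])
    show "(1 + norm x) ^ (2 * DIM(real^'n)) * norm (B x) \<le> (1 + \<rho>) ^ (2 * DIM(real^'n)) * (LINT \<xi>|lborel. norm (K \<xi>))" for x
    proof (cases "norm x > \<rho>")
      case True
      have "0 \<le> (1 + \<rho>) ^ (2 * DIM(real^'n)) * (LINT \<xi>|lborel. norm (K \<xi>))"
        by (intro mult_nonneg_nonneg zero_le_power Bochner_Integration.integral_nonneg) (auto simp: \<rho>_def)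
      then show ?thesis using B0[OF True] by simp
    next
      case False
      have "norm (B x) \<le> (LINT \<xi>|lborel. norm (K \<xi> * exp (\<i> * of_real (x \<bullet> \<xi>))))"
        unfolding B_def by (rule integral_norm_bound)
      then have "norm (B x) \<le> (LINT \<xi>|lborel. norm (K \<xi>))" by (simp add: norm_mult)
      then show ?thesis using False by (intro mult_mono power_mono) (auto simp: \<rho>_def)
    qed
  qed
  define c where "c = complex_of_real ((2 * pi) ^ DIM(real^'n))"
  have c0: "c \<noteq> 0" by (simp add: c_def)
  have inv: "(LINT x|lborel. B x * exp (- \<i> * of_real (x \<bullet> \<eta>))) = c * K \<eta>" for \<eta>
    unfolding c_def B_def
    by (rule fourier_inversion[OF Kcont Kint Kb]) (use Bint in \<open>simp only: B_def\<close>)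
  show thesis
  proof (rule that[of "\<lambda>x. (1 / c) * B x" \<rho>])
    show "continuous_on UNIV (\<lambda>x. (1 / c) * B x)" by (intro continuous_intros Bcont)
    show "\<rho> \<ge> 0" by (simp add: \<rho>_def)
    show "(1 / c) * B x = 0" if "norm x > \<rho>" for x using B0[OF that] by simp
    have "fourier B \<eta> = c * K \<eta>" for \<eta> unfolding fourier_def by (rule inv)
    then show "\<kappa> \<eta> * inv_fourier f \<eta> = fourier (\<lambda>x. (1 / c) * B x) \<eta>" for \<eta>
      using c0 by (simp only: fourier_cmult K_def) simp
  qed
qed

text \<open>Compact support of \<open>b\<close> lets the frequency along the line become complex. On
  the support the kernel has modulus at most
  \<open>exp (\<rho> * norm v * \<bar>Im z\<bar>)\<close>, by the Cauchy-Schwarz inequality.\<close>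

lemma fourier_line_extension:
  fixes b :: "real ^ 'n \<Rightarrow> complex"
  assumes b: "continuous_on UNIV b" and z: "\<And>x. norm x > \<rho> \<Longrightarrow> b x = 0"
  obtains G where "G holomorphic_on UNIV" "\<And>s. G (of_real s) = fourier b (p + s *\<^sub>R v)"
    "\<And>z. norm (G z) \<le> (LINT x|lborel. norm (b x)) * exp (\<rho> * norm v * \<bar>Im z\<bar>)"
proof -
  define F where "F = (\<lambda>z x. b x * exp (- \<i> * (of_real (x \<bullet> p) + z * of_real (x \<bullet> v))))"
  define G where "G = (\<lambda>z. LINT x|lborel. F z x)"
  \<comment> \<open>The integral is taken over a box, the domain for which differentiation in a
    complex parameter is used.\<close>
  obtain a where a: "cball (0::real^'n) \<rho> \<subseteq> cbox (- a) a"
    using bounded_subset_cbox_symmetric[OF bounded_cball] by metis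
  have Fz: "F z x = 0" if "x \<notin> cbox (- a) a" for z x
  proof -
    have "norm x > \<rho>" using a that by (auto simp: not_le)
    then show ?thesis using assms(2) by (simp add: F_def)
  qed
  have Fcont: "continuous_on UNIV (F z)" for z
    unfolding F_def by (intro continuous_intros b)
  have ind: "(\<lambda>x. indicator (cbox (- a) a) x *\<^sub>R F z x) = F z" for z
    using Fz by (auto simp: indicator_def)
  have Fint: "integrable lborel (F z)" for z
    using borel_integrable_compact[OF compact_cbox continuous_on_subset[OF Fcont subset_UNIV], of "- a" a z] by (simp only: ind)
  have GI: "G z = integral (cbox (- a) a) (F z)" and FI: "F z integrable_on cbox (- a) a" for z
  proof -
    have s: "set_integrable lborel (cbox (- a) a) (F z)" unfolding set_integrable_def ind by (rule Fint)
    show "G z = integral (cbox (- a) a) (F z)"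
      using set_borel_integral_eq_integral(2)[OF s] unfolding set_lebesgue_integral_def ind G_def .
    show "F z integrable_on cbox (- a) a" using set_borel_integral_eq_integral(1)[OF s] .
  qed
  have "(\<lambda>z. integral (cbox (- a) a) (F z)) holomorphic_on UNIV"
  proof (rule leibniz_rule_holomorphic[where fx = "\<lambda>z x. F z x * (- \<i> * of_real (x \<bullet> v))"])
    show "((\<lambda>z. F z x) has_field_derivative F z x * (- \<i> * of_real (x \<bullet> v))) (at z within UNIV)" for z x
      unfolding F_def by (auto intro!: derivative_eq_intros simp: algebra_simps)
    show "F z integrable_on cbox (- a) a" for z by (rule FI)
    have "continuous_on (UNIV \<times> cbox (- a) a) (\<lambda>q. b (snd q) * exp (- \<i> * (of_real (snd q \<bullet> p) + fst q * of_real (snd q \<bullet> v))) * (- \<i> * of_real (snd q \<bullet> v)))"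
      by (intro continuous_intros continuous_on_compose2[OF b]) auto
    then show "continuous_on (UNIV \<times> cbox (- a) a) (\<lambda>(z, x). F z x * (- \<i> * of_real (x \<bullet> v)))"
      by (simp add: F_def case_prod_unfold)
  qed simp
  then have hol: "G holomorphic_on UNIV" using GI by (simp add: GI[abs_def])
  have bn: "integrable lborel (\<lambda>x. norm (b x))"
  proof -
    have z: "(\<lambda>x. indicator (cbox (- a) a) x *\<^sub>R b x) = b"
      using a assms(2) by (auto simp: indicator_def fun_eq_iff) (metis mem_box(2) mem_cball_0 not_le subsetD)
    have "integrable lborel (\<lambda>x. indicator (cbox (- a) a) x *\<^sub>R b x)"
      by (rule borel_integrable_compact[OF compact_cbox continuous_on_subset[OF b subset_UNIV]])
    then show ?thesis unfolding z by (rule integrable_norm)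
  qed
  show thesis
  proof (rule that[OF hol])
    show "G (of_real s) = fourier b (p + s *\<^sub>R v)" for s
      unfolding G_def F_def fourier_def by (simp add: inner_add_right)
    fix z
    have "norm (G z) \<le> (LINT x|lborel. norm (b x) * exp (\<rho> * norm v * \<bar>Im z\<bar>))"
      unfolding G_def
    proof (rule Bochner_Integration.integral_norm_bound_integral[OF Fint integrable_mult_left[OF bn]])
      fix x
      show "norm (F z x) \<le> norm (b x) * exp (\<rho> * norm v * \<bar>Im z\<bar>)"
      proof (cases "norm x > \<rho>")
        case True
        then show ?thesis using assms(2) by (simp add: F_def)
      next
        case False
        have "(x \<bullet> v) * Im z \<le> \<bar>x \<bullet> v\<bar> * \<bar>Im z\<bar>" by (metis abs_ge_self abs_mult)
        also have "\<dots> \<le> (norm x * norm v) * \<bar>Im z\<bar>" by (intro mult_right_mono Cauchy_Schwarz_ineq2) auto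
        also have "\<dots> \<le> (\<rho> * norm v) * \<bar>Im z\<bar>" using False by (intro mult_right_mono) auto
        finally have "(x \<bullet> v) * Im z \<le> \<rho> * norm v * \<bar>Im z\<bar>" .
        then show ?thesis by (simp add: F_def norm_mult mult_left_mono mult.commute)
      qed
    qed
    then show "norm (G z) \<le> (LINT x|lborel. norm (b x)) * exp (\<rho> * norm v * \<bar>Im z\<bar>)" by simp
  qed
qed

section \<open>Separately affine functions\<close>

definition upd :: "real ^ 'n \<Rightarrow> 'n \<Rightarrow> real \<Rightarrow> real ^ 'n" where
  "upd \<xi> j s = (\<chi> i. if i = j then s else \<xi> $ i)"

lemma upd_line: "upd \<xi> j s = upd \<xi> j 0 + s *\<^sub>R axis j 1"
  by (simp add: upd_def vec_eq_iff axis_def)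

lemma upd_same [simp]: "upd \<xi> j (\<xi> $ j) = \<xi>"
  by (simp add: upd_def vec_eq_iff)

lemma upd_upd_same [simp]: "upd (upd \<xi> j s) j r = upd \<xi> j r"
  by (simp add: upd_def vec_eq_iff)

lemma upd_commute: "j \<noteq> k \<Longrightarrow> upd (upd \<xi> j s) k r = upd (upd \<xi> k r) j s"
  by (simp add: upd_def vec_eq_iff)

lemma continuous_upd: "continuous_on UNIV (\<lambda>\<xi>. upd \<xi> j s)"
  unfolding upd_def
proof (rule continuous_on_vec_lambda)
  show "continuous_on UNIV (\<lambda>\<xi>. if i = j then s else \<xi> $ i)" for i
    by (cases "i = j") (auto intro!: continuous_intros)
qed

text \<open>The slope in the \<open>j\<close>th variable is itself affine in each other variable. Being bounded, it is
  constant, which excludes mixed terms such as \<open>\<xi>\<^sub>1 \<xi>\<^sub>2\<close>.\<close>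

lemma separately_affine_imp_affine:
  fixes \<omega> :: "real ^ 'n \<Rightarrow> real"
  defines "D \<equiv> \<lambda>j \<xi>. \<omega> (upd \<xi> j 1) - \<omega> (upd \<xi> j 0)"
  assumes aff: "\<And>\<xi> j s. \<omega> (upd \<xi> j s) = \<omega> (upd \<xi> j 0) + s * D j \<xi>" and bd: "\<And>j \<xi>. \<bar>D j \<xi>\<bar> \<le> B"
  shows "\<omega> \<xi> = \<omega> 0 + (\<Sum>j\<in>UNIV. D j 0 * \<xi> $ j)"
proof -
  have slope: "D j (upd \<xi> k s) = D j (upd \<xi> k 0)" for j k \<xi> s
  proof (cases "j = k")
    case True
    then show ?thesis by (simp add: D_def)
  next
    case False
    define e where "e = D k (upd \<xi> j 1) - D k (upd \<xi> j 0)"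
    have lin: "D j (upd \<xi> k r) = D j (upd \<xi> k 0) + r * e" for r
    proof -
      have sw: "D j (upd \<xi> k r) = \<omega> (upd (upd \<xi> j 1) k r) - \<omega> (upd (upd \<xi> j 0) k r)" for r
        using False by (simp add: D_def upd_commute[of k j])
      show ?thesis unfolding sw e_def aff[of "upd \<xi> j 1" k r] aff[of "upd \<xi> j 0" k r]
        by (simp add: algebra_simps)
    qed
    have "e = 0"
    proof (rule ccontr)
      assume e: "e \<noteq> 0"
      \<comment> \<open>Large enough that the slope at \<open>r\<close> exceeds \<open>B\<close> by
        at least 1, whatever the sign of the slope at 0.\<close>
      define r where "r = (B + \<bar>D j (upd \<xi> k 0)\<bar> + 1) / e"
      have "D j (upd \<xi> k r) = D j (upd \<xi> k 0) + (B + \<bar>D j (upd \<xi> k 0)\<bar> + 1)"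
        using lin[of r] e by (simp add: r_def)
      then show False using bd[of j "upd \<xi> k r"] by linarith
    qed
    then show ?thesis using lin by simp
  qed
  \<comment> \<open>The coordinates of \<open>\<xi>\<close> are switched on one at a time, and by
    constancy of the slopes each adds its slope at the origin times its value.\<close>
  define x where "x = (\<lambda>A. \<chi> i. if i \<in> A then \<xi> $ i else 0)"
  have xi: "x (insert k A) = upd (x A) k (\<xi> $ k)" for k A
    by (simp add: x_def upd_def vec_eq_iff)
  have x0: "upd (x A) k 0 = x A" if "k \<notin> A" for k A
    using that by (simp add: x_def upd_def vec_eq_iff)
  have Dx: "D j (x A) = D j 0" if "finite A" for A j
    using that
  proof (induction A rule: finite_induct)
    case empty
    have "x {} = 0" by (simp add: x_def vec_eq_iff)
    then show ?case by simp
  next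
    case (insert k A)
    then show ?case unfolding xi slope[of j "x A" k "\<xi> $ k"] x0[OF insert(2)] by blast
  qed
  have "\<omega> (x A) = \<omega> 0 + (\<Sum>j\<in>A. D j 0 * \<xi> $ j)" if "finite A" for A
    using that
  proof (induction A rule: finite_induct)
    case empty
    have "x {} = 0" by (simp add: x_def vec_eq_iff)
    then show ?case by simp
  next
    case (insert k A)
    have "\<omega> (x (insert k A)) = \<omega> (x A) + \<xi> $ k * D k (x A)"
      unfolding xi aff[of "x A" k "\<xi> $ k"] x0[OF insert(2)] ..
    then show ?case using insert Dx[OF insert(1), of k] by (simp add: algebra_simps)
  qed
  moreover have "x UNIV = \<xi>" by (simp add: x_def vec_eq_iff)
  ultimately show ?thesis by (metis finite)
qed

text \<open>The multi-indices of order at most one are zero and the unit vectors \<open>u j\<close>,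
  so the coefficients are \<open>w\<close> and the \<open>c j\<close>.\<close>

lemma affine_as_multiindex_sum:
  fixes \<omega> :: "real ^ 'n \<Rightarrow> real"
  assumes "\<And>\<xi>. \<omega> \<xi> = w + (\<Sum>j\<in>UNIV. c j * \<xi> $ j)"
  shows "\<exists>a :: ('n \<Rightarrow> nat) \<Rightarrow> real. \<forall>\<xi>. \<omega> \<xi> = (\<Sum>\<alpha> | (\<Sum>i\<in>UNIV. \<alpha> i) \<le> 1. a \<alpha> * (\<Prod>i\<in>UNIV. (\<xi> $ i) ^ \<alpha> i))"
proof -
  define u :: "'n \<Rightarrow> 'n \<Rightarrow> nat" where "u = (\<lambda>j i. if i = j then 1 else 0)"
  have inj: "inj u" by (auto simp: inj_def u_def fun_eq_iff split: if_splits)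
  have u0: "u j \<noteq> (\<lambda>_. 0)" for j by (auto simp: u_def fun_eq_iff)
  have eq: "{\<alpha> :: 'n \<Rightarrow> nat. (\<Sum>i\<in>UNIV. \<alpha> i) \<le> 1} = insert (\<lambda>_. 0) (range u)"
  proof (intro equalityI subsetI)
    fix \<alpha> :: "'n \<Rightarrow> nat" assume "\<alpha> \<in> {\<alpha>. (\<Sum>i\<in>UNIV. \<alpha> i) \<le> 1}"
    then have le: "(\<Sum>i\<in>UNIV. \<alpha> i) \<le> 1" by simp
    show "\<alpha> \<in> insert (\<lambda>_. 0) (range u)"
    proof (cases "\<alpha> = (\<lambda>_. 0)")
      case False
      then obtain j where j: "\<alpha> j \<noteq> 0" by auto
      have s: "(\<Sum>i\<in>UNIV. \<alpha> i) = \<alpha> j + (\<Sum>i\<in>UNIV - {j}. \<alpha> i)" by (simp add: sum.remove)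
      then have "\<alpha> j = 1" "(\<Sum>i\<in>UNIV - {j}. \<alpha> i) = 0" using le j by linarith+
      then have "\<alpha> = u j" by (auto simp: u_def fun_eq_iff)
      then show ?thesis by auto
    qed auto
  next
    fix \<alpha> :: "'n \<Rightarrow> nat" assume "\<alpha> \<in> insert (\<lambda>_. 0) (range u)"
    then show "\<alpha> \<in> {\<alpha>. (\<Sum>i\<in>UNIV. \<alpha> i) \<le> 1}" by (auto simp: u_def)
  qed
  define a where "a = (\<lambda>\<alpha>. if \<alpha> = (\<lambda>_. 0) then w else c (inv u \<alpha>))"
  have "(\<Sum>\<alpha> | (\<Sum>i\<in>UNIV. \<alpha> i) \<le> 1. a \<alpha> * (\<Prod>i\<in>UNIV. (\<xi> $ i) ^ \<alpha> i)) = \<omega> \<xi>" for \<xi>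
  proof -
    have "(\<Sum>\<alpha> | (\<Sum>i\<in>UNIV. \<alpha> i) \<le> 1. a \<alpha> * (\<Prod>i\<in>UNIV. (\<xi> $ i) ^ \<alpha> i))
      = w + (\<Sum>\<alpha>\<in>range u. a \<alpha> * (\<Prod>i\<in>UNIV. (\<xi> $ i) ^ \<alpha> i))"
    proof -
      have "(\<lambda>_. 0) \<notin> range u" using u0 by (metis rangeE)
      then show ?thesis unfolding eq by (subst sum.insert) (simp_all add: a_def)
    qed
    also have "(\<Sum>\<alpha>\<in>range u. a \<alpha> * (\<Prod>i\<in>UNIV. (\<xi> $ i) ^ \<alpha> i)) = (\<Sum>j\<in>UNIV. a (u j) * (\<Prod>i\<in>UNIV. (\<xi> $ i) ^ u j i))"
      by (simp add: sum.reindex[OF inj] o_def)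
    also have "\<dots> = (\<Sum>j\<in>UNIV. c j * \<xi> $ j)"
    proof (intro sum.cong refl)
      fix j
      have "(\<Prod>i\<in>UNIV. (\<xi> $ i) ^ u j i) = (\<Prod>i\<in>UNIV. if i = j then \<xi> $ i else 1)"
        by (intro prod.cong refl) (simp add: u_def)
      then show "a (u j) * (\<Prod>i\<in>UNIV. (\<xi> $ i) ^ u j i) = c j * \<xi> $ j"
        using u0[of j] inv_f_f[OF inj, of j] by (simp add: a_def)
    qed
    finally show ?thesis using assms[of \<xi>] by simp
  qed
  then show ?thesis by metis
qed

section \<open>Dispersion relations\<close>

text \<open>Here \<open>P\<close> and \<open>exp (- i t \<omega>) P\<close> are the Fourier transforms of regularizations of \<open>\<phi>\<close> and of
  \<open>U(t)\<phi>\<close>; the compactness of the supports enters only through the entire extensions along lines.\<close>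

locale dispersive_pair =
  fixes \<omega> :: "real ^ 'n \<Rightarrow> real" and t :: real and P :: "real ^ 'n \<Rightarrow> complex" and C R :: real
  assumes cont: "continuous_on UNIV \<omega>" and t: "t \<noteq> 0" and R: "R \<ge> 0" and nonzero: "\<exists>\<xi>. P \<xi> \<noteq> 0"
    and line: "\<And>p v. \<exists>G H. G holomorphic_on UNIV \<and> H holomorphic_on UNIV \<and>
      (\<forall>s. G (of_real s) = P (p + s *\<^sub>R v)) \<and>
      (\<forall>s. H (of_real s) = exp (- \<i> * of_real (t * \<omega> (p + s *\<^sub>R v))) * P (p + s *\<^sub>R v)) \<and>
      (\<forall>z. norm (G z) \<le> C * exp (R * norm v * \<bar>Im z\<bar>)) \<and> (\<forall>z. norm (H z) \<le> C * exp (R * norm v * \<bar>Im z\<bar>))"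
begin

text \<open>On the line from a point of \<open>V\<close> to a point where \<open>P\<close> is
  nonzero, the entire extension would vanish near the parameter 0 and hence at the parameter
  1.\<close>

lemma zero_set_has_empty_interior:
  assumes V: "open V" "x \<in> V" shows "\<exists>y\<in>V. P y \<noteq> 0"
proof (rule ccontr)
  assume "\<not> ?thesis"
  then have z: "\<And>y. y \<in> V \<Longrightarrow> P y = 0" by blast
  obtain \<xi> where \<xi>: "P \<xi> \<noteq> 0" using nonzero by blast
  obtain G where G: "G holomorphic_on UNIV" "\<And>s. G (of_real s) = P (x + s *\<^sub>R (\<xi> - x))"
    using line[of x "\<xi> - x"] by blast
  have "((\<lambda>s. x + s *\<^sub>R (\<xi> - x)) \<longlongrightarrow> x + 0 *\<^sub>R (\<xi> - x)) (nhds (0::real))"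
    by (intro tendsto_intros filterlim_ident)
  then have "eventually (\<lambda>s. x + s *\<^sub>R (\<xi> - x) \<in> V) (nhds (0::real))"
    using V by (auto simp: tendsto_def)
  then obtain d where d: "d > 0" "\<And>s. dist s 0 < d \<Longrightarrow> x + s *\<^sub>R (\<xi> - x) \<in> V"
    unfolding eventually_nhds_metric by blast
  have "(0::complex) islimpt of_real ` ball 0 d"
    unfolding islimpt_approachable
  proof (intro allI impI)
    fix e :: real assume e: "e > 0"
    define m where "m = min e d / 2"
    have "m > 0" "m < e" "m < d" using e d(1) by (auto simp: m_def)
    then show "\<exists>x'\<in>complex_of_real ` ball 0 d. x' \<noteq> 0 \<and> dist x' 0 < e"
      by (intro bexI[of _ "of_real m"] conjI imageI) auto
  qed
  then have "G 1 = 0"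
    by (rule analytic_continuation[OF G(1) open_UNIV connected_UNIV subset_UNIV UNIV_I])
       (use G(2) d(2) z in \<open>auto simp: dist_commute\<close>)
  then show False using G(2)[of 1] \<xi> by simp
qed

lemma slice_continuous: "continuous_on UNIV (\<lambda>s. \<omega> (p + s *\<^sub>R v))"
  by (intro continuous_on_compose2[OF cont] continuous_intros) auto

lemma line_slit_extension:
  assumes "P (p + s0 *\<^sub>R v) \<noteq> 0"
  shows "\<exists>E F. slit_extension (\<lambda>s. \<omega> (p + s *\<^sub>R v)) E F \<and> open (slit_plane E) \<and> simply_connected (slit_plane E)"
proof -
  obtain G H where GH: "G holomorphic_on UNIV" "H holomorphic_on UNIV" "\<And>s. G (of_real s) = P (p + s *\<^sub>R v)"
    "\<And>s. H (of_real s) = exp (- \<i> * of_real (t * \<omega> (p + s *\<^sub>R v))) * G (of_real s)"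
    using line[of p v] by metis
  have nz: "G (of_real s0) \<noteq> 0" using assms GH(3) by simp
  show ?thesis
    using slit_extension_quotient[OF GH(1) nz GH(2) slice_continuous t GH(4)]
      contractible_imp_simply_connected[OF contractible_slit_plane] by blast
qed

lemma line_affine:
  assumes nz: "P (p + s0 *\<^sub>R v) \<noteq> 0"
    and ext: "slit_extension (\<lambda>s. \<omega> (p + s *\<^sub>R v)) E F"
    and punct: "\<And>p. p \<in> E \<Longrightarrow> holomorphic_on_punctured_disk_at (slit_plane E) F p"
  shows "\<exists>m b. (\<forall>s. \<omega> (p + s *\<^sub>R v) = m * s + b) \<and> \<bar>t * m\<bar> \<le> 2 * (R * norm v)"
proof -
  obtain G H where GH: "G holomorphic_on UNIV" "H holomorphic_on UNIV" "\<And>s. G (of_real s) = P (p + s *\<^sub>R v)"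
    "\<And>s. H (of_real s) = exp (- \<i> * of_real (t * \<omega> (p + s *\<^sub>R v))) * G (of_real s)"
    "\<And>z. norm (G z) \<le> C * exp (R * norm v * \<bar>Im z\<bar>)" "\<And>z. norm (H z) \<le> C * exp (R * norm v * \<bar>Im z\<bar>)"
    using line[of p v] by metis
  have nz: "G (of_real s0) \<noteq> 0" using nz GH(3) by simp
  have Rv: "R * norm v \<ge> 0" using R by simp
  show ?thesis
    by (rule slice_affine[OF GH(1) nz GH(2) slice_continuous t GH(4-6) Rv ext punct]) blast+
qed

lemma slice_eq: "slice \<omega> j y = (\<lambda>s. \<omega> ((\<chi> i. if i = j then 0 else y i) + s *\<^sub>R axis j 1))"
  unfolding slice_def by (intro ext arg_cong[of _ _ \<omega>]) (simp add: vec_eq_iff axis_def)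

text \<open>\<open>P\<close> vanishes everywhere over \<open>Z\<close>. Were \<open>Z\<close>
  nonempty and open, its preimage under the projection would be a nonempty open set of zeros of
  \<open>P\<close>. The empty set, which is open, is the other alternative.\<close>

lemma slices_extend:
  "\<exists>Z E F. Z \<subseteq> topspace (remaining_top j) \<and> (Z = {} \<or> \<not> openin (remaining_top j) Z) \<and>
     extends_off \<omega> j Z E F \<and>
     (\<forall>y \<in> topspace (remaining_top j) - Z. open (slit_plane (E y)) \<and> simply_connected (slit_plane (E y)))"
proof -
  define pt where "pt = (\<lambda>y. \<chi> i. if i = j then (0::real) else y i)"
  define Z where "Z = {y \<in> topspace (remaining_top j). \<forall>s. P (pt y + s *\<^sub>R axis j 1) = 0}"
  have "\<exists>E F. slit_extension (slice \<omega> j y) E F \<and> open (slit_plane E) \<and> simply_connected (slit_plane E)"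
    if "y \<in> topspace (remaining_top j) - Z" for y
  proof -
    obtain s0 where "P (pt y + s0 *\<^sub>R axis j 1) \<noteq> 0" using \<open>y \<in> _\<close> unfolding Z_def by blast
    then show ?thesis unfolding slice_eq using line_slit_extension[of "pt y" s0 "axis j 1"] by (simp add: pt_def)
  qed
  then obtain E F where EF: "\<And>y. y \<in> topspace (remaining_top j) - Z \<Longrightarrow>
      slit_extension (slice \<omega> j y) (E y) (F y) \<and> open (slit_plane (E y)) \<and> simply_connected (slit_plane (E y))"
    by metis
  have "\<not> openin (remaining_top j) Z" if Zne: "Z \<noteq> {}"
  proof
    assume op: "openin (remaining_top j) Z"
    define r where "r = (\<lambda>\<xi>::real^'n. restrict (\<lambda>i. \<xi> $ i) (- {j}))"
    have "continuous_map euclidean (remaining_top j) r"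
      unfolding continuous_map_componentwise r_def by (auto intro!: continuous_intros)
    then have "openin euclidean {\<xi> \<in> topspace euclidean. r \<xi> \<in> Z}"
      using op by (rule openin_continuous_map_preimage)
    then have oV: "open {\<xi>. r \<xi> \<in> Z}" by simp
    obtain y where y: "y \<in> Z" using Zne by blast
    then have "y \<in> extensional (- {j})" by (auto simp: Z_def PiE_def)
    then have "r (pt y) = y" by (auto simp: r_def pt_def fun_eq_iff extensional_def)
    then obtain \<xi> where \<xi>: "r \<xi> \<in> Z" "P \<xi> \<noteq> 0"
      using zero_set_has_empty_interior[OF oV, of "pt y"] y by auto
    \<comment> \<open>The point \<open>\<xi>\<close> lies on the line over its own
      projection.\<close>
    have "pt (r \<xi>) + (\<xi> $ j) *\<^sub>R axis j 1 = \<xi>" by (simp add: pt_def r_def vec_eq_iff axis_def)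
    then show False using \<xi> unfolding Z_def by (metis (mono_tags, lifting) mem_Collect_eq)
  qed
  moreover have "Z \<subseteq> topspace (remaining_top j)" by (auto simp: Z_def)
  ultimately show ?thesis
    using EF unfolding extends_off_def by (intro exI[of _ Z] exI[of _ E] exI[of _ F]) blast
qed

lemma one_dimensional_extension:
  assumes "CARD('n) = 1"
  shows "\<exists>E F. slit_extension (\<lambda>s. \<omega> (\<chi> i. s)) E F"
proof -
  obtain k where k: "(UNIV :: 'n set) = {k}" using assms by (metis card_1_singletonE)
  obtain \<xi> where \<xi>: "P \<xi> \<noteq> 0" using nonzero by blast
  have eq: "(0 :: real ^ 'n) + s *\<^sub>R (\<chi> i. 1) = (\<chi> i. s)" for s by (simp add: vec_eq_iff)
  have "\<xi> = (\<chi> i. \<xi> $ k)" using k by (auto simp: vec_eq_iff)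
  then have "P (0 + (\<xi> $ k) *\<^sub>R (\<chi> i. 1)) \<noteq> 0" using \<xi> unfolding eq by simp
  from line_slit_extension[OF this] show ?thesis unfolding eq by blast
qed

lemma affine_if_extensions_punctured:
  assumes ext: "\<And>j. extends_off \<omega> j {} (E j) (F j)"
    and punct: "\<And>j y p. y \<in> topspace (remaining_top j) \<Longrightarrow> p \<in> E j y \<Longrightarrow>
       holomorphic_on_punctured_disk_at (slit_plane (E j y)) (F j y) p"
  shows "\<exists>a :: ('n \<Rightarrow> nat) \<Rightarrow> real. \<forall>\<xi>. \<omega> \<xi> = (\<Sum>\<alpha> | (\<Sum>i\<in>UNIV. \<alpha> i) \<le> 1. a \<alpha> * (\<Prod>i\<in>UNIV. (\<xi> $ i) ^ \<alpha> i))"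
proof -
  define D where "D = (\<lambda>j \<xi>. \<omega> (upd \<xi> j 1) - \<omega> (upd \<xi> j 0))"
  \<comment> \<open>The line through \<open>\<xi>\<close> in direction \<open>j\<close> meets the
    set where \<open>P\<close> is nonzero at \<open>\<xi>\<close> itself. As the direction has norm
    1, the slope bound is the same for all lines and all \<open>j\<close>.\<close>
  have good: "\<omega> (upd \<xi> j s) = \<omega> (upd \<xi> j 0) + s * D j \<xi> \<and> \<bar>t * D j \<xi>\<bar> \<le> 2 * R" if \<xi>: "P \<xi> \<noteq> 0" for \<xi> j s
  proof -
    define y where "y = restrict (\<lambda>i. \<xi> $ i) (- {j})"
    have y: "y \<in> topspace (remaining_top j)" by (simp add: y_def)
    have pt: "(\<chi> i. if i = j then 0 else y i) = upd \<xi> j 0" by (simp add: upd_def y_def vec_eq_iff)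
    have "slit_extension (slice \<omega> j y) (E j y) (F j y)"
      using ext[of j] y unfolding extends_off_def by blast
    then have "slit_extension (\<lambda>s. \<omega> (upd \<xi> j 0 + s *\<^sub>R axis j 1)) (E j y) (F j y)"
      unfolding slice_eq pt .
    moreover have "P (upd \<xi> j 0 + (\<xi> $ j) *\<^sub>R axis j 1) \<noteq> 0" using \<xi> by (simp add: upd_line[symmetric])
    ultimately obtain m b where mb: "\<And>s. \<omega> (upd \<xi> j 0 + s *\<^sub>R axis j 1) = m * s + b" "\<bar>t * m\<bar> \<le> 2 * (R * norm (axis j (1::real) :: real^'n))"
      using line_affine[OF _ _ punct[OF y]] by metis
    then have u: "\<omega> (upd \<xi> j s) = m * s + b" for s by (subst upd_line) simp
    then have "D j \<xi> = m" by (simp add: D_def)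
    then show ?thesis using u mb(2) by simp
  qed
  have dense: "closure {\<xi>. P \<xi> \<noteq> 0} = UNIV"
  proof (rule ccontr)
    assume "closure {\<xi>. P \<xi> \<noteq> 0} \<noteq> UNIV"
    then obtain x where "x \<in> - closure {\<xi>. P \<xi> \<noteq> 0}" by blast
    then obtain y where "y \<in> - closure {\<xi>. P \<xi> \<noteq> 0}" "P y \<noteq> 0"
      using zero_set_has_empty_interior[of "- closure {\<xi>. P \<xi> \<noteq> 0}" x] by auto
    then show False using closure_subset[of "{\<xi>. P \<xi> \<noteq> 0}"] by blast
  qed
  have c: "continuous_on UNIV (\<lambda>\<xi>. \<omega> (upd \<xi> j s))" for j s
    by (rule continuous_on_compose2[OF cont continuous_upd]) auto
  \<comment> \<open>Both conditions are closed in \<open>\<xi>\<close> by continuity of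
    \<open>\<omega>\<close>, so they pass from the dense set to every point, including lines on
    which \<open>P\<close> vanishes identically.\<close>
  have all: "\<omega> (upd \<xi> j s) = \<omega> (upd \<xi> j 0) + s * D j \<xi> \<and> \<bar>t * D j \<xi>\<bar> \<le> 2 * R" for \<xi> j s
  proof -
    have "closed {\<xi>. \<omega> (upd \<xi> j s) = \<omega> (upd \<xi> j 0) + s * D j \<xi> \<and> \<bar>t * D j \<xi>\<bar> \<le> 2 * R}"
      unfolding D_def by (intro closed_Collect_conj closed_Collect_eq closed_Collect_le continuous_intros c)
    then have "closure {\<xi>. P \<xi> \<noteq> 0} \<subseteq> {\<xi>. \<omega> (upd \<xi> j s) = \<omega> (upd \<xi> j 0) + s * D j \<xi> \<and> \<bar>t * D j \<xi>\<bar> \<le> 2 * R}"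
      using good by (intro closure_minimal) auto
    then show ?thesis unfolding dense by blast
  qed
  have bound: "\<bar>D j \<xi>\<bar> \<le> 2 * R / \<bar>t\<bar>" for j \<xi>
    using all[of \<xi> j 0] t by (simp add: abs_mult field_simps)
  have "\<omega> \<xi> = \<omega> 0 + (\<Sum>j\<in>UNIV. D j 0 * \<xi> $ j)" for \<xi>
    using separately_affine_imp_affine[of \<omega> "2 * R / \<bar>t\<bar>" \<xi>] all bound unfolding D_def by blast
  then show ?thesis by (rule affine_as_multiindex_sum)
qed

end

theorem theorem2p1:
  fixes \<omega> :: "real ^ 'n \<Rightarrow> real"
    and \<phi> :: "(real ^ 'n \<Rightarrow> complex) \<Rightarrow> complex"
    and t :: real
  assumes "continuous_on UNIV \<omega>"
    and "\<phi> \<in> compactly_supported_distributions"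
    and "nonzero_distribution \<phi>"
    and "t \<noteq> 0"
    and "compact (distr_support (propagator \<omega> t \<phi>))"
  shows
    "(CARD('n) \<ge> 2 \<longrightarrow>
       (\<forall>j. \<exists>Z E F. Z \<subseteq> topspace (remaining_top j) \<and>
          (Z = {} \<or> \<not> openin (remaining_top j) Z) \<and>
          extends_off \<omega> j Z E F \<and>
          (\<forall>y \<in> topspace (remaining_top j) - Z.
             open (slit_plane (E y)) \<and> simply_connected (slit_plane (E y))))) \<and>
     (CARD('n) = 1 \<longrightarrow>
       (\<exists>E F. slit_extension (\<lambda>s. \<omega> (\<chi> i. s)) E F)) \<and>
     (\<forall>Z E F.
        (\<forall>j. extends_off \<omega> j (Z j) (E j) (F j)) \<longrightarrow>
        (\<forall>j. Z j = {}) \<longrightarrow>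
        (\<forall>j. \<forall>y \<in> topspace (remaining_top j). \<forall>p \<in> E j y.
           holomorphic_on_punctured_disk_at (slit_plane (E j y)) (F j y) p) \<longrightarrow>
        (\<exists>a :: ('n \<Rightarrow> nat) \<Rightarrow> real. \<forall>\<xi>.
           \<omega> \<xi> = (\<Sum>\<alpha> | (\<Sum>i\<in>UNIV. \<alpha> i) \<le> 1. a \<alpha> * (\<Prod>i\<in>UNIV. (\<xi> $ i) ^ \<alpha> i))))"
proof -
  interpret compactly_supported \<phi> using assms(2) by unfold_locales
  obtain f where f: "f \<in> test_functions" "\<phi> f \<noteq> 0" using assms(3) by (auto simp: nonzero_distribution_def)
  define m where "m = (\<lambda>\<xi>. exp (- \<i> * complex_of_real (t * \<omega> \<xi>)))"
  define P where "P = (\<lambda>\<xi>. fourier_density \<xi> * inv_fourier f \<xi>)"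
  obtain C0 N where growth: "\<And>\<xi>. norm (fourier_density \<xi>) \<le> C0 * (1 + norm \<xi>) ^ N"
    by (rule fourier_density_growth) blast
  have mcont: "continuous_on UNIV (\<lambda>\<xi>. m \<xi> * fourier_density \<xi>)"
    unfolding m_def by (intro continuous_intros assms(1) continuous_fourier_density)
  \<comment> \<open>The multiplier has modulus one, so the evolved density grows no faster.\<close>
  have mgrowth: "norm (m \<xi> * fourier_density \<xi>) \<le> C0 * (1 + norm \<xi>) ^ N" for \<xi>
    using growth[of \<xi>] by (simp add: m_def norm_mult)
  have supp: "compact (distr_support \<phi>)" using assms(2) by (simp add: compactly_supported_distributions_def)
  obtain b1 \<rho>1 where b1: "continuous_on UNIV b1" "\<rho>1 \<ge> 0" "\<And>x. norm x > \<rho>1 \<Longrightarrow> b1 x = 0"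
    "\<And>\<eta>. fourier_density \<eta> * inv_fourier f \<eta> = fourier b1 \<eta>"
    by (rule compactly_supported_regularization[OF continuous_fourier_density growth \<phi>_eq_inv_fourier supp f(1)]) blast+
  have propm: "propagator \<omega> t \<phi> h = (LINT \<xi>|lborel. (m \<xi> * fourier_density \<xi>) * inv_fourier h \<xi>)" for h
    by (simp only: propagator_eq m_def)
  obtain b2 \<rho>2 where b2: "continuous_on UNIV b2" "\<rho>2 \<ge> 0" "\<And>x. norm x > \<rho>2 \<Longrightarrow> b2 x = 0"
    "\<And>\<eta>. (m \<eta> * fourier_density \<eta>) * inv_fourier f \<eta> = fourier b2 \<eta>"
    by (rule compactly_supported_regularization[OF mcont mgrowth propm assms(5) f(1)]) blast+
  define C where "C = max (LINT x|lborel. norm (b1 x)) (LINT x|lborel. norm (b2 x))"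
  define R where "R = max \<rho>1 \<rho>2"
  interpret dispersive_pair \<omega> t P C R
  proof
    show "R \<ge> 0" using b1(2) by (simp add: R_def)
    \<comment> \<open>\<open>\<phi> f\<close> is the integral of \<open>P\<close>, and
      \<open>f\<close> was chosen to make it nonzero.\<close>
    show "\<exists>\<xi>. P \<xi> \<noteq> 0"
    proof (rule ccontr)
      assume "\<not> ?thesis"
      then have "fourier_density \<xi> * inv_fourier f \<xi> = 0" for \<xi> unfolding P_def by blast
      then have "(\<lambda>\<xi>. fourier_density \<xi> * inv_fourier f \<xi>) = (\<lambda>_. 0)" by (rule ext)
      then have "\<phi> f = 0" unfolding \<phi>_eq_inv_fourier[OF f(1)] by (simp only: Bochner_Integration.integral_zero)
      then show False using f by simp
    qed
    fix p v :: "real^'n"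
    \<comment> \<open>Passes from the separate constants of the two regularizations to common
      \<open>C\<close> and \<open>R\<close>.\<close>
    have le: "norm w \<le> C * exp (R * norm v * \<bar>Im z\<bar>)"
      if "norm w \<le> D * exp (\<rho> * norm v * \<bar>Im z\<bar>)" "\<rho> \<le> R" "D \<le> C" "D \<ge> 0" for w z :: complex and D \<rho>
    proof -
      have "exp (\<rho> * norm v * \<bar>Im z\<bar>) \<le> exp (R * norm v * \<bar>Im z\<bar>)" using that(2) by (simp add: mult_right_mono)
      then have "D * exp (\<rho> * norm v * \<bar>Im z\<bar>) \<le> C * exp (R * norm v * \<bar>Im z\<bar>)" using that by (intro mult_mono) auto
      then show ?thesis using that(1) by simp
    qed
    obtain G where G: "G holomorphic_on UNIV" "\<And>s. G (of_real s) = fourier b1 (p + s *\<^sub>R v)"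
      "\<And>z. norm (G z) \<le> (LINT x|lborel. norm (b1 x)) * exp (\<rho>1 * norm v * \<bar>Im z\<bar>)"
      by (rule fourier_line_extension[OF b1(1,3), where p = p and v = v]) blast+
    obtain H where H: "H holomorphic_on UNIV" "\<And>s. H (of_real s) = fourier b2 (p + s *\<^sub>R v)"
      "\<And>z. norm (H z) \<le> (LINT x|lborel. norm (b2 x)) * exp (\<rho>2 * norm v * \<bar>Im z\<bar>)"
      by (rule fourier_line_extension[OF b2(1,3), where p = p and v = v]) blast+
    have "norm (G z) \<le> C * exp (R * norm v * \<bar>Im z\<bar>)" for z
      by (rule le[OF G(3)]) (simp_all add: R_def C_def)
    moreover have "norm (H z) \<le> C * exp (R * norm v * \<bar>Im z\<bar>)" for z
      by (rule le[OF H(3)]) (simp_all add: R_def C_def)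
    moreover have "G (of_real s) = P (p + s *\<^sub>R v)" for s by (simp add: G(2) P_def b1(4))
    moreover have "H (of_real s) = exp (- \<i> * of_real (t * \<omega> (p + s *\<^sub>R v))) * P (p + s *\<^sub>R v)" for s
      unfolding H(2) b2(4)[symmetric] P_def m_def by (simp only: mult.assoc)
    ultimately show "\<exists>G H. G holomorphic_on UNIV \<and> H holomorphic_on UNIV \<and>
      (\<forall>s. G (of_real s) = P (p + s *\<^sub>R v)) \<and>
      (\<forall>s. H (of_real s) = exp (- \<i> * of_real (t * \<omega> (p + s *\<^sub>R v))) * P (p + s *\<^sub>R v)) \<and>
      (\<forall>z. norm (G z) \<le> C * exp (R * norm v * \<bar>Im z\<bar>)) \<and> (\<forall>z. norm (H z) \<le> C * exp (R * norm v * \<bar>Im z\<bar>))"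
      using G(1) H(1) by blast
  qed (use assms in auto)
  show ?thesis
  proof (intro conjI impI allI)
    fix Z E F
    assume "\<forall>j. extends_off \<omega> j (Z j) (E j) (F j)" "\<forall>j. Z j = {}"
      "\<forall>j. \<forall>y \<in> topspace (remaining_top j). \<forall>p \<in> E j y. holomorphic_on_punctured_disk_at (slit_plane (E j y)) (F j y) p"
    then show "\<exists>a :: ('n \<Rightarrow> nat) \<Rightarrow> real. \<forall>\<xi>. \<omega> \<xi> = (\<Sum>\<alpha> | (\<Sum>i\<in>UNIV. \<alpha> i) \<le> 1. a \<alpha> * (\<Prod>i\<in>UNIV. (\<xi> $ i) ^ \<alpha> i))"
      by (intro affine_if_extensions_punctured[of E F]) auto
  qed (use slices_extend one_dimensional_extension in blast)+
qed

end
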